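(* Let $I_0\subset\mathbb{R}$ be an interval, let $f\in C^{(3)}(I_0)$, and let $\mathcal{C}_f:=\{(x,f(x)):x\in I_0\}$. Let $\psi$ be an approximating function of order $\lambda(\psi)>1$ and assume that $\dim\{x\in I_0:f''(x)=0\}\le 2/(1+\lambda(\psi))$. Then $$\dim\big(\mathcal{C}_f\cap\mathcal{S}^*_2(\psi)\big)=\frac{2}{1+\lambda(\psi)}.$$
   Context: $\dim$ denotes Hausdorff dimension. $C^{(3)}(I_0)$ is the set of three times continuously differentiable real functions on the (non-degenerate) interval $I_0$. An approximating function is a decreasing function $\psi:\mathbb{R}^+\to\mathbb{R}^+$ (with positive real values). Saying that $\psi$ has order $\lambda(\psi)$ means that the limit $$\lambda(\psi):=\lim_{h\to\infty}\frac{-\log\psi(h)}{\log h}$$ exists (as a real number) and is positive. For $x\in\mathbb{R}$ put $\|x\|=\min\{|x-m|:m\in\mathbb{Z}\}$. $\mathcal{S}^*_2(\psi)$ is the set of $(y_1,y_2)\in\mathbb{R}^2$ for which there are infinitely many $q\in\mathbb{N}$ such that $\|qy_1\|\cdot\|qy_2\|<\psi(q)$. *)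

theory Defs
  imports "HOL-Analysis.Analysis"
begin

section \<open>Hausdorff measure and dimension\<close>

text \<open>The contribution \<open>diam(U)^s\<close> of a covering set, with the usual conventions that the empty set
  contributes \<open>0\<close> and that \<open>0^0 = 1\<close> (whereas \<open>0 powr 0 = 0\<close>).\<close>

definition diam_pow :: "real \<Rightarrow> 'a::metric_space set \<Rightarrow> ennreal" where
  "diam_pow s U = (if U = {} then 0 else if s = 0 then 1 else ennreal (diameter U powr s))"

text \<open>Boundedness is required explicitly, as \<^const>\<open>diameter\<close> is unspecified on unbounded sets.
  Covers are sequences; finite covers are obtained by padding with empty sets.\<close>

definition delta_covers :: "real \<Rightarrow> 'a::metric_space set \<Rightarrow> (nat \<Rightarrow> 'a set) set" where
  "delta_covers \<delta> A = {U. (\<forall>i. bounded (U i) \<and> diameter (U i) \<le> \<delta>) \<and> A \<subseteq> (\<Union>i. U i)}"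

definition hausdorff_premeasure :: "real \<Rightarrow> real \<Rightarrow> 'a::metric_space set \<Rightarrow> ennreal" where
  "hausdorff_premeasure s \<delta> A = (INF U\<in>delta_covers \<delta> A. \<Sum>i. diam_pow s (U i))"

definition hausdorff_measure :: "real \<Rightarrow> 'a::metric_space set \<Rightarrow> ennreal" where
  "hausdorff_measure s A = (SUP \<delta>\<in>{0<..}. hausdorff_premeasure s \<delta> A)"

definition hausdorff_dim :: "'a::metric_space set \<Rightarrow> ereal" where
  "hausdorff_dim A = Inf {ereal s |s. 0 \<le> s \<and> hausdorff_measure s A = 0}"

section \<open>Functions of class \<open>C^n\<close> on an interval\<close>

text \<open>Derivatives are taken within \<open>I\<close>, hence one-sided at endpoints belonging to \<open>I\<close>. They are
  meaningful (unique) because the intervals considered are non-degenerate.\<close>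

fun iter_deriv_on :: "real set \<Rightarrow> nat \<Rightarrow> (real \<Rightarrow> real) \<Rightarrow> real \<Rightarrow> real" where
  "iter_deriv_on I 0 f = f"
| "iter_deriv_on I (Suc n) f = (\<lambda>x. vector_derivative (iter_deriv_on I n f) (at x within I))"

definition C_n_on :: "nat \<Rightarrow> real set \<Rightarrow> (real \<Rightarrow> real) set" where
  "C_n_on n I = {f. (\<forall>k<n. iter_deriv_on I k f differentiable_on I)
                     \<and> continuous_on I (iter_deriv_on I n f)}"

definition nondegenerate_interval :: "real set \<Rightarrow> bool" where
  "nondegenerate_interval I \<longleftrightarrow> is_interval I \<and> (\<exists>a\<in>I. \<exists>b\<in>I. a < b)"

definition graph_on :: "(real \<Rightarrow> real) \<Rightarrow> real set \<Rightarrow> (real \<times> real) set" where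
  "graph_on f I = {(x, f x) |x. x \<in> I}"

section \<open>Multiplicative Diophantine approximation\<close>

text \<open>Only the values of \<open>\<psi>\<close> on the positive reals matter. ``Decreasing'' is read in the weak sense.\<close>

definition approximating_function :: "(real \<Rightarrow> real) \<Rightarrow> bool" where
  "approximating_function \<psi> \<longleftrightarrow> (\<forall>h>0. \<psi> h > 0) \<and> antimono_on {0<..} \<psi>"

definition has_order :: "(real \<Rightarrow> real) \<Rightarrow> real \<Rightarrow> bool" where
  "has_order \<psi> l \<longleftrightarrow> ((\<lambda>h. - ln (\<psi> h) / ln h) \<longlongrightarrow> l) at_top \<and> l > 0"

definition dist_int :: "real \<Rightarrow> real" where
  "dist_int x = (INF m::int. \<bar>x - of_int m\<bar>)"

lemma dist_int_eq_round: "dist_int x = \<bar>x - of_int (round x)\<bar>"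
  unfolding dist_int_def
  by (rule cInf_eq_minimum) (auto simp: round_diff_minimal)

definition mult_approx_set :: "(real \<Rightarrow> real) \<Rightarrow> (real \<times> real) set" where
  "mult_approx_set \<psi> =
     {(y1, y2). infinite {q::nat. q > 0 \<and> dist_int (real q * y1) * dist_int (real q * y2) < \<psi> (real q)}}"

end

(*
  Lower bound: dist(q x, Z) < q^-\<rho> already forces the product to be small, so the projection to the first
  coordinate contains a classical Jarnik-Besicovitch set, for which no cover of small s-content exists: one
  descends through balls about rationals, keeping the mass of the covering sets that meet the current ball small.

  Upper bound: if q x and q f(x) are within \<alpha> and \<beta> of integers, then (x, f(x)) is close to a rational point of
  denominator q that lies within O(max \<alpha> \<beta> / q) of the curve, and x is confined to a set of diameter
  O(min \<alpha> \<beta> / q) as soon as f' does not vanish.  It remains to count rational points of height at most Q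
  near a curve with f'' bounded away from 0; Huxley's bound O(Q^(1+\<epsilon>)) at distance 1/(4 Q^2) suffices, because
  larger distances are split into translates.  Three rational points on an arc of length c/Q have an integral
  determinant of absolute value less than 1, hence are collinear, and a rational line that carries three points
  is almost tangent, i.e. a rational point near the Legendre dual curve, of height at most c Q.  Induction on Q,
  alternating between the curve and its dual, closes the estimate when c is small.
*)
theory Submission
  imports Defs "HOL-Real_Asymp.Real_Asymp"
begin

section \<open>Hausdorff content\<close>

text \<open>Content replaces measure because for s > 0 both have the same null sets, and no mesh has
  to be carried along. The critical exponent pairs counts with diameters. For q in [Q, 2 Q) and
  larger distance about 2^-k there are O(Q^(1+\<epsilon>) (Q 2^-k + 1)) rational points, each
  costing about (2^k Q^(-1-\<rho>))^s. With s <= 1 and s \<rho> <= 2 the sum over 2^k <=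
  Q^(\<rho>/2) is as small as at k = 0, namely Q^(2+\<epsilon>-s(1+\<rho>)) up to a logarithm; l > 1
  leaves room for such s above 2/(1+l). The count recurses to heights c1 Q with coefficient A
  c1^\<epsilon>. The \<epsilon> makes the sum over dyadic heights geometric and lets a small c1 beat
  A. The induction meets duals, slopes outside the original range and vertical translates. Hence the
  arc is extended to a uniformly convex function on the whole line, and the bound is uniform over
  all conjugate pairs with given constants. Zeros of f'' are paid for by the hypothesis; zeros of f'
  with f'' nonzero are isolated.\<close>

definition hausdorff_content :: "real \<Rightarrow> 'a::metric_space set \<Rightarrow> ennreal" where
  "hausdorff_content s A =
     (INF U\<in>{U. (\<forall>i. bounded (U i)) \<and> A \<subseteq> (\<Union>i::nat. U i)}. \<Sum>i. diam_pow s (U i))"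

lemma diam_pow_pos_exponent: "s > 0 \<Longrightarrow> diam_pow s U = ennreal (diameter U powr s)"
  by (auto simp: diam_pow_def)

lemma diam_pow_empty [simp]: "diam_pow s {} = 0"
  by (simp add: diam_pow_def)

lemma hausdorff_content_le_cover:
  assumes "\<And>i. bounded (U i)" "A \<subseteq> (\<Union>i. U i)"
  shows "hausdorff_content s A \<le> (\<Sum>i. diam_pow s (U i))"
  unfolding hausdorff_content_def using assms by (intro INF_lower) auto

lemma hausdorff_content_less_obtain:
  assumes "hausdorff_content s A < e"
  obtains U where "\<And>i::nat. bounded (U i)" "A \<subseteq> (\<Union>i. U i)" "(\<Sum>i. diam_pow s (U i)) < e"
  using assms unfolding hausdorff_content_def INF_less_iff by blast

lemma hausdorff_content_le_diam_pow:
  assumes "bounded T"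
  shows "hausdorff_content s T \<le> diam_pow s T"
proof -
  define U where "U = (\<lambda>i::nat. if i = 0 then T else {})"
  have "hausdorff_content s T \<le> (\<Sum>i. diam_pow s (U i))"
    using assms by (intro hausdorff_content_le_cover) (auto simp: U_def)
  also have "\<dots> = (\<Sum>i\<in>{0}. diam_pow s (U i))"
    by (intro suminf_finite) (auto simp: U_def)
  finally show ?thesis by (simp add: U_def)
qed

lemma hausdorff_content_mono: "A \<subseteq> B \<Longrightarrow> hausdorff_content s A \<le> hausdorff_content s B"
  unfolding hausdorff_content_def by (intro INF_superset_mono) auto

text \<open>Covers optimal up to e / 2^(n+1) are merged into one sequence by the pairing of nat with
  itself.\<close>

lemma hausdorff_content_UN_le:
  "hausdorff_content s (\<Union>n::nat. A n) \<le> (\<Sum>n. hausdorff_content s (A n))"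
proof (cases "(\<Sum>n. hausdorff_content s (A n)) < top")
  case False
  then show ?thesis using top.not_eq_extremum by fastforce
next
  case True
  have fin: "hausdorff_content s (A n) < top" for n
  proof -
    have "hausdorff_content s (A n) \<le> (\<Sum>n. hausdorff_content s (A n))"
      using sum_le_suminf[of "\<lambda>n. hausdorff_content s (A n)" "{n}"] by simp
    with True show ?thesis by (rule order.strict_trans1[rotated])
  qed
  show ?thesis
  proof (rule ennreal_le_epsilon)
    fix e :: real assume e: "e > 0"
    have "\<exists>U. (\<forall>i::nat. bounded (U i)) \<and> A n \<subseteq> (\<Union>i. U i) \<and>
         (\<Sum>i. diam_pow s (U i)) \<le> hausdorff_content s (A n) + ennreal (e * (1/2)^Suc n)" for n
    proof -
      \<comment> \<open>Finiteness matters: adding a positive amount to an infinite content gives no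
        strict inequality.\<close>
      have "hausdorff_content s (A n) < hausdorff_content s (A n) + ennreal (e * (1/2)^Suc n)"
        using fin[of n] e by (simp add: ennreal_zero_less_mult_iff)
      then show ?thesis
        by (elim hausdorff_content_less_obtain) (metis less_imp_le)
    qed
    then obtain U where U: "\<And>n i::nat. bounded (U n i)" "\<And>n. A n \<subseteq> (\<Union>i. U n i)"
      "\<And>n. (\<Sum>i. diam_pow s (U n i)) \<le> hausdorff_content s (A n) + ennreal (e * (1/2)^Suc n)"
      by metis
    define V where "V = (\<lambda>k. case prod_decode k of (n, i) \<Rightarrow> U n i)"
    have "hausdorff_content s (\<Union>n. A n) \<le> (\<Sum>k. diam_pow s (V k))"
    proof (intro hausdorff_content_le_cover)
      show "bounded (V i)" for i using U(1) by (auto simp: V_def split: prod.split)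
      show "(\<Union>n. A n) \<subseteq> (\<Union>i. V i)"
      proof
        fix x assume "x \<in> (\<Union>n. A n)"
        then obtain n i where "x \<in> U n i" using U(2) by blast
        then have "x \<in> V (prod_encode (n, i))" by (simp add: V_def)
        then show "x \<in> (\<Union>i. V i)" by blast
      qed
    qed
    also have "(\<Sum>k. diam_pow s (V k)) = (\<Sum>n. \<Sum>i. diam_pow s (U n i))"
      using suminf_ennreal_2dimen[of "\<lambda>n. \<Sum>i. diam_pow s (U n i)" "\<lambda>(n, i). diam_pow s (U n i)"]
      by (simp add: V_def comp_def case_prod_beta)
    also have "\<dots> \<le> (\<Sum>n. hausdorff_content s (A n) + ennreal (e * (1/2)^Suc n))"
      by (intro suminf_le U(3)) auto
    also have "\<dots> = (\<Sum>n. hausdorff_content s (A n)) + (\<Sum>n. ennreal (e * (1/2)^Suc n))"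
      by (intro suminf_add[symmetric]) auto
    also have "(\<Sum>n. ennreal (e * (1/2)^Suc n)) = ennreal e"
      using e sums_mult[OF power_half_series, of e]
      by (intro suminf_ennreal_eq) auto
    finally show "hausdorff_content s (\<Union>n. A n) \<le> (\<Sum>n. hausdorff_content s (A n)) + ennreal e" .
  qed
qed

lemma hausdorff_content_empty [simp]: "hausdorff_content s {} = 0"
  using hausdorff_content_le_diam_pow[of "{}" s] by simp

lemma hausdorff_content_Un_le:
  "hausdorff_content s (A \<union> B) \<le> hausdorff_content s A + hausdorff_content s B"
proof -
  define T where "T = (\<lambda>n::nat. if n = 0 then A else if n = 1 then B else {})"
  have "A \<union> B = (\<Union>n. T n)" by (auto simp: T_def split: if_splits)
  moreover have "(\<Sum>n. hausdorff_content s (T n)) = (\<Sum>n\<in>{0, 1}. hausdorff_content s (T n))"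
    by (intro suminf_finite) (auto simp: T_def)
  ultimately show ?thesis using hausdorff_content_UN_le[of s T] by (simp add: T_def)
qed

lemma hausdorff_content_finite_UN_le:
  assumes "finite I"
  shows "hausdorff_content s (\<Union>i\<in>I. A i) \<le> (\<Sum>i\<in>I. hausdorff_content s (A i))"
  using assms
proof (induction I)
  case (insert i I)
  have "hausdorff_content s (\<Union>i\<in>insert i I. A i) \<le>
      hausdorff_content s (A i) + hausdorff_content s (\<Union>i\<in>I. A i)"
    using hausdorff_content_Un_le[of s "A i" "\<Union>i\<in>I. A i"] by simp
  also have "\<dots> \<le> hausdorff_content s (A i) + (\<Sum>i\<in>I. hausdorff_content s (A i))"
    using insert by (intro add_mono) auto
  finally show ?case using insert by simp
qed auto

lemma hausdorff_content_null_countable_UN: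
  assumes "countable I" "\<And>i. i \<in> I \<Longrightarrow> hausdorff_content s (A i) = 0"
  shows "hausdorff_content s (\<Union>i\<in>I. A i) = 0"
proof (cases "I = {}")
  case False
  have "(\<Union>i\<in>I. A i) = (\<Union>n. A (from_nat_into I n))"
    using range_from_nat_into[OF False assms(1)] by (metis image_image)
  moreover have "hausdorff_content s (A (from_nat_into I n)) = 0" for n
    by (intro assms(2) from_nat_into False)
  ultimately show ?thesis
    using hausdorff_content_UN_le[of s "\<lambda>n. A (from_nat_into I n)"] by simp
qed auto

text \<open>Convergence half of Borel-Cantelli: every tail of the sequence covers \<open>B\<close>,
  and the cost of the tails tends to 0.\<close>

lemma hausdorff_content_null_limsup:
  assumes c: "\<And>n. hausdorff_content s (A n) \<le> ennreal (c n)" "\<And>n. 0 \<le> c n" "summable c"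
    and sub: "\<And>x. x \<in> B \<Longrightarrow> infinite {n::nat. x \<in> A n}"
  shows "hausdorff_content s B = 0"
proof -
  have le: "hausdorff_content s B \<le> ennreal (\<Sum>n. c (n + m))" for m
  proof -
    have "B \<subseteq> (\<Union>n. A (n + m))"
    proof
      fix x assume "x \<in> B"
      from sub[OF this] obtain n where "n \<ge> m" "x \<in> A n"
        unfolding infinite_nat_iff_unbounded_le by blast
      then show "x \<in> (\<Union>n. A (n + m))"
        by (intro UN_I[of "n - m"]) auto
    qed
    then have "hausdorff_content s B \<le> hausdorff_content s (\<Union>n. A (n + m))"
      by (rule hausdorff_content_mono)
    also have "\<dots> \<le> (\<Sum>n. hausdorff_content s (A (n + m)))" by (rule hausdorff_content_UN_le)
    also have "\<dots> \<le> (\<Sum>n. ennreal (c (n + m)))" by (intro suminf_le c) auto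
    also have "\<dots> = ennreal (\<Sum>n. c (n + m))"
      using c by (intro suminf_ennreal2) auto
    finally show ?thesis .
  qed
  have "(\<lambda>m. \<Sum>n. c (n + m)) \<longlonglongrightarrow> 0" by (rule suminf_exist_split2[OF c(3)])
  then have "(\<lambda>m. ennreal (\<Sum>n. c (n + m))) \<longlonglongrightarrow> ennreal 0" by (rule tendsto_ennrealI)
  then have "hausdorff_content s B \<le> ennreal 0"
    by (rule LIMSEQ_le_const) (use le in auto)
  then show ?thesis by simp
qed

lemma hausdorff_content_Lipschitz_image_null:
  fixes \<phi> :: "'a::metric_space \<Rightarrow> 'b::metric_space"
  assumes s: "s > 0" and lip: "\<And>x y. x \<in> A \<Longrightarrow> y \<in> A \<Longrightarrow> dist (\<phi> x) (\<phi> y) \<le> C * dist x y"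
    and null: "hausdorff_content s A = 0"
  shows "hausdorff_content s (\<phi> ` A) = 0"
proof -
  \<comment> \<open>A positive Lipschitz constant, so that \<open>D powr s\<close> can be divided
    by.\<close>
  define D where "D = max C 1"
  have D: "D > 0" "\<And>x y. x \<in> A \<Longrightarrow> y \<in> A \<Longrightarrow> dist (\<phi> x) (\<phi> y) \<le> D * dist x y"
    using lip by (auto simp: D_def intro: order.trans[OF lip mult_right_mono])
  have "hausdorff_content s (\<phi> ` A) \<le> ennreal e" if e: "e > 0" for e :: real
  proof -
    have "hausdorff_content s A < ennreal (e / D powr s)" using null e D by simp
    then obtain U where U: "\<And>i::nat. bounded (U i)" "A \<subseteq> (\<Union>i. U i)"
      "(\<Sum>i. diam_pow s (U i)) < ennreal (e / D powr s)"
      by (rule hausdorff_content_less_obtain) blast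
    have d: "dist (\<phi> x) (\<phi> y) \<le> D * diameter (U i)" if "x \<in> A \<inter> U i" "y \<in> A \<inter> U i" for x y i
      using D(2)[of x y] that diameter_bounded_bound[OF U(1), of x i y] D(1)
      by (meson IntD1 IntD2 mult_left_mono less_imp_le order.trans)
    have b: "bounded (\<phi> ` (A \<inter> U i))" for i
      using d[of _ i] unfolding bounded_two_points by blast
    have "diam_pow s (\<phi> ` (A \<inter> U i)) \<le> ennreal (D powr s) * diam_pow s (U i)" for i
    proof -
      have "diameter (\<phi> ` (A \<inter> U i)) \<le> D * diameter (U i)"
        using d[of _ i] D(1) diameter_ge_0[OF U(1)[of i]]
        unfolding diameter_def[of "\<phi> ` _"] by (auto intro!: cSUP_least)
      then have "diameter (\<phi> ` (A \<inter> U i)) powr s \<le> (D * diameter (U i)) powr s"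
        using s diameter_ge_0[OF b] by (intro powr_mono2) auto
      also have "\<dots> = D powr s * diameter (U i) powr s"
        using D(1) diameter_ge_0[OF U(1)] by (simp add: powr_mult)
      finally show ?thesis using s by (simp add: diam_pow_pos_exponent flip: ennreal_mult)
    qed
    then have "(\<Sum>i. diam_pow s (\<phi> ` (A \<inter> U i))) \<le> (\<Sum>i. ennreal (D powr s) * diam_pow s (U i))"
      by (intro suminf_le) auto
    also have "\<dots> = ennreal (D powr s) * (\<Sum>i. diam_pow s (U i))" by simp
    also have "\<dots> \<le> ennreal (D powr s) * ennreal (e / D powr s)"
      using U(3) by (intro mult_left_mono) auto
    also have "\<dots> = ennreal e" using D(1) e by (simp flip: ennreal_mult)
    finally have "(\<Sum>i. diam_pow s (\<phi> ` (A \<inter> U i))) \<le> ennreal e" .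
    moreover have "\<phi> ` A \<subseteq> (\<Union>i. \<phi> ` (A \<inter> U i))" using U(2) by blast
    ultimately show ?thesis
      using hausdorff_content_le_cover[where s = s and U = "\<lambda>i. \<phi> ` (A \<inter> U i)", OF b]
      by (meson order.trans)
  qed
  then show ?thesis
    using ennreal_le_epsilon[of 0 "hausdorff_content s (\<phi> ` A)"] by simp
qed

text \<open>A cover of total cost below \<open>\<delta> powr s\<close> consists of sets of diameter
  at most \<delta>, so cheap covers are automatically fine.\<close>

lemma hausdorff_measure_eq_0_iff_content:
  assumes s: "s > 0"
  shows "hausdorff_measure s A = 0 \<longleftrightarrow> hausdorff_content s A = 0"
proof
  assume "hausdorff_measure s A = 0"
  then have "hausdorff_premeasure s 1 A = 0" 
    unfolding hausdorff_measure_def by (simp add: SUP_eq_iff bot_ennreal[symmetric])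
  moreover have "hausdorff_content s A \<le> hausdorff_premeasure s 1 A"
    unfolding hausdorff_content_def hausdorff_premeasure_def delta_covers_def
    by (intro INF_superset_mono) auto
  ultimately show "hausdorff_content s A = 0" by simp
next
  assume null: "hausdorff_content s A = 0"
  have "hausdorff_premeasure s \<delta> A \<le> ennreal e" if "\<delta> > 0" "e > 0" for \<delta> e :: real
  proof -
    have "hausdorff_content s A < ennreal (min e (\<delta> powr s))" using null that by simp
    then obtain U where U: "\<And>i::nat. bounded (U i)" "A \<subseteq> (\<Union>i. U i)"
      "(\<Sum>i. diam_pow s (U i)) < ennreal (min e (\<delta> powr s))"
      by (rule hausdorff_content_less_obtain) blast
    have "diameter (U i) \<le> \<delta>" for i
    proof -
      have "diam_pow s (U i) \<le> (\<Sum>i. diam_pow s (U i))"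
        using sum_le_suminf[of "\<lambda>n. diam_pow s (U n)" "{i}"] by simp
      also have "\<dots> < ennreal (min e (\<delta> powr s))" by (rule U)
      finally have "diameter (U i) powr s < \<delta> powr s"
        using s that by (simp add: diam_pow_pos_exponent ennreal_less_iff)
      then show ?thesis using s that by (meson less_imp_le not_le powr_mono2)
    qed
    then have "U \<in> delta_covers \<delta> A" using U by (auto simp: delta_covers_def)
    then have "hausdorff_premeasure s \<delta> A \<le> (\<Sum>i. diam_pow s (U i))"
      unfolding hausdorff_premeasure_def by (rule INF_lower)
    also have "\<dots> \<le> ennreal e" 
      using U(3) that by (meson ennreal_leI less_imp_le min.cobounded1 order.trans)
    finally show ?thesis .
  qed
  then have "hausdorff_premeasure s \<delta> A \<le> 0" if "\<delta> > 0" for \<delta>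
    using ennreal_le_epsilon[of 0 "hausdorff_premeasure s \<delta> A"] that by simp
  then show "hausdorff_measure s A = 0"
    unfolding hausdorff_measure_def by (intro antisym SUP_least) auto
qed

text \<open>Raising the exponent lowers the power of a diameter that is at most 1. The case s' = 0
  is included, since the infimum that defines the dimension ranges over it.\<close>

lemma hausdorff_content_null_mono_exponent:
  assumes "0 \<le> s'" "s' < s" "hausdorff_measure s' A = 0"
  shows "hausdorff_content s A = 0"
proof -
  have "hausdorff_premeasure s' 1 A = 0" 
    using assms(3)
    unfolding hausdorff_measure_def by (simp add: SUP_eq_iff bot_ennreal[symmetric])
  moreover have "hausdorff_content s A \<le> hausdorff_premeasure s' 1 A"
    unfolding hausdorff_premeasure_def
  proof (rule INF_greatest)
    fix U :: "nat \<Rightarrow> 'a set" assume "U \<in> delta_covers 1 A"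
    then have U: "\<And>i. bounded (U i)" "\<And>i. diameter (U i) \<le> 1" "A \<subseteq> (\<Union>i. U i)"
      by (auto simp: delta_covers_def)
    have "diam_pow s (U i) \<le> diam_pow s' (U i)" for i
      using assms(1,2) U(2)[of i] diameter_ge_0[OF U(1)[of i]]
      by (cases "diameter (U i) = 0")
         (auto simp: diam_pow_def powr_le_one_le intro!: ennreal_leI powr_mono' powr_le1)
    then have "(\<Sum>i. diam_pow s (U i)) \<le> (\<Sum>i. diam_pow s' (U i))"
      by (intro suminf_le) auto
    then show "hausdorff_content s A \<le> (\<Sum>i. diam_pow s' (U i))"
      using hausdorff_content_le_cover[OF U(1) U(3), of s] by (rule order.trans[rotated])
  qed
  ultimately show ?thesis by simp
qed

lemma hausdorff_content_null_above_dim: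
  assumes "hausdorff_dim A < ereal s"
  shows "hausdorff_content s A = 0"
  using assms unfolding hausdorff_dim_def Inf_less_iff
  by (auto intro: hausdorff_content_null_mono_exponent)

text \<open>Only exponents slightly above \<open>t\<close> matter. The bound \<open>u\<close> later
  keeps s within the range where the counting argument works.\<close>

lemma hausdorff_dim_leI:
  assumes "0 \<le> t" "t < u" "\<And>s. t < s \<Longrightarrow> s < u \<Longrightarrow> hausdorff_content s A = 0"
  shows "hausdorff_dim A \<le> ereal t"
proof (rule dense_ge_bounded[of _ "ereal u"])
  show "ereal t < ereal u" using assms by simp
  fix w assume w: "ereal t < w" "w < ereal u"
  then obtain s where s: "w = ereal s" by (cases w) auto
  then have "hausdorff_measure s A = 0"
    using assms w hausdorff_measure_eq_0_iff_content[of s A] by auto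
  then show "hausdorff_dim A \<le> w"
    unfolding hausdorff_dim_def s using w s assms by (intro Inf_lower) auto
qed

lemma hausdorff_dim_geI:
  assumes "\<And>s. 0 < s \<Longrightarrow> s < t \<Longrightarrow> hausdorff_content s A \<noteq> 0"
  shows "ereal t \<le> hausdorff_dim A"
  unfolding hausdorff_dim_def
proof (rule Inf_greatest, clarify)
  fix s :: real assume s: "0 \<le> s" "hausdorff_measure s A = 0"
  show "ereal t \<le> ereal s"
  proof (rule ccontr)
    assume "\<not> ?thesis"
    then have "s < (s + t) / 2" "(s + t) / 2 < t" by auto
    then show False
      using hausdorff_content_null_mono_exponent[of s "(s + t) / 2" A] s assms[of "(s + t) / 2"]
      by auto
  qed
qed

section \<open>The Jarnik-Besicovitch lower bound\<close>

lemma Ints_between_eq: "{m::int. a \<le> real_of_int m \<and> real_of_int m \<le> b} = {\<lceil>a\<rceil>..\<lfloor>b\<rfloor>}"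
  by (auto simp: ceiling_le_iff le_floor_iff)

lemma finite_Ints_between: "finite {m::int. a \<le> real_of_int m \<and> real_of_int m \<le> b}"
  by (simp add: Ints_between_eq)

lemma card_Ints_between_le:
  assumes "a \<le> b"
  shows "real (card {m::int. a \<le> real_of_int m \<and> real_of_int m \<le> b}) \<le> b - a + 1"
  unfolding Ints_between_eq card_atLeastAtMost_int using assms by linarith

text \<open>Pigeonhole: of the cells of length \<open>d\<close> counted from the minimum, each holds
  at most one point.\<close>

lemma card_separated_le:
  fixes X :: "real set"
  assumes "finite X" "d > 0" "S \<ge> 0"
    and sep: "\<And>x y. x \<in> X \<Longrightarrow> y \<in> X \<Longrightarrow> x \<noteq> y \<Longrightarrow> d \<le> \<bar>x - y\<bar>"
    and diam: "\<And>x y. x \<in> X \<Longrightarrow> y \<in> X \<Longrightarrow> \<bar>x - y\<bar> \<le> S"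
  shows "real (card X) \<le> S / d + 1"
proof (cases "X = {}")
  case False
  define m where "m = Min X"
  have m: "m \<in> X" "\<And>x. x \<in> X \<Longrightarrow> m \<le> x" using False assms(1) by (auto simp: m_def)
  define h where "h = (\<lambda>x. \<lfloor>(x - m) / d\<rfloor>)"
  have "inj_on h X"
  proof (rule inj_onI, rule ccontr)
    fix x y assume xy: "x \<in> X" "y \<in> X" "h x = h y" "x \<noteq> y"
    have "\<bar>(x - m) / d - (y - m) / d\<bar> < 1" using xy(3) unfolding h_def by linarith
    also have "(x - m) / d - (y - m) / d = (x - y) / d" by (simp add: diff_divide_distrib)
    finally have "\<bar>x - y\<bar> < d" using \<open>d > 0\<close> by (simp add: abs_divide)
    then show False using sep[OF xy(1,2,4)] by simp
  qed
  moreover have "h ` X \<subseteq> {i. 0 \<le> real_of_int i \<and> of_int i \<le> S / d}"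
  proof clarify
    fix x assume "x \<in> X"
    then have "0 \<le> (x - m) / d" "(x - m) / d \<le> S / d"
      using m(2)[of x] diam[of x m] m(1) \<open>d > 0\<close> by (auto intro: divide_right_mono)
    then show "0 \<le> real_of_int (h x) \<and> real_of_int (h x) \<le> S / d"
      unfolding h_def by (auto intro: order.trans[OF of_int_floor_le])
  qed
  ultimately have "card X \<le> card {i. 0 \<le> real_of_int i \<and> of_int i \<le> S / d}"
    by (metis card_image card_mono finite_Ints_between)
  then show ?thesis
    using card_Ints_between_le[of 0 "S / d"] assms by simp
qed (use assms in auto)

lemma interval_length_le_cover:
  fixes a b :: real
  assumes "finite I" "{a..b} \<subseteq> (\<Union>i\<in>I. {c i - d i..c i + d i})" "\<And>i. i \<in> I \<Longrightarrow> d i \<ge> 0"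
  shows "b - a \<le> (\<Sum>i\<in>I. 2 * d i)"
proof (cases "a \<le> b")
  case True
  have "ennreal (b - a) = emeasure lborel {a..b}" using True by simp
  also have "\<dots> \<le> emeasure lborel (\<Union>i\<in>I. {c i - d i..c i + d i})"
    using assms by (intro emeasure_mono) auto
  also have "\<dots> \<le> (\<Sum>i\<in>I. emeasure lborel {c i - d i..c i + d i})"
    using assms by (intro emeasure_subadditive_finite) auto
  also have "\<dots> = (\<Sum>i\<in>I. ennreal (2 * d i))"
    using assms by (intro sum.cong) auto
  also have "\<dots> = ennreal (\<Sum>i\<in>I. 2 * d i)" using assms by (intro sum_ennreal) auto
  finally show ?thesis using assms by (subst (asm) ennreal_le_iff) (auto intro: sum_nonneg)
qed (use assms sum_nonneg[of I "\<lambda>i. 2 * d i"] in auto)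

text \<open>The difference is a nonzero integer divided by q q'. The fractions need not be
  reduced.\<close>

lemma rationals_separated:
  fixes x y :: real
  assumes "0 < q" "q \<le> Q" "real q * x \<in> \<int>" "0 < q'" "q' \<le> Q" "real q' * y \<in> \<int>" "x \<noteq> y"
  shows "1 / (real Q)\<^sup>2 \<le> \<bar>x - y\<bar>"
proof -
  have "real q * real q' * (x - y) = real q' * (real q * x) - real q * (real q' * y)"
    by (simp add: algebra_simps)
  moreover have "real q' * (real q * x) - real q * (real q' * y) \<in> \<int>"
    by (intro Ints_diff Ints_mult[OF Ints_of_nat] assms)
  ultimately have "real q * real q' * (x - y) \<in> \<int>" by metis
  then have "1 \<le> \<bar>real q * real q' * (x - y)\<bar>"
    using assms by (intro Ints_nonzero_abs_ge1) simp_all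
  also have "\<dots> = real q * real q' * \<bar>x - y\<bar>" by (simp add: abs_mult)
  also have "\<dots> \<le> (real Q)\<^sup>2 * \<bar>x - y\<bar>"
    unfolding power2_eq_square using assms by (intro mult_right_mono mult_mono) auto
  finally show ?thesis using assms by (simp add: field_simps)
qed

text \<open>By Dirichlet's theorem the intervals of radius \<open>1 / (q Q)\<close> about the \<open>p / q\<close> with \<open>q \<le> Q\<close>
  cover everything, and those with \<open>q < Q / 16\<close> cover at most half of the middle of \<open>{u..u + r}\<close>.\<close>

lemma many_rationals_in_interval:
  fixes u r :: real
  assumes "r > 0"
  shows "\<forall>\<^sub>F Q::nat in sequentially.
    r * (real Q)\<^sup>2 / 128 \<le> real (card {x \<in> {u..u+r}. \<exists>q::nat. real Q / 16 \<le> real q \<and> 0 < q \<and> q \<le> Q \<and> real q * x \<in> \<int>})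
    \<and> finite {x \<in> {u..u+r}. \<exists>q::nat. real Q / 16 \<le> real q \<and> 0 < q \<and> q \<le> Q \<and> real q * x \<in> \<int>}"
proof -
  \<comment> \<open>Cut-off in the sum of 1 / q over small denominators, chosen to make the tail
    contribute only r / 256.\<close>
  define M where "M = 32 / r"
  have M: "M > 0" using assms by (simp add: M_def)
  have ev: "\<forall>\<^sub>F Q::nat in sequentially. Q \<ge> 1 \<and> 64 \<le> r * real Q \<and> 32 * M \<le> r * real Q"
    using assms by (intro eventually_conj) real_asymp+
  show ?thesis
  proof (rule eventually_mono[OF ev])
    fix Q :: nat assume Q: "Q \<ge> 1 \<and> 64 \<le> r * real Q \<and> 32 * M \<le> r * real Q"
    define P where "P = {x \<in> {u..u+r}. \<exists>q::nat. real Q / 16 \<le> real q \<and> 0 < q \<and> q \<le> Q \<and> real q * x \<in> \<int>}"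
    \<comment> \<open>Each such q has about q r fractions in the interval, with neighbourhoods of
      length 2 / (q Q). Fewer than Q / 16 denominators thus cover about r / 8, while the middle half
      has length r / 2.\<close>
    define Bq where "Bq = {q::nat. 0 < q \<and> real q < real Q / 16}"
    define Z where "Z = (\<lambda>q::nat. {p::int. real q * u \<le> of_int p \<and> of_int p \<le> real q * (u + r)})"
    have finB: "finite Bq" by (rule finite_subset[of _ "{..Q}"]) (auto simp: Bq_def)
    have finZ: "finite (Z q)" for q unfolding Z_def by (rule finite_Ints_between)
    have finP: "finite P"
    proof (rule finite_subset)
      show "P \<subseteq> (\<lambda>(q, p). of_int p / real q) ` (SIGMA q:{1..Q}. Z q)"
      proof
        fix x assume "x \<in> P"
        then obtain q p where "u \<le> x" "x \<le> u + r" "0 < q" "q \<le> Q" "real q * x = of_int p"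
          unfolding P_def Ints_def by auto
        then have "(q, p) \<in> (SIGMA q:{1..Q}. Z q)" "x = of_int p / real q"
          using mult_left_mono[of u x "real q"] mult_left_mono[of x "u + r" "real q"]
          by (auto simp: Z_def field_simps)
        then show "x \<in> (\<lambda>(q, p). of_int p / real q) ` (SIGMA q:{1..Q}. Z q)"
          by (intro image_eqI[of _ _ "(q, p)"]) auto
      qed
    qed (use finZ in auto)
    \<comment> \<open>The left summand holds the wanted rationals, with the uniform radius 16 / Q^2
      that dominates 1 / (q Q) for q >= Q / 16. The right one holds pairs (q, p) with small q, where
      a fraction may be repeated.\<close>
    have cover: "{u + r/4..u + 3*r/4} \<subseteq>
      (\<Union>i\<in>Inl ` P \<union> Inr ` (SIGMA q:Bq. Z q).
         {(case i of Inl x \<Rightarrow> x | Inr (q, p) \<Rightarrow> of_int p / real q) -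
            (case i of Inl x \<Rightarrow> 16 / (real Q)\<^sup>2 | Inr (q, p) \<Rightarrow> 1 / (real q * real Q))..
          (case i of Inl x \<Rightarrow> x | Inr (q, p) \<Rightarrow> of_int p / real q) +
            (case i of Inl x \<Rightarrow> 16 / (real Q)\<^sup>2 | Inr (q, p) \<Rightarrow> 1 / (real q * real Q))})"
      (is "_ \<subseteq> ?U")
    proof
      fix x assume x: "x \<in> {u + r/4..u + 3*r/4}"
      obtain q' :: int and p :: int where "0 < q'" "q' \<le> int Q" "\<bar>of_int q' * x - of_int p\<bar> < 1 / real Q"
        using Dirichlet_approx[of Q x] Q by (metis less_le_trans zero_less_one)
      then obtain q :: nat where q: "0 < q" "q \<le> Q" "\<bar>real q * x - of_int p\<bar> < 1 / real Q"
        by (metis of_int_of_nat_eq of_nat_0_less_iff of_nat_le_iff zero_less_imp_eq_int)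
      define y where "y = of_int p / real q"
      have "x - y = (real q * x - of_int p) / real q" using q by (simp add: y_def field_simps)
      then have "\<bar>x - y\<bar> = \<bar>real q * x - of_int p\<bar> / real q" by (simp add: abs_divide)
      also have "\<dots> \<le> (1 / real Q) / real q" using q by (intro divide_right_mono) auto
      finally have d: "\<bar>x - y\<bar> \<le> 1 / (real q * real Q)" by (simp add: mult.commute)
      have "1 / (real q * real Q) \<le> 1 / real Q" using q Q by (simp add: field_simps)
      also have "\<dots> \<le> r / 4" using Q by (simp add: field_simps)
      finally have y: "u \<le> y" "y \<le> u + r" using d x by auto
      then have pZ: "p \<in> Z q" using q by (simp add: Z_def y_def field_simps)
      show "x \<in> ?U"
      proof (cases "real q < real Q / 16")
        case True
        then have "Inr (q, p) \<in> Inl ` P \<union> Inr ` (SIGMA q:Bq. Z q)"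
          using q pZ by (auto simp: Bq_def)
        moreover have "x \<in> {y - 1 / (real q * real Q)..y + 1 / (real q * real Q)}" using d by auto
        ultimately show ?thesis by (intro UN_I[of "Inr (q, p)"]) (auto simp: y_def)
      next
        case False
        have "real q * y \<in> \<int>" using q by (simp add: y_def)
        then have "y \<in> P" using y q False unfolding P_def by (auto intro!: exI[of _ q])
        moreover have "1 / (real q * real Q) \<le> 16 / (real Q)\<^sup>2"
          using False q Q by (simp add: field_simps power2_eq_square)
        ultimately show ?thesis using d by (intro UN_I[of "Inl y"]) auto
      qed
    qed
    have "r / 2 \<le> (\<Sum>i\<in>Inl ` P \<union> Inr ` (SIGMA q:Bq. Z q).
      2 * (case i of Inl x \<Rightarrow> 16 / (real Q)\<^sup>2 | Inr (q, p) \<Rightarrow> 1 / (real q * real Q)))"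
      using interval_length_le_cover[OF _ cover] finP finB finZ
      by (auto split: sum.splits prod.splits)
    also have "\<dots> = (\<Sum>x\<in>P. 32 / (real Q)\<^sup>2) + (\<Sum>x\<in>Sigma Bq Z. 2 / (real (fst x) * real Q))"
      using finP finB finZ
      by (subst sum.union_disjoint) (auto simp: sum.reindex case_prod_beta)
    also have "(\<Sum>x\<in>Sigma Bq Z. 2 / (real (fst x) * real Q)) = (\<Sum>q\<in>Bq. \<Sum>p\<in>Z q. 2 / (real q * real Q))"
      using finB finZ by (subst sum.Sigma) (auto simp: case_prod_beta)
    finally have 1: "r / 2 \<le> (\<Sum>x\<in>P. 32 / (real Q)\<^sup>2) + (\<Sum>q\<in>Bq. \<Sum>p\<in>Z q. 2 / (real q * real Q))" .
    have "(\<Sum>q\<in>Bq. \<Sum>p\<in>Z q. 2 / (real q * real Q)) \<le> (\<Sum>q\<in>Bq. (real q * r + 1) * (2 / (real q * real Q)))"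
    proof (rule sum_mono)
      fix q assume "q \<in> Bq"
      have "real (card (Z q)) \<le> real q * r + 1"
        using card_Ints_between_le[of "real q * u" "real q * (u + r)"] assms
        by (simp add: Z_def algebra_simps)
      then show "(\<Sum>p\<in>Z q. 2 / (real q * real Q)) \<le> (real q * r + 1) * (2 / (real q * real Q))"
        by (simp only: sum_constant) (intro mult_right_mono, auto)
    qed
    \<comment> \<open>Splitting at \<open>M\<close> avoids the logarithm of the harmonic sum: at
      most M terms with q <= M, and 1 / M for every other q.\<close>
    also have "\<dots> \<le> (\<Sum>q\<in>Bq. 2 * r / real Q + 2 / real Q * ((if real q \<le> M then 1 else 0) + 1 / M))"
    proof (rule sum_mono)
      fix q assume "q \<in> Bq"
      then have q: "q \<ge> 1" by (auto simp: Bq_def)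
      have "1 / real q \<le> (if real q \<le> M then 1 else 0) + 1 / M"
        using q M by (cases "real q \<le> M") (auto intro: add_increasing2 frac_le simp: divide_le_eq_1)
      then have "2 / real Q * (1 / real q) \<le> 2 / real Q * ((if real q \<le> M then 1 else 0) + 1 / M)"
        by (intro mult_left_mono) auto
      moreover have "(real q * r + 1) * (2 / (real q * real Q)) = 2 * r / real Q + 2 / real Q * (1 / real q)"
        using q Q by (simp add: field_simps)
      ultimately show "(real q * r + 1) * (2 / (real q * real Q)) \<le>
          2 * r / real Q + 2 / real Q * ((if real q \<le> M then 1 else 0) + 1 / M)" by simp
    qed
    also have "\<dots> = real (card Bq) * (2 * r / real Q + 2 / (real Q * M)) +
        2 / real Q * (\<Sum>q\<in>Bq. if real q \<le> M then 1 else 0)"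
      by (simp only: sum.distrib sum_constant sum_distrib_left[symmetric] distrib_left) (simp add: field_simps)
    finally have 2: "(\<Sum>q\<in>Bq. \<Sum>p\<in>Z q. 2 / (real q * real Q)) \<le>
        real (card Bq) * (2 * r / real Q + 2 / (real Q * M)) +
        2 / real Q * (\<Sum>q\<in>Bq. if real q \<le> M then 1 else 0)" .
    have 3: "(\<Sum>q\<in>Bq. if real q \<le> M then 1 else 0) \<le> M"
    proof -
      have "(\<Sum>q\<in>Bq. if real q \<le> M then 1 else (0::real)) = real (card {q \<in> Bq. real q \<le> M})"
        using finB by (simp add: sum.If_cases Int_def)
      also have "{q \<in> Bq. real q \<le> M} \<subseteq> {1..nat \<lfloor>M\<rfloor>}"
        by (auto simp: Bq_def le_nat_floor)
      then have "card {q \<in> Bq. real q \<le> M} \<le> nat \<lfloor>M\<rfloor>"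
        using card_mono[of "{1..nat \<lfloor>M\<rfloor>}" "{q \<in> Bq. real q \<le> M}"] by simp
      then have "real (card {q \<in> Bq. real q \<le> M}) \<le> M" using M by linarith
      finally show ?thesis .
    qed
    have 4: "real (card Bq) \<le> real Q / 16"
    proof -
      have "Bq \<subseteq> {1..Q div 16}" by (auto simp: Bq_def)
      then have "card Bq \<le> Q div 16" using card_mono[of "{1..Q div 16}" Bq] by simp
      then show ?thesis by linarith
    qed
    have "real (card Bq) * (2 * r / real Q + 2 / (real Q * M)) \<le>
        real Q / 16 * (2 * r / real Q + 2 / (real Q * M))"
      using 4 M assms by (intro mult_right_mono) auto
    also have "\<dots> = r / 8 + r / 256"
      using Q assms by (simp add: M_def field_simps)
    finally have 5: "real (card Bq) * (2 * r / real Q + 2 / (real Q * M)) \<le> r / 8 + r / 256" .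
    have "2 / real Q * (\<Sum>q\<in>Bq. if real q \<le> M then 1 else 0) \<le> 2 / real Q * M"
      using 3 by (intro mult_left_mono) auto
    also have "\<dots> \<le> r / 16" using Q by (simp add: field_simps)
    finally have "r / 4 \<le> (\<Sum>x\<in>P. 32 / (real Q)\<^sup>2)" using 1 2 5 assms by linarith
    then have "r / 4 \<le> real (card P) * (32 / (real Q)\<^sup>2)" by simp
    then have "r * (real Q)\<^sup>2 / 128 \<le> real (card P)" using Q by (simp add: field_simps)
    then show "r * (real Q)\<^sup>2 / 128 \<le> real (card {x \<in> {u..u+r}. \<exists>q::nat. real Q / 16 \<le> real q \<and> 0 < q \<and> q \<le> Q \<and> real q * x \<in> \<int>})
    \<and> finite {x \<in> {u..u+r}. \<exists>q::nat. real Q / 16 \<le> real q \<and> 0 < q \<and> q \<le> Q \<and> real q * x \<in> \<int>}"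
      using finP unfolding P_def by simp
  qed
qed

section \<open>Descent through intervals that meet little of the cover\<close>

text \<open>Total weight of the covering sets that touch \<open>J\<close>. Controlling it replaces
  the construction of a measure on the limsup set: the invariant is a bound by (length /
  1536)^s.\<close>

definition hit_mass :: "(nat \<Rightarrow> real) \<Rightarrow> (nat \<Rightarrow> real set) \<Rightarrow> real set \<Rightarrow> real" where
  "hit_mass v U J = (\<Sum>i. if U i \<inter> J \<noteq> {} then v i else 0)"

lemma summable_hit:
  assumes "summable v" "\<And>i. (0::real) \<le> v i"
  shows "summable (\<lambda>i::nat. if P i then v i else 0)"
  by (rule summable_comparison_test'[OF assms(1), of 0]) (use assms(2) in auto)

lemma le_hit_mass:
  assumes "summable v" "\<And>i. 0 \<le> v i" "U i \<inter> J \<noteq> {}"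
  shows "v i \<le> hit_mass v U J"
proof -
  have "v i = (\<Sum>j\<in>{i}. if U j \<inter> J \<noteq> {} then v j else 0)" using assms(3) by simp
  also have "\<dots> \<le> hit_mass v U J"
    unfolding hit_mass_def using assms by (intro sum_le_suminf summable_hit) auto
  finally show ?thesis .
qed

lemma sum_le_hit_mass:
  assumes "summable v" "\<And>i. 0 \<le> v i" "finite K" "\<And>i. i \<in> K \<Longrightarrow> U i \<inter> J \<noteq> {}"
  shows "(\<Sum>i\<in>K. v i) \<le> hit_mass v U J"
proof -
  have "(\<Sum>i\<in>K. v i) = (\<Sum>j\<in>K. if U j \<inter> J \<noteq> {} then v j else 0)"
    using assms(4) by (intro sum.cong) auto
  also have "\<dots> \<le> hit_mass v U J"
    unfolding hit_mass_def using assms by (intro sum_le_suminf summable_hit) auto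
  finally show ?thesis .
qed

text \<open>Among the many rationals of height at most \<open>Q\<close> in \<open>{a..b}\<close>, few are met by covering sets larger
  than the spacing \<open>1 / Q\<^sup>2\<close>, and each smaller set meets at most three of the children; hence some child
  inherits the bound on the mass.\<close>

lemma hit_mass_step:
  fixes U :: "nat \<Rightarrow> real set" and v :: "nat \<Rightarrow> real"
  assumes v: "summable v" "\<And>i. 0 < v i"
    and s: "0 < s" "1 \<le> \<rho>" "s * (1 + \<rho>) < 2"
    and U: "\<And>i x y. x \<in> U i \<Longrightarrow> y \<in> U i \<Longrightarrow> \<bar>x - y\<bar> \<le> v i powr (1 / s)"
    and ab: "a < b" and mass: "hit_mass v U {a..b} \<le> ((b - a) / 1536) powr s"
  shows "\<exists>a' b'. \<exists>q::nat. a \<le> a' \<and> a' < b' \<and> b' \<le> b \<and> b' - a' \<le> 1 / real (Suc N) \<and> N < q \<and>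
    hit_mass v U {a'..b'} \<le> ((b' - a') / 1536) powr s \<and> (\<forall>x\<in>{a'..b'}. dist_int (real q * x) < real q powr - \<rho>)"
proof -
  define r where "r = b - a"
  define w where "w = (\<lambda>i. v i powr (1 / s))"
  \<comment> \<open>Length of a child interval about p: then q |x - p| <= Q^-\<rho> / 4 for its
    points x and all q <= Q.\<close>
  define r' where "r' = (\<lambda>Q::nat. real Q powr (- 1 - \<rho>) / 2)"
  \<comment> \<open>Centres lie in the middle half, so that children of length at most r / 4 stay
    inside {a..b}.\<close>
  define P where "P = (\<lambda>Q::nat. {x \<in> {a + r/4..a + r/4 + r/2}.
      \<exists>q::nat. real Q / 16 \<le> real q \<and> 0 < q \<and> q \<le> Q \<and> real q * x \<in> \<int>})"
  have r: "r > 0" using ab by (simp add: r_def)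
  have v0: "\<And>i. 0 \<le> v i" using v(2) by (simp add: less_imp_le)
  have "s * 2 \<le> s * (1 + \<rho>)" using s by (intro mult_left_mono) auto
  then have s1: "s < 1" using s(3) by linarith
  have w0: "0 < w i" for i using v(2)[of i] by (simp add: w_def)
  have vw: "v i = w i powr s" for i using v(2)[of i] s by (simp add: w_def powr_powr)
  \<comment> \<open>This is what contradicts the mass count at the end; the exponent of Q is
    positive because s (1 + \<rho>) < 2.\<close>
  have "\<forall>\<^sub>F Q::nat in sequentially. 1536 * 2 powr s * r powr (s - 1) < real Q powr (2 - s * (1 + \<rho>))"
    using s by real_asymp
  moreover have "\<forall>\<^sub>F Q::nat in sequentially. r' Q \<le> r / 4"
    unfolding r'_def using r s by real_asymp
  moreover have "\<forall>\<^sub>F Q::nat in sequentially. r' Q \<le> 1 / real (Suc N)"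
    unfolding r'_def using s by real_asymp
  moreover have "\<forall>\<^sub>F Q::nat in sequentially. real N < real Q / 16" by real_asymp
  moreover have "\<forall>\<^sub>F Q::nat in sequentially. r / 2 * (real Q)\<^sup>2 / 128 \<le> real (card (P Q)) \<and> finite (P Q)"
    unfolding P_def using many_rationals_in_interval[of "r / 2" "a + r / 4"] r by simp
  ultimately have "\<forall>\<^sub>F Q::nat in sequentially.
      1536 * 2 powr s * r powr (s - 1) < real Q powr (2 - s * (1 + \<rho>)) \<and> r' Q \<le> r / 4 \<and>
      r' Q \<le> 1 / real (Suc N) \<and> real N < real Q / 16 \<and>
      r / 2 * (real Q)\<^sup>2 / 128 \<le> real (card (P Q)) \<and> finite (P Q)"
    by (auto simp only: eventually_conj_iff)
  then obtain Q :: nat where Q: "1536 * 2 powr s * r powr (s - 1) < real Q powr (2 - s * (1 + \<rho>))"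
      "r' Q \<le> r / 4" "r' Q \<le> 1 / real (Suc N)" "real N < real Q / 16"
      "r / 2 * (real Q)\<^sup>2 / 128 \<le> real (card (P Q))" "finite (P Q)"
    by (metis (mono_tags, lifting) eventually_sequentially order_refl)
  have "0 < Q" using Q(4) by (auto intro: gr0I)
  then have Q1: "real Q \<ge> 1" by simp
  have r'0: "r' Q > 0" using Q1 by (simp add: r'_def)
  have r'Q: "r' Q * (real Q)\<^sup>2 \<le> 1 / 2"
  proof -
    have "r' Q * (real Q)\<^sup>2 = real Q powr (1 - \<rho>) / 2"
      using Q1 by (simp add: r'_def powr_add[symmetric] flip: powr_numeral)
    also have "real Q powr (1 - \<rho>) \<le> 1" using Q1 s powr_mono[of "1 - \<rho>" 0 "real Q"] by simp
    finally show ?thesis by simp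
  qed
  define J where "J = (\<lambda>p. {p - r' Q / 2..p + r' Q / 2})"
  have JI: "J p \<subseteq> {a..b}" if "p \<in> P Q" for p
    using that Q(2) r by (auto simp: J_def P_def r_def field_simps)
  \<comment> \<open>The centres hit lie within \<open>w i + r' Q\<close> of each other and are 1 /
    Q^2 apart, and r' Q^2 <= 1/2, so their number is at most w Q^2 + 3/2.\<close>
  have hits: "real (card {p \<in> P Q. U i \<inter> J p \<noteq> {}}) \<le> 3 * max 1 (w i * (real Q)\<^sup>2)" for i
  proof -
    have "real (card {p \<in> P Q. U i \<inter> J p \<noteq> {}}) \<le> (w i + r' Q) / (1 / (real Q)\<^sup>2) + 1"
    proof (rule card_separated_le)
      fix x y assume "x \<in> {p \<in> P Q. U i \<inter> J p \<noteq> {}}" "y \<in> {p \<in> P Q. U i \<inter> J p \<noteq> {}}"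
      then obtain x' y' where xy: "x \<in> P Q" "y \<in> P Q" "x' \<in> U i" "y' \<in> U i" "x' \<in> J x" "y' \<in> J y" by blast
      from U[OF xy(3,4)] xy(5,6) show "\<bar>x - y\<bar> \<le> w i + r' Q" unfolding w_def J_def by auto
      assume "x \<noteq> y"
      with xy(1,2) show "1 / (real Q)\<^sup>2 \<le> \<bar>x - y\<bar>"
        unfolding P_def by (auto intro: rationals_separated)
    qed (use Q w0[of i] r'0 Q1 in auto)
    also have "\<dots> = w i * (real Q)\<^sup>2 + r' Q * (real Q)\<^sup>2 + 1" by (simp add: algebra_simps)
    finally show ?thesis using r'Q by linarith
  qed
  define L where "L = {i. U i \<inter> {a..b} \<noteq> {} \<and> 1 \<le> w i * (real Q)\<^sup>2}"
  have finL: "finite L"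
  proof -
    have "v \<longlonglongrightarrow> 0" using v(1) by (rule summable_LIMSEQ_zero)
    moreover have "(1 / (real Q)\<^sup>2) powr s > 0" using Q1 by simp
    ultimately have "\<forall>\<^sub>F i in sequentially. v i < (1 / (real Q)\<^sup>2) powr s"
      by (rule order_tendstoD)
    then obtain n where n: "\<And>i. i \<ge> n \<Longrightarrow> v i < (1 / (real Q)\<^sup>2) powr s"
      unfolding eventually_sequentially by blast
    have "L \<subseteq> {..<n}"
    proof (rule subsetI, rule ccontr)
      fix i assume i: "i \<in> L" "i \<notin> {..<n}"
      then have "1 / (real Q)\<^sup>2 \<le> w i" using Q1 by (simp add: L_def field_simps)
      then have "(1 / (real Q)\<^sup>2) powr s \<le> v i" unfolding vw using s by (intro powr_mono2) auto
      with n[of i] i show False by simp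
    qed
    then show ?thesis by (rule finite_subset) auto
  qed
  \<comment> \<open>Since s < 1, w = v w^(1-s), and the mass bound caps both the sum of the v and
    each w. As 1536 = 3 * 512, the large sets then spoil at most r Q^2 / 512 rationals, half of
    those available.\<close>
  have wL: "(\<Sum>i\<in>L. w i) \<le> r / 1536"
  proof -
    have "(\<Sum>i\<in>L. w i) \<le> (\<Sum>i\<in>L. v i * (r / 1536) powr (1 - s))"
    proof (rule sum_mono)
      fix i assume "i \<in> L"
      then have "v i \<le> hit_mass v U {a..b}" using v v0 by (intro le_hit_mass) (auto simp: L_def)
      also have "\<dots> \<le> (r / 1536) powr s" using mass by (simp add: r_def)
      finally have "w i \<le> r / 1536"
        unfolding vw using w0[of i] r s by (metis divide_pos_pos less_imp_le not_le powr_less_mono2 zero_less_numeral)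
      then have "w i powr (1 - s) \<le> (r / 1536) powr (1 - s)"
        using w0[of i] s1 by (intro powr_mono2) auto
      then have "v i * w i powr (1 - s) \<le> v i * (r / 1536) powr (1 - s)"
        using v0 by (intro mult_left_mono) auto
      then show "w i \<le> v i * (r / 1536) powr (1 - s)"
        using w0[of i] by (simp add: vw powr_add[symmetric])
    qed
    also have "\<dots> = (\<Sum>i\<in>L. v i) * (r / 1536) powr (1 - s)" by (simp add: sum_distrib_right)
    also have "\<dots> \<le> (r / 1536) powr s * (r / 1536) powr (1 - s)"
    proof (intro mult_right_mono)
      have "(\<Sum>i\<in>L. v i) \<le> hit_mass v U {a..b}"
        using v v0 finL by (intro sum_le_hit_mass) (auto simp: L_def)
      then show "(\<Sum>i\<in>L. v i) \<le> (r / 1536) powr s" using mass by (simp add: r_def)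
    qed auto
    also have "\<dots> = r / 1536" using r by (simp add: powr_add[symmetric])
    finally show ?thesis .
  qed
  define B where "B = (\<Union>i\<in>L. {p \<in> P Q. U i \<inter> J p \<noteq> {}})"
  have "real (card B) \<le> (\<Sum>i\<in>L. real (card {p \<in> P Q. U i \<inter> J p \<noteq> {}}))"
    unfolding B_def using card_UN_le[OF finL, of "\<lambda>i. {p \<in> P Q. U i \<inter> J p \<noteq> {}}"]
    by (simp flip: of_nat_sum)
  also have "\<dots> \<le> (\<Sum>i\<in>L. 3 * (real Q)\<^sup>2 * w i)"
    by (intro sum_mono order.trans[OF hits]) (auto simp: L_def max_def)
  also have "\<dots> = 3 * (real Q)\<^sup>2 * (\<Sum>i\<in>L. w i)" by (simp add: sum_distrib_left)
  also have "\<dots> \<le> 3 * (real Q)\<^sup>2 * (r / 1536)" using wL by (intro mult_left_mono) auto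
  finally have cardB: "real (card B) \<le> r * (real Q)\<^sup>2 / 512" by simp
  define G where "G = P Q - B"
  have finG: "finite G" using Q(6) by (simp add: G_def)
  have cardG: "r * (real Q)\<^sup>2 / 512 \<le> real (card G)"
  proof -
    have "B \<subseteq> P Q" by (auto simp: B_def)
    then have "real (card G) = real (card (P Q)) - real (card B)"
      using Q(6) card_mono[of "P Q" B] by (simp add: G_def card_Diff_subset finite_subset of_nat_diff)
    then show ?thesis using cardB Q(5) by simp
  qed
  \<comment> \<open>Interchanging the sums: the sets left to touch a child of \<open>G\<close> are
    smaller than the spacing, so each is counted at most three times.\<close>
  have "(\<Sum>p\<in>G. hit_mass v U (J p)) = (\<Sum>i. \<Sum>p\<in>G. if U i \<inter> J p \<noteq> {} then v i else 0)"
    unfolding hit_mass_def using v v0 by (intro suminf_sum[symmetric] summable_hit)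
  also have "\<dots> \<le> (\<Sum>i. 3 * (if U i \<inter> {a..b} \<noteq> {} then v i else 0))"
  proof (rule suminf_le)
    fix i
    have *: "(\<Sum>p\<in>G. if U i \<inter> J p \<noteq> {} then v i else 0) = real (card {p \<in> G. U i \<inter> J p \<noteq> {}}) * v i"
      using finG by (simp add: sum.If_cases Int_def)
    show "(\<Sum>p\<in>G. if U i \<inter> J p \<noteq> {} then v i else 0) \<le> 3 * (if U i \<inter> {a..b} \<noteq> {} then v i else 0)"
    proof (cases "{p \<in> G. U i \<inter> J p \<noteq> {}} = {}")
      case False
      then obtain p where p: "p \<in> P Q" "p \<notin> B" "U i \<inter> J p \<noteq> {}" by (auto simp: G_def)
      then have hit: "U i \<inter> {a..b} \<noteq> {}" using JI by blast
      with p have "i \<notin> L" by (auto simp: B_def)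
      with hit have "max 1 (w i * (real Q)\<^sup>2) = 1" by (auto simp: L_def)
      then have "real (card {p \<in> P Q. U i \<inter> J p \<noteq> {}}) \<le> 3" using hits[of i] by simp
      moreover have "card {p \<in> G. U i \<inter> J p \<noteq> {}} \<le> card {p \<in> P Q. U i \<inter> J p \<noteq> {}}"
        using Q(6) by (intro card_mono) (auto simp: G_def)
      ultimately have "real (card {p \<in> G. U i \<inter> J p \<noteq> {}}) \<le> 3" by linarith
      then show ?thesis unfolding * using hit v0 by (simp add: mult_right_mono)
    next
      case True
      show ?thesis unfolding * True using v0 by simp
    qed
  qed (use v v0 in \<open>auto intro!: summable_sum summable_hit summable_mult\<close>)
  also have "\<dots> = 3 * hit_mass v U {a..b}"
    unfolding hit_mass_def using v v0 by (intro suminf_mult summable_hit)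
  also have "\<dots> \<le> 3 * (r / 1536) powr s" using mass by (simp add: r_def)
  finally have total: "(\<Sum>p\<in>G. hit_mass v U (J p)) \<le> 3 * (r / 1536) powr s" .
  \<comment> \<open>If every child were too heavy, the total would exceed r Q^2 / 512 times (r' /
    1536)^s. Up to constants this is Q^(2 - s (1 + \<rho>)), which outgrows the mass
    available.\<close>
  have "\<exists>p\<in>G. hit_mass v U (J p) \<le> (r' Q / 1536) powr s"
  proof (rule ccontr)
    assume "\<not> ?thesis"
    then have "(\<Sum>p\<in>G. (r' Q / 1536) powr s) \<le> (\<Sum>p\<in>G. hit_mass v U (J p))"
      by (intro sum_mono) auto
    then have "real (card G) * (r' Q / 1536) powr s \<le> 3 * (r / 1536) powr s" using total by simp
    moreover have "r * (real Q)\<^sup>2 / 512 * (r' Q / 1536) powr s \<le> real (card G) * (r' Q / 1536) powr s"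
      using cardG by (intro mult_right_mono) auto
    ultimately have "r * (real Q)\<^sup>2 / 512 * (r' Q powr s / 1536 powr s) \<le> 3 * (r powr s / 1536 powr s)"
      using r r'0 by (simp add: powr_divide)
    then have "r * ((real Q)\<^sup>2 * r' Q powr s) \<le> 1536 * r powr s"
      by (simp add: field_simps)
    also have "r' Q powr s = real Q powr (- s * (1 + \<rho>)) / 2 powr s"
    proof -
      have e: "(- 1 - \<rho>) * s = - s * (1 + \<rho>)" by (simp add: algebra_simps)
      have "r' Q powr s = (real Q powr (- 1 - \<rho>)) powr s / 2 powr s"
        unfolding r'_def by (simp add: powr_divide)
      then show ?thesis by (simp only: powr_powr e)
    qed
    also have "(real Q)\<^sup>2 * (real Q powr (- s * (1 + \<rho>)) / 2 powr s) = real Q powr (2 - s * (1 + \<rho>)) / 2 powr s"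
    proof -
      have "(real Q)\<^sup>2 * real Q powr (- X) = real Q powr (2 - X)" for X
        using Q1 by (simp add: powr_diff powr_minus divide_inverse)
      from this[of "s * (1 + \<rho>)"] show ?thesis by simp
    qed
    finally have "r * real Q powr (2 - s * (1 + \<rho>)) \<le> 1536 * 2 powr s * r powr s"
      by (simp add: field_simps)
    moreover have "r * (1536 * 2 powr s * r powr (s - 1)) < r * real Q powr (2 - s * (1 + \<rho>))"
      using Q(1) r by (intro mult_strict_left_mono)
    moreover have "r * (1536 * 2 powr s * r powr (s - 1)) = 1536 * 2 powr s * r powr s"
      using r by (simp add: powr_diff)
    ultimately show False by simp
  qed
  then obtain p where p: "p \<in> P Q" "hit_mass v U (J p) \<le> (r' Q / 1536) powr s"
    by (auto simp: G_def)
  then obtain q :: nat where q: "real Q / 16 \<le> real q" "0 < q" "q \<le> Q" "real q * p \<in> \<int>"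
    by (auto simp: P_def)
  obtain m where m: "real q * p = of_int m" using q(4) by (auto elim: Ints_cases)
  have approx: "dist_int (real q * x) < real q powr - \<rho>" if "x \<in> J p" for x
  proof -
    have "dist_int (real q * x) \<le> \<bar>real q * x - of_int m\<bar>"
      unfolding dist_int_def by (intro cINF_lower bdd_belowI[of _ 0]) auto
    also have "real q * x - of_int m = real q * (x - p)" using m by (simp add: algebra_simps)
    also have "\<bar>real q * (x - p)\<bar> = real q * \<bar>x - p\<bar>" by (simp add: abs_mult)
    also have "\<bar>x - p\<bar> \<le> r' Q / 2"
      using that unfolding J_def atLeastAtMost_iff by linarith
    then have "real q * \<bar>x - p\<bar> \<le> real Q * (r' Q / 2)" using q by (intro mult_mono) auto
    also have "\<dots> = real Q * (real Q powr (- 1 - \<rho>) / 4)" by (simp add: r'_def)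
    also have "\<dots> = real Q powr - \<rho> / 4"
      using Q1 by (simp add: powr_diff powr_minus field_simps)
    also have "\<dots> < real Q powr - \<rho>" using Q1 by simp
    also have "\<dots> \<le> real q powr - \<rho>" using q s by (intro powr_mono2') auto
    finally show ?thesis .
  qed
  have "N < q" using q(1) Q(4) by linarith
  moreover have "a \<le> p - r' Q / 2" "p + r' Q / 2 \<le> b" using JI[OF p(1)] r'0 by (auto simp: J_def)
  ultimately show ?thesis
    using p(2) approx r'0 Q(3) unfolding J_def
    by (intro exI[of _ "p - r' Q / 2"] exI[of _ "p + r' Q / 2"] exI[of _ q]) auto
qed

text \<open>A cheap cover would start the descent on {a..b}. The nested intervals shrink to a point
  of the set, and the covering set containing it would have to have weight 0.\<close>

lemma Jarnik_Besicovitch_content: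
  assumes ab: "a < b" and s: "0 < s" "1 \<le> \<rho>" "s * (1 + \<rho>) < 2"
  shows "hausdorff_content s {x \<in> {a..b}. infinite {q::nat. q > 0 \<and> dist_int (real q * x) < real q powr - \<rho>}} \<noteq> 0"
    (is "hausdorff_content s ?E \<noteq> 0")
proof
  assume null: "hausdorff_content s ?E = 0"
  define \<kappa> where "\<kappa> = ((b - a) / 1536) powr s"
  have \<kappa>: "\<kappa> > 0" using ab by (simp add: \<kappa>_def)
  have "hausdorff_content s ?E < ennreal (\<kappa> / 2)" using null \<kappa> by simp
  then obtain U where U: "\<And>i::nat. bounded (U i)" "?E \<subseteq> (\<Union>i. U i)"
    "(\<Sum>i. diam_pow s (U i)) < ennreal (\<kappa> / 2)"
    by (rule hausdorff_content_less_obtain) blast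
  define d where "d = (\<lambda>i. diameter (U i) powr s)"
  \<comment> \<open>The geometric term makes every weight positive, even for covering sets of
    diameter 0; otherwise the final contradiction would fail.\<close>
  define v where "v = (\<lambda>i. d i + \<kappa> / 2 * (1/2) ^ Suc i)"
  have d0: "0 \<le> d i" for i by (simp add: d_def)
  have dfin: "(\<Sum>i. ennreal (d i)) < ennreal (\<kappa> / 2)"
    using U(3) s by (simp add: d_def diam_pow_pos_exponent)
  then have dsum: "summable d" using d0 by (intro summable_suminf_not_top) auto
  have dle: "(\<Sum>i. d i) \<le> \<kappa> / 2"
    using dfin \<kappa> d0 dsum by (subst (asm) suminf_ennreal2) (auto simp: ennreal_less_iff suminf_nonneg)
  have g: "(\<lambda>i. \<kappa> / 2 * (1/2) ^ Suc i) sums (\<kappa> / 2)"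
    using sums_mult[OF power_half_series, of "\<kappa> / 2"] by simp
  have v: "summable v" unfolding v_def using dsum g by (intro summable_add) (auto simp: sums_iff)
  have vpos: "0 < v i" for i using d0[of i] \<kappa> by (simp add: v_def add_nonneg_pos)
  have "hit_mass v U {a..b} \<le> (\<Sum>i. v i)"
    unfolding hit_mass_def using v vpos
    by (intro suminf_le summable_hit) (auto simp: less_imp_le)
  also have "\<dots> = (\<Sum>i. d i) + \<kappa> / 2"
    unfolding v_def using dsum g by (subst suminf_add[symmetric]) (auto simp: sums_iff)
  also have "\<dots> \<le> \<kappa>" using dle by simp
  finally have mass0: "hit_mass v U {a..b} \<le> ((b - a) / 1536) powr s" by (simp add: \<kappa>_def)
  have diam: "\<bar>x - y\<bar> \<le> v i powr (1 / s)" if "x \<in> U i" "y \<in> U i" for i x y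
  proof -
    have "\<bar>x - y\<bar> \<le> diameter (U i)"
      using diameter_bounded_bound[OF U(1) that] by (simp add: dist_real_def)
    also have "\<dots> = d i powr (1 / s)"
      using s diameter_ge_0[OF U(1)] by (simp add: d_def powr_powr)
    also have "\<dots> \<le> v i powr (1 / s)"
      using s d0 \<kappa> by (intro powr_mono2) (auto simp: v_def)
    finally show ?thesis .
  qed
  define good where "good = (\<lambda>(N::nat) (z::real \<times> real \<times> nat). case z of (a', b', q) \<Rightarrow>
    a' < b' \<and> hit_mass v U {a'..b'} \<le> ((b' - a') / 1536) powr s)"
  define step where "step = (\<lambda>(N::nat) (z::real \<times> real \<times> nat) (z'::real \<times> real \<times> nat).
    case z of (a, b, q) \<Rightarrow> case z' of (a', b', q') \<Rightarrow>
      a \<le> a' \<and> b' \<le> b \<and> b' - a' \<le> 1 / real (Suc (N + q)) \<and> N + q < q' \<and>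
      (\<forall>x\<in>{a'..b'}. dist_int (real q' * x) < real q' powr - \<rho>))"
  have "\<exists>f. \<forall>n. good n (f n) \<and> step n (f n) (f (Suc n)) \<and> fst (f 0) \<ge> a \<and> fst (snd (f 0)) \<le> b"
  proof -
    have "\<exists>f. \<forall>n. (good n (f n) \<and> (n = 0 \<longrightarrow> f n = (a, b, 0))) \<and> step n (f n) (f (Suc n))"
    proof (rule dependent_nat_choice[where P = "\<lambda>n z. good n z \<and> (n = 0 \<longrightarrow> z = (a, b, 0))" and Q = step])
      show "\<exists>z. good 0 z \<and> ((0::nat) = 0 \<longrightarrow> z = (a, b, 0))"
        using ab mass0 by (auto simp: good_def)
      fix z n assume z: "good n z \<and> (n = 0 \<longrightarrow> z = (a, b, 0))"
      obtain a1 b1 q1 where zz: "z = (a1, b1, q1)" by (cases z)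
      from z have "a1 < b1" "hit_mass v U {a1..b1} \<le> ((b1 - a1) / 1536) powr s"
        by (auto simp: good_def zz)
      \<comment> \<open>This threshold makes the denominators strictly increasing, hence infinitely
        many, and the lengths tend to 0.\<close>
      from hit_mass_step[OF v vpos s diam this, of "n + q1"]
      obtain a' b' q' where "a1 \<le> a'" "a' < b'" "b' \<le> b1" "b' - a' \<le> 1 / real (Suc (n + q1))"
        "n + q1 < q'" "hit_mass v U {a'..b'} \<le> ((b' - a') / 1536) powr s"
        "\<forall>x\<in>{a'..b'}. dist_int (real q' * x) < real q' powr - \<rho>"
        by blast
      then show "\<exists>z'. (good (Suc n) z' \<and> (Suc n = 0 \<longrightarrow> z' = (a, b, 0))) \<and> step n z z'"
        by (intro exI[of _ "(a', b', q')"]) (auto simp: good_def step_def zz)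
    qed
    then show ?thesis by (metis fst_conv order_refl snd_conv)
  qed
  then obtain f where f: "\<And>n. good n (f n)" "\<And>n. step n (f n) (f (Suc n))"
      "fst (f 0) \<ge> a" "fst (snd (f 0)) \<le> b" by blast
  define A where "A = (\<lambda>n. fst (f n))"
  define B where "B = (\<lambda>n. fst (snd (f n)))"
  define q where "q = (\<lambda>n. snd (snd (f n)))"
  have fn: "f n = (A n, B n, q n)" for n by (simp add: A_def B_def q_def)
  have AB: "A n < B n" "hit_mass v U {A n..B n} \<le> ((B n - A n) / 1536) powr s" for n
    using f(1)[of n] by (auto simp: good_def fn)
  have nest: "A n \<le> A (Suc n)" "B (Suc n) \<le> B n" "B (Suc n) - A (Suc n) \<le> 1 / real (Suc (n + q n))"
      "n + q n < q (Suc n)" "\<And>x. x \<in> {A (Suc n)..B (Suc n)} \<Longrightarrow> dist_int (real (q (Suc n)) * x) < real (q (Suc n)) powr - \<rho>"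
    for n using f(2)[of n] by (auto simp: step_def fn)
  have incA: "incseq A" using nest(1) by (rule incseq_SucI)
  have decB: "decseq B" using nest(2) by (rule decseq_SucI)
  have "A n \<le> B 0" for n
    using AB(1)[of n] decseqD[OF decB, of 0 n] by simp
  then have bdd: "bdd_above (range A)" by (intro bdd_aboveI[of _ "B 0"]) auto
  define x where "x = (SUP n. A n)"
  have x: "A n \<le> x" "x \<le> B n" for n
  proof -
    show "A n \<le> x" unfolding x_def using bdd by (intro cSUP_upper) auto
    have "A m \<le> B n" for m
      using AB(1)[of "max m n"] incseqD[OF incA, of m "max m n"] decseqD[OF decB, of n "max m n"] by simp
    then show "x \<le> B n" unfolding x_def by (intro cSUP_least) auto
  qed
  have qmono: "strict_mono q"
    using nest(4) by (intro strict_monoI_Suc) (metis add_leE not_le order.strict_trans2 le_add2 less_le_trans not_less)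
  have "x \<in> ?E"
  proof -
    have "(\<lambda>n. q (Suc n)) ` UNIV \<subseteq> {q. q > 0 \<and> dist_int (real q * x) < real q powr - \<rho>}"
      using nest(5) x by (auto intro: order.strict_trans1[OF zero_le nest(4)])
    moreover have "infinite (range (\<lambda>n. q (Suc n)))"
      using qmono by (intro range_inj_infinite) (auto simp: inj_def strict_mono_eq)
    ultimately have "infinite {q. q > 0 \<and> dist_int (real q * x) < real q powr - \<rho>}"
      using finite_subset by blast
    moreover have "x \<in> {a..b}" using x[of 0] f(3,4) by (auto simp: A_def B_def)
    ultimately show ?thesis by simp
  qed
  \<comment> \<open>This one set touches every interval of the descent, so its weight is below all
    their mass bounds.\<close>
  then obtain i where "x \<in> U i" using U(2) by blast
  then have "U i \<inter> {A n..B n} \<noteq> {}" for n using x[of n] by auto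
  then have "v i \<le> hit_mass v U {A n..B n}" for n
    using v vpos by (intro le_hit_mass) (auto simp: less_imp_le)
  then have le: "v i \<le> ((B n - A n) / 1536) powr s" for n using AB(2) order.trans by blast
  have "v i \<le> (1 / real (Suc n)) powr s" for n
  proof -
    have "1 / real (Suc (n + q n)) \<le> 1 / real (Suc n)" by (simp add: field_simps)
    moreover have "(B (Suc n) - A (Suc n)) / 1536 \<le> B (Suc n) - A (Suc n)"
      using AB(1)[of "Suc n"] by simp
    ultimately have "(B (Suc n) - A (Suc n)) / 1536 \<le> 1 / real (Suc n)"
      using nest(3)[of n] by (meson order.trans)
    then have "((B (Suc n) - A (Suc n)) / 1536) powr s \<le> (1 / real (Suc n)) powr s"
      using AB(1)[of "Suc n"] s by (intro powr_mono2) auto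
    then show ?thesis using le[of "Suc n"] by simp
  qed
  moreover have "(\<lambda>n. (1 / real (Suc n)) powr s) \<longlonglongrightarrow> 0" using s by real_asymp
  ultimately have "v i \<le> 0" by (intro LIMSEQ_le_const) auto
  with vpos[of i] show False by simp
qed

section \<open>Rational points near a curve\<close>

text \<open>A pair of uniformly convex functions that are Legendre conjugate to each other, with derivatives
  \<open>g\<close> and \<open>gs\<close>.  The conditions are symmetric in \<open>(f, g)\<close> and \<open>(fs, gs)\<close>: the rational lines
  \<open>y = s x - \<tau>\<close> almost tangent to the graph of \<open>f\<close> are the rational points \<open>(s, \<tau>)\<close> near the graph of \<open>fs\<close>.\<close>

definition conj_pair ::
  "real \<Rightarrow> real \<Rightarrow> (real \<Rightarrow> real) \<Rightarrow> (real \<Rightarrow> real) \<Rightarrow> (real \<Rightarrow> real) \<Rightarrow> (real \<Rightarrow> real) \<Rightarrow> bool" where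
  "conj_pair c C f g fs gs \<longleftrightarrow>
     (\<forall>x y. c * (y - x)\<^sup>2 \<le> f y - f x - g x * (y - x) \<and> f y - f x - g x * (y - x) \<le> C * (y - x)\<^sup>2) \<and>
     (\<forall>x y. c * (y - x)\<^sup>2 \<le> fs y - fs x - gs x * (y - x) \<and> fs y - fs x - gs x * (y - x) \<le> C * (y - x)\<^sup>2) \<and>
     (\<forall>x. gs (g x) = x) \<and> (\<forall>x. g (gs x) = x) \<and> (\<forall>x. f x + fs (g x) = x * g x)"

lemma conj_pair_sym: "conj_pair c C f g fs gs \<Longrightarrow> conj_pair c C fs gs f g"
  unfolding conj_pair_def by (metis add.commute mult.commute)

lemma conj_pair_translate:
  "conj_pair c C f g fs gs \<Longrightarrow> conj_pair c C (\<lambda>x. f x + t) g (\<lambda>x. fs x - t) gs"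
  unfolding conj_pair_def by simp

lemma conj_pair_lower: "conj_pair c C f g fs gs \<Longrightarrow> c * (y - x)\<^sup>2 \<le> f y - f x - g x * (y - x)"
  and conj_pair_upper: "conj_pair c C f g fs gs \<Longrightarrow> f y - f x - g x * (y - x) \<le> C * (y - x)\<^sup>2"
  unfolding conj_pair_def by blast+

lemma conj_pair_le: "conj_pair c C f g fs gs \<Longrightarrow> c \<le> C"
  using conj_pair_lower[of c C f g fs gs 1 0] conj_pair_upper[of c C f g fs gs 1 0] by simp

text \<open>Adding the inequalities for (x, y) and (y, x) cancels the values of f.\<close>

lemma conj_pair_deriv_diff:
  assumes "conj_pair c C f g fs gs" "x \<le> y"
  shows "2 * c * (y - x) \<le> g y - g x" "g y - g x \<le> 2 * C * (y - x)"
proof -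
  have "2 * c * (y - x)\<^sup>2 \<le> (g y - g x) * (y - x)" "(g y - g x) * (y - x) \<le> 2 * C * (y - x)\<^sup>2"
    using conj_pair_lower[OF assms(1), of y x] conj_pair_lower[OF assms(1), of x y]
      conj_pair_upper[OF assms(1), of y x] conj_pair_upper[OF assms(1), of x y]
    by (simp_all add: algebra_simps power2_commute power2_eq_square)
  then show "2 * c * (y - x) \<le> g y - g x" "g y - g x \<le> 2 * C * (y - x)"
    using assms(2) by (cases "x = y"; simp add: power2_eq_square mult.assoc[symmetric])+
qed

lemma conj_pair_deriv_Lipschitz:
  assumes "conj_pair c C f g fs gs" "0 < c"
  shows "\<bar>g y - g x\<bar> \<le> 2 * C * \<bar>y - x\<bar>"
proof -
  have *: "\<bar>g v - g u\<bar> \<le> 2 * C * \<bar>v - u\<bar>" if "u \<le> v" for u v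
  proof -
    have "0 \<le> 2 * c * (v - u)" using assms(2) that by simp
    then show ?thesis using conj_pair_deriv_diff[OF assms(1) that] that by simp
  qed
  show ?thesis using *[of x y] *[of y x] by (cases "x \<le> y") (auto simp: abs_minus_commute)
qed

section \<open>Rational points in thin strips\<close>

text \<open>Points are pairs of reals, so that one with several admissible denominators is counted
  once.\<close>

definition rat_points_near :: "(real \<Rightarrow> real) \<Rightarrow> real \<Rightarrow> real \<Rightarrow> nat \<Rightarrow> real \<Rightarrow> (real \<times> real) set" where
  "rat_points_near f a b Q \<eta> = {(x, y). (\<exists>q::nat. 0 < q \<and> q \<le> Q \<and> real q * x \<in> \<int> \<and> real q * y \<in> \<int>) \<and>
     a \<le> x \<and> x \<le> b \<and> \<bar>f x - y\<bar> \<le> \<eta>}"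

lemma finite_rat_points_near: "finite (rat_points_near f a b Q \<eta>)"
proof (rule finite_subset)
  define Z where "Z = (\<lambda>q::nat. {p::int. real q * a \<le> of_int p \<and> of_int p \<le> real q * b})"
  define Y where "Y = (\<lambda>(q::nat, p::int). {r::int. real q * (f (of_int p / real q) - \<eta>) \<le> of_int r \<and>
      of_int r \<le> real q * (f (of_int p / real q) + \<eta>)})"
  have "finite (Z q)" "finite (Y (q, p))" for q p by (auto simp: Z_def Y_def finite_Ints_between)
  then show "finite ((\<lambda>((q, p), r). (of_int p / real q, of_int r / real q)) ` (SIGMA z:(SIGMA q:{1..Q}. Z q). Y z))"
    by (intro finite_imageI finite_SigmaI) auto
  show "rat_points_near f a b Q \<eta> \<subseteq> (\<lambda>((q, p), r). (of_int p / real q, of_int r / real q)) ` (SIGMA z:(SIGMA q:{1..Q}. Z q). Y z)"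
  proof clarify
    fix x y assume "(x, y) \<in> rat_points_near f a b Q \<eta>"
    then obtain q p r where *: "0 < q" "q \<le> Q" "real q * x = of_int p" "real q * y = of_int r"
      "a \<le> x" "x \<le> b" "\<bar>f x - y\<bar> \<le> \<eta>"
      by (auto simp: rat_points_near_def elim!: Ints_cases)
    then have xy: "x = of_int p / real q" "y = of_int r / real q" by (auto simp: field_simps)
    have "f x - \<eta> \<le> y" "y \<le> f x + \<eta>" using *(7) by (auto simp: abs_le_iff)
    then have "real q * a \<le> real q * x \<and> real q * x \<le> real q * b \<and>
      real q * (f x - \<eta>) \<le> real q * y \<and> real q * y \<le> real q * (f x + \<eta>)"
      using *(5,6) by (intro conjI mult_left_mono) simp_all
    then have "p \<in> Z q" "r \<in> Y (q, p)" using *(3,4) by (auto simp: Z_def Y_def simp flip: xy)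
    then show "(x, y) \<in> (\<lambda>((q, p), r). (of_int p / real q, of_int r / real q)) ` (SIGMA z:(SIGMA q:{1..Q}. Z q). Y z)"
      using * xy by (intro image_eqI[of _ _ "((q, p), r)"]) auto
  qed
qed

text \<open>Two points on one vertical line would be at most 1 / (2 Q^2) apart, less than the
  spacing 1 / Q^2. This is why the basic strip has half-width 1 / (4 Q^2): its points can be counted
  by abscissae.\<close>

lemma rat_points_near_fst_inj:
  assumes "(x, y) \<in> rat_points_near f a b Q (1 / (4 * (real Q)\<^sup>2))"
    "(x, y') \<in> rat_points_near f a b Q (1 / (4 * (real Q)\<^sup>2))"
  shows "y = y'"
proof (rule ccontr)
  assume ne: "y \<noteq> y'"
  have "1 / (real Q)\<^sup>2 \<le> \<bar>y - y'\<bar>"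
    using assms ne unfolding rat_points_near_def by (auto intro: rationals_separated)
  moreover have "\<bar>y - y'\<bar> \<le> 2 * (1 / (4 * (real Q)\<^sup>2))"
    using assms unfolding rat_points_near_def by auto
  moreover have "Q > 0" using assms(1) unfolding rat_points_near_def by auto
  then have "2 * (1 / (4 * (real Q)\<^sup>2)) < 1 / (real Q)\<^sup>2" by (simp add: field_simps)
  ultimately show False by linarith
qed

text \<open>The strip is cut into unit pieces horizontally and into translates of the basic strip
  vertically, so \<open>N\<close> must be uniform in both \<open>t\<close> and
  \<open>z\<close>.\<close>

lemma card_rat_points_near_general:
  assumes "a \<le> b" "0 \<le> \<eta>" "0 < Q"
    and N: "\<And>t z. real (card (rat_points_near (\<lambda>x. f x + t) z (z + 1) Q (1 / (4 * (real Q)\<^sup>2)))) \<le> N"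
  shows "real (card (rat_points_near f a b Q \<eta>)) \<le> (b - a + 1) * (4 * \<eta> * (real Q)\<^sup>2 + 1) * N"
proof -
  define e where "e = 1 / (4 * (real Q)\<^sup>2)"
  have e: "e > 0" using assms by (simp add: e_def)
  define I where "I = {i::int. 0 \<le> real_of_int i \<and> of_int i \<le> b - a}"
  define K where "K = {i::int. 0 \<le> real_of_int i \<and> of_int i \<le> \<eta> / e}"
  define X where "X = (\<lambda>(i::int, k::int). rat_points_near (\<lambda>x. f x + (\<eta> - (2 * of_int k + 1) * e)) (a + of_int i) (a + of_int i + 1) Q e)"
  have fin: "finite I" "finite K" unfolding I_def K_def by (rule finite_Ints_between)+
  have "rat_points_near f a b Q \<eta> \<subseteq> (\<Union>z\<in>I \<times> K. X z)"
  proof clarify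
    fix x y assume "(x, y) \<in> rat_points_near f a b Q \<eta>"
    then obtain q :: nat where xy: "0 < q" "q \<le> Q" "real q * x \<in> \<int>" "real q * y \<in> \<int>"
      "a \<le> x" "x \<le> b" "\<bar>f x - y\<bar> \<le> \<eta>" by (auto simp: rat_points_near_def)
    define i where "i = \<lfloor>x - a\<rfloor>"
    \<comment> \<open>Height above the lower boundary in units of a full strip 2 e; its floor
      numbers the strip, whose centre is at (2 k + 1) e above that boundary.\<close>
    define u where "u = (f x - y + \<eta>) / (2 * e)"
    define k where "k = \<lfloor>u\<rfloor>"
    have i: "0 \<le> real_of_int i" "of_int i \<le> x - a" "x - a \<le> of_int i + 1"
      unfolding i_def using xy floor_correct[of "x - a"] by auto
    have "0 \<le> f x - y + \<eta>" "f x - y + \<eta> \<le> 2 * \<eta>" using xy(7) by (auto simp: abs_le_iff)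
    then have "0 \<le> u" "u \<le> 2 * \<eta> / (2 * e)"
      unfolding u_def using e by (intro divide_right_mono divide_nonneg_nonneg; simp)+
    then have u: "0 \<le> u" "u \<le> \<eta> / e" by simp_all
    have k: "0 \<le> real_of_int k" "of_int k \<le> u" "u \<le> of_int k + 1"
      unfolding k_def using u floor_correct[of u] by auto
    have "f x - y + \<eta> = 2 * e * u" using e by (simp add: u_def)
    moreover have "2 * e * of_int k \<le> 2 * e * u" "2 * e * u \<le> 2 * e * (of_int k + 1)"
      using e k by (auto intro: mult_left_mono)
    ultimately have "\<bar>f x + (\<eta> - (2 * of_int k + 1) * e) - y\<bar> \<le> e"
      by (auto simp: abs_le_iff algebra_simps)
    then have "(x, y) \<in> X (i, k)" using xy i by (auto simp: X_def rat_points_near_def)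
    moreover have "i \<in> I" "k \<in> K" using i k u xy by (auto simp: I_def K_def)
    ultimately show "(x, y) \<in> (\<Union>z\<in>I \<times> K. X z)" by blast
  qed
  then have "card (rat_points_near f a b Q \<eta>) \<le> card (\<Union>z\<in>I \<times> K. X z)"
    using fin by (intro card_mono) (auto simp: X_def finite_rat_points_near)
  also have "\<dots> \<le> (\<Sum>z\<in>I \<times> K. card (X z))" using fin by (intro card_UN_le) auto
  finally have "real (card (rat_points_near f a b Q \<eta>)) \<le> (\<Sum>z\<in>I \<times> K. real (card (X z)))"
    by (simp flip: of_nat_sum)
  also have "\<dots> \<le> (\<Sum>z\<in>I \<times> K. N)"
    using N by (intro sum_mono) (auto simp: X_def e_def)
  also have "\<dots> = real (card I) * real (card K) * N" by (simp add: card_cartesian_product)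
  also have "\<dots> \<le> (b - a + 1) * (4 * \<eta> * (real Q)\<^sup>2 + 1) * N"
  proof (intro mult_right_mono mult_mono)
    show "real (card I) \<le> b - a + 1"
      using card_Ints_between_le[of 0 "b - a"] assms by (simp add: I_def)
    have "0 \<le> \<eta> / e" using assms e by simp
    then show "real (card K) \<le> 4 * \<eta> * (real Q)\<^sup>2 + 1"
      using card_Ints_between_le[of 0 "\<eta> / e"] by (simp add: K_def e_def)
    show "0 \<le> N" using N[of 0 0] by (rule order.trans[rotated]) simp
  qed (use assms in auto)
  finally show ?thesis .
qed

text \<open>Multiplied by the three denominators the determinant is an integer. The bound assumed on
  \<open>c1\<close> is what its estimate yields: curvature gives 2 C c1^3, and the distance from the
  curve gives c1.\<close>

lemma near_points_collinear:
  assumes cp: "conj_pair c C f g fs gs" and "0 < c" and Q: "0 < Q"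
    and L: "L = c1 / real Q" "0 < c1" "2 * C * c1 ^ 3 + c1 < 1"
    and P: "\<And>i. i \<in> {1, 2, 3::nat} \<Longrightarrow> (x i, y i) \<in> rat_points_near f a b Q (1 / (4 * (real Q)\<^sup>2))"
    and d: "\<bar>x 2 - x 1\<bar> \<le> L" "\<bar>x 3 - x 1\<bar> \<le> L"
  shows "(x 2 - x 1) * (y 3 - y 1) = (x 3 - x 1) * (y 2 - y 1)"
proof (rule ccontr)
  define \<eta> where "\<eta> = 1 / (4 * (real Q)\<^sup>2)"
  define D where "D = (x 2 - x 1) * (y 3 - y 1) - (x 3 - x 1) * (y 2 - y 1)"
  assume "\<not> ?thesis"
  then have D: "D \<noteq> 0" by (simp add: D_def)
  have L0: "L > 0" using L Q by simp
  have C: "C > 0" using conj_pair_le[OF cp] assms(2) by simp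
  have "\<forall>i\<in>{1, 2, 3}. \<exists>q::nat. 0 < q \<and> q \<le> Q \<and> real q * x i \<in> \<int> \<and> real q * y i \<in> \<int>"
    using P unfolding rat_points_near_def by blast
  then obtain q where q: "\<And>i. i \<in> {1, 2, 3::nat} \<Longrightarrow> 0 < q i \<and> q i \<le> Q \<and> real (q i) * x i \<in> \<int> \<and> real (q i) * y i \<in> \<int>"
    by metis
  define m where "m = (\<lambda>i. real (q i))"
  have X: "m 1 * x 1 \<in> \<int>" "m 2 * x 2 \<in> \<int>" "m 3 * x 3 \<in> \<int>" "m 1 * y 1 \<in> \<int>" "m 2 * y 2 \<in> \<int>" "m 3 * y 3 \<in> \<int>"
     and m: "m 1 \<in> \<int>" "m 2 \<in> \<int>" "m 3 \<in> \<int>"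
    using q[of 1] q[of 2] q[of 3] by (auto simp: m_def)
  have "m 1 * m 2 * m 3 * D =
      m 1 * (m 2 * x 2) * (m 3 * y 3) - m 1 * (m 3 * x 3) * (m 2 * y 2)
      - m 2 * (m 1 * x 1) * (m 3 * y 3) + m 2 * (m 3 * x 3) * (m 1 * y 1)
      + m 3 * (m 1 * x 1) * (m 2 * y 2) - m 3 * (m 2 * x 2) * (m 1 * y 1)"
    unfolding D_def by algebra
  moreover have "u * v * w \<in> \<int>" if "u \<in> \<int>" "v \<in> \<int>" "w \<in> \<int>" for u v w :: real
    by (intro Ints_mult that)
  ultimately have "m 1 * m 2 * m 3 * D \<in> \<int>"
    using X m by (simp only: Ints_add Ints_diff)
  moreover have "m 1 * m 2 * m 3 * D \<noteq> 0" using D q by (auto simp: m_def)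
  ultimately have "1 \<le> \<bar>m 1 * m 2 * m 3 * D\<bar>" by (rule Ints_nonzero_abs_ge1)
  also have "\<dots> = m 1 * m 2 * m 3 * \<bar>D\<bar>" by (simp add: abs_mult m_def)
  also have "\<dots> \<le> real Q * real Q * real Q * \<bar>D\<bar>"
    using q[of 1] q[of 2] q[of 3] unfolding m_def by (intro mult_right_mono mult_mono) auto
  finally have 1: "1 \<le> real Q ^ 3 * \<bar>D\<bar>" by (simp add: power3_eq_cube)
  \<comment> \<open>Deviation from the line of slope g (x 1) through the first point. Subtracting a
    multiple of the abscissae from the ordinates leaves the determinant unchanged and makes the
    second column small.\<close>
  define r where "r = (\<lambda>i. y i - y 1 - g (x 1) * (x i - x 1))"
  have r: "\<bar>r i\<bar> \<le> C * L\<^sup>2 + 2 * \<eta>" if "i \<in> {2, 3}" for i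
  proof -
    have "0 \<le> c * (x i - x 1)\<^sup>2" using assms(2) by simp
    then have "0 \<le> f (x i) - f (x 1) - g (x 1) * (x i - x 1)"
      using conj_pair_lower[OF cp, of "x i" "x 1"] by linarith
    moreover have "(x i - x 1)\<^sup>2 \<le> L\<^sup>2"
      using d that L0 by (intro abs_le_square_iff[THEN iffD1]) auto
    then have "C * (x i - x 1)\<^sup>2 \<le> C * L\<^sup>2" using C by simp
    then have "f (x i) - f (x 1) - g (x 1) * (x i - x 1) \<le> C * L\<^sup>2"
      using conj_pair_upper[OF cp, of "x i" "x 1"] by linarith
    moreover have "\<bar>f (x i) - y i\<bar> \<le> \<eta>" "\<bar>f (x 1) - y 1\<bar> \<le> \<eta>"
      using P[of i] P[of 1] that unfolding rat_points_near_def \<eta>_def by auto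
    ultimately show ?thesis unfolding r_def by linarith
  qed
  have "D = (x 2 - x 1) * r 3 - (x 3 - x 1) * r 2" unfolding D_def r_def by algebra
  then have "\<bar>D\<bar> \<le> \<bar>x 2 - x 1\<bar> * \<bar>r 3\<bar> + \<bar>x 3 - x 1\<bar> * \<bar>r 2\<bar>"
    by (metis abs_mult abs_triangle_ineq4)
  also have "\<dots> \<le> L * (C * L\<^sup>2 + 2 * \<eta>) + L * (C * L\<^sup>2 + 2 * \<eta>)"
    using d r L0 by (intro add_mono mult_mono) auto
  finally have "real Q ^ 3 * \<bar>D\<bar> \<le> real Q ^ 3 * (2 * L * (C * L\<^sup>2 + 2 * \<eta>))"
    by (intro mult_left_mono) auto
  also have "\<dots> = 2 * C * c1 ^ 3 + c1"
    using Q by (simp add: L(1) \<eta>_def field_simps power2_eq_square power3_eq_cube)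
  finally show False using 1 L(3) by simp
qed

section \<open>Rational lines and their heights\<close>

text \<open>For a rational line y = s x - \<tau> this is the coefficient of y in its primitive
  integral equation, that is, the height of the dual point (s, \<tau>).\<close>

definition rat_height :: "real \<times> real \<Rightarrow> nat" where
  "rat_height w = (LEAST B. 0 < B \<and> real B * fst w \<in> \<int> \<and> real B * snd w \<in> \<int>)"

text \<open>The integer q q' (x - x') clears both the slope and the intercept. The bound is read in
  two ways: close points span a line of small height, and on a line of height B points are at least
  B / Q^2 apart.\<close>

lemma rat_height_line:
  assumes P: "(x, y) \<in> rat_points_near f a b Q \<eta>" "(x', y') \<in> rat_points_near f' a' b' Q \<eta>'"
    and ne: "x \<noteq> x'" and on: "y + \<tau> = s * x" "y' + \<tau> = s * x'"
  shows "0 < rat_height (s, \<tau>)" "real (rat_height (s, \<tau>)) * s \<in> \<int>" "real (rat_height (s, \<tau>)) * \<tau> \<in> \<int>"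
    "real (rat_height (s, \<tau>)) \<le> (real Q)\<^sup>2 * \<bar>x - x'\<bar>"
proof -
  obtain q q' :: nat where q: "0 < q" "q \<le> Q" "real q * x \<in> \<int>" "real q * y \<in> \<int>"
    "0 < q'" "q' \<le> Q" "real q' * x' \<in> \<int>" "real q' * y' \<in> \<int>"
    using P unfolding rat_points_near_def by auto
  have "real q * real q' * (x - x') = real q' * (real q * x) - real q * (real q' * x')"
    by (simp add: algebra_simps)
  also have "\<dots> \<in> \<int>" by (intro Ints_diff Ints_mult[OF Ints_of_nat] q)
  finally obtain m where m: "real q * real q' * (x - x') = of_int m" by (auto elim: Ints_cases)
  have "real q * real q' * (x - x') \<noteq> 0" using ne q by simp
  then have m0: "m \<noteq> 0" using m by auto
  define B where "B = nat \<bar>m\<bar>"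
  have B: "real B = \<bar>of_int m\<bar>" "0 < B" using m0 by (auto simp: B_def)
  have "of_int m * s = real q' * (real q * y) - real q * (real q' * y')"
    unfolding m[symmetric] using on by algebra
  also have "\<dots> \<in> \<int>" by (intro Ints_diff Ints_mult[OF Ints_of_nat] q)
  finally have 1: "of_int m * s \<in> \<int>" .
  have "of_int m * \<tau> = (real q * y) * (real q' * x') - (real q' * y') * (real q * x)"
    unfolding m[symmetric] using on by algebra
  also have "\<dots> \<in> \<int>" by (intro Ints_diff Ints_mult q)
  finally have 2: "of_int m * \<tau> \<in> \<int>" .
  have wit: "0 < B \<and> real B * fst (s, \<tau>) \<in> \<int> \<and> real B * snd (s, \<tau>) \<in> \<int>"
    using B 1 2 by (cases "m \<ge> 0") auto
  have "0 < rat_height (s, \<tau>) \<and> real (rat_height (s, \<tau>)) * fst (s, \<tau>) \<in> \<int> \<and> real (rat_height (s, \<tau>)) * snd (s, \<tau>) \<in> \<int>"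
    unfolding rat_height_def by (rule LeastI[where P = "\<lambda>B. 0 < B \<and> real B * fst (s, \<tau>) \<in> \<int> \<and> real B * snd (s, \<tau>) \<in> \<int>", OF wit])
  then show "0 < rat_height (s, \<tau>)" "real (rat_height (s, \<tau>)) * s \<in> \<int>" "real (rat_height (s, \<tau>)) * \<tau> \<in> \<int>"
    by auto
  have "rat_height (s, \<tau>) \<le> B"
    unfolding rat_height_def by (rule Least_le[where P = "\<lambda>B. 0 < B \<and> real B * fst (s, \<tau>) \<in> \<int> \<and> real B * snd (s, \<tau>) \<in> \<int>", OF wit])
  then have "real (rat_height (s, \<tau>)) \<le> \<bar>of_int m\<bar>" using B by linarith
  also have "\<dots> = real q * real q' * \<bar>x - x'\<bar>" by (simp add: abs_mult flip: m)
  also have "\<dots> \<le> real Q * real Q * \<bar>x - x'\<bar>" using q by (intro mult_right_mono mult_mono) auto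
  finally show "real (rat_height (s, \<tau>)) \<le> (real Q)\<^sup>2 * \<bar>x - x'\<bar>" by (simp add: power2_eq_square)
qed

text \<open>Curve minus line changes by at most 2 \<eta> between the points. That change is a
  convexity term plus (g x - s) (x' - x); with both points on one side of \<open>gs s\<close>, x the
  nearer, both terms are nonnegative, so each is small.\<close>

lemma near_points_on_line_spread:
  assumes cp: "conj_pair c C f g fs gs" and "0 < c"
    and near: "\<bar>f x - y\<bar> \<le> \<eta>" "\<bar>f x' - y'\<bar> \<le> \<eta>"
    and on: "y + \<tau> = s * x" "y' + \<tau> = s * x'"
    and side: "gs s \<le> x \<and> x \<le> x' \<or> x' \<le> x \<and> x \<le> gs s"
  shows "c * (x' - x)\<^sup>2 \<le> 2 * \<eta>" "c * \<bar>x - gs s\<bar> * \<bar>x' - x\<bar> \<le> \<eta>"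
proof -
  define x0 where "x0 = gs s"
  have s: "g x0 = s" using cp unfolding conj_pair_def x0_def by blast
  have "f x' - f x - s * (x' - x) \<le> 2 * \<eta>"
    using near on by (simp add: algebra_simps)
  then have D: "(f x' - f x - g x * (x' - x)) + (g x - g x0) * (x' - x) \<le> 2 * \<eta>"
    by (simp add: s algebra_simps)
  have mon: "2 * c * \<bar>x - x0\<bar> * \<bar>x' - x\<bar> \<le> (g x - g x0) * (x' - x)"
    using side
  proof
    assume h: "gs s \<le> x \<and> x \<le> x'"
    then have "2 * c * (x - x0) * (x' - x) \<le> (g x - g x0) * (x' - x)"
      using conj_pair_deriv_diff(1)[OF cp, of x0 x] by (intro mult_right_mono) (auto simp: x0_def)
    then show ?thesis using h by (simp add: x0_def)
  next
    assume h: "x' \<le> x \<and> x \<le> gs s"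
    then have "2 * c * (x0 - x) * (x - x') \<le> (g x0 - g x) * (x - x')"
      using conj_pair_deriv_diff(1)[OF cp, of x x0] by (intro mult_right_mono) (auto simp: x0_def)
    then show ?thesis using h by (simp add: x0_def algebra_simps)
  qed
  have p: "0 \<le> c * (x' - x)\<^sup>2" "0 \<le> c * \<bar>x - x0\<bar> * \<bar>x' - x\<bar>" using assms(2) by simp_all
  show "c * (x' - x)\<^sup>2 \<le> 2 * \<eta>" "c * \<bar>x - gs s\<bar> * \<bar>x' - x\<bar> \<le> \<eta>"
    using D mon p conj_pair_lower[OF cp, of x' x] by (simp_all add: x0_def[symmetric])
qed

text \<open>On each side of the point of slope s the points spread over at most 1 / (Q sqrt (2 c))
  and are B / Q^2 apart. The additive constants are absorbed using B <= Q.\<close>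

lemma card_line_points_le:
  assumes cp: "conj_pair c C f g fs gs" and c: "0 < c" and Q: "0 < Q"
    and X: "X = {P \<in> rat_points_near f a b Q (1 / (4 * (real Q)\<^sup>2)). snd P + \<tau> = s * fst P}"
    and h: "0 < rat_height (s, \<tau>)" "rat_height (s, \<tau>) \<le> Q"
  shows "real (card X) \<le> (2 + 2 / sqrt (2 * c)) * real Q / real (rat_height (s, \<tau>))"
proof -
  define B where "B = real (rat_height (s, \<tau>))"
  define \<eta> where "\<eta> = 1 / (4 * (real Q)\<^sup>2)"
  have B: "0 < B" "B \<le> real Q" using h by (auto simp: B_def)
  have finX: "finite X" unfolding X using finite_rat_points_near by simp
  have inj: "inj_on fst X"
    unfolding X by (auto intro!: inj_onI intro: rat_points_near_fst_inj)
  \<comment> \<open>The second condition says that \<open>Y\<close> lies entirely on one side of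
    \<open>gs s\<close>.\<close>
  have side: "real (card Y) \<le> 1 + real Q / (B * sqrt (2 * c))"
    if Y: "Y \<subseteq> X" "\<And>P. P \<in> Y \<Longrightarrow> gs s \<le> fst P \<or> (\<forall>P\<in>Y. fst P \<le> gs s)" for Y
  proof -
    have "real (card (fst ` Y)) \<le> (1 / (real Q * sqrt (2 * c))) / (B / (real Q)\<^sup>2) + 1"
    proof (rule card_separated_le)
      show "finite (fst ` Y)" using finX Y finite_subset by blast
      fix x x' assume "x \<in> fst ` Y" "x' \<in> fst ` Y"
      then obtain y y' where P: "(x, y) \<in> Y" "(x', y') \<in> Y" by auto
      then have PX: "(x, y) \<in> rat_points_near f a b Q \<eta>" "(x', y') \<in> rat_points_near f a b Q \<eta>"
          "y + \<tau> = s * x" "y' + \<tau> = s * x'" using Y(1) unfolding X \<eta>_def by auto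
      { assume "x \<noteq> x'"
        from rat_height_line(4)[OF PX(1,2) this PX(3,4)] Q
        show "B / (real Q)\<^sup>2 \<le> \<bar>x - x'\<bar>" by (simp add: B_def field_simps) }
      have n: "\<bar>f x - y\<bar> \<le> \<eta>" "\<bar>f x' - y'\<bar> \<le> \<eta>" using PX by (auto simp: rat_points_near_def)
      have "(gs s \<le> x \<and> gs s \<le> x') \<or> (x \<le> gs s \<and> x' \<le> gs s)"
        using Y(2)[OF P(1)] Y(2)[OF P(2)] P by auto
      then have "c * (x' - x)\<^sup>2 \<le> 2 * \<eta>"
        using near_points_on_line_spread(1)[OF cp c n PX(3,4)]
          near_points_on_line_spread(1)[OF cp c n(2,1) PX(4,3)]
        by (cases "x \<le> x'") (auto simp: power2_commute[of x])
      then have "\<bar>x - x'\<bar>\<^sup>2 \<le> (1 / (real Q * sqrt (2 * c)))\<^sup>2"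
        using c Q by (simp add: power_mult_distrib power_divide \<eta>_def field_simps power2_commute[of x])
      then show "\<bar>x - x'\<bar> \<le> 1 / (real Q * sqrt (2 * c))"
        by (rule power2_le_imp_le) (use c in auto)
    qed (use B Q c in auto)
    also have "card (fst ` Y) = card Y" using inj Y(1) by (intro card_image) (rule inj_on_subset)
    also have "(1 / (real Q * sqrt (2 * c))) / (B / (real Q)\<^sup>2) + 1 = 1 + real Q / (B * sqrt (2 * c))"
      using Q B c by (simp add: field_simps power2_eq_square)
    finally show ?thesis .
  qed
  define Y1 where "Y1 = {P \<in> X. gs s \<le> fst P}"
  define Y2 where "Y2 = {P \<in> X. fst P < gs s}"
  have "X = Y1 \<union> Y2" by (auto simp: Y1_def Y2_def)
  then have "card X \<le> card Y1 + card Y2" by (simp add: card_Un_le)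
  moreover have "real (card Y1) \<le> 1 + real Q / (B * sqrt (2 * c))"
    by (rule side) (auto simp: Y1_def)
  moreover have "real (card Y2) \<le> 1 + real Q / (B * sqrt (2 * c))"
    by (rule side) (auto simp: Y2_def)
  ultimately have "real (card X) \<le> 2 * 1 + 2 * (real Q / (B * sqrt (2 * c)))" by linarith
  also have "\<dots> \<le> 2 * (real Q / B) + 2 * (real Q / (B * sqrt (2 * c)))"
    using B by (intro add_mono mult_left_mono) auto
  also have "\<dots> = (2 + 2 / sqrt (2 * c)) * real Q / B" by (simp add: algebra_simps add_divide_distrib)
  finally show ?thesis by (simp add: B_def)
qed

text \<open>Of three points on a line, two lie on the same side of the point \<open>gs s\<close> where the curve
  has slope \<open>s\<close>; they force the line to be almost tangent to the curve.\<close>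

lemma line_through_near_points_is_near_dual:
  assumes cp: "conj_pair c C f g fs gs" and c: "0 < c" and Q: "0 < Q"
    and P: "\<And>i. i \<in> {1, 2, 3::nat} \<Longrightarrow> (x i, y i) \<in> rat_points_near f z (z + 1) Q (1 / (4 * (real Q)\<^sup>2))"
    and on: "\<And>i. i \<in> {1, 2, 3} \<Longrightarrow> y i + \<tau> = s * x i"
    and ne: "x 1 \<noteq> x 2" "x 1 \<noteq> x 3" "x 2 \<noteq> x 3"
    and B: "B = rat_height (s, \<tau>)" "B \<le> Q"
  shows "\<bar>s - g z\<bar> \<le> C / (2 * c) + 2 * C" "\<bar>fs s - \<tau>\<bar> \<le> (1 / 4 + C / (16 * c\<^sup>2)) / (real B)\<^sup>2"
proof -
  define \<eta> where "\<eta> = 1 / (4 * (real Q)\<^sup>2)"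
  define x0 where "x0 = gs s"
  have s: "g x0 = s" and fsx0: "f x0 + fs s = s * x0"
    using cp unfolding conj_pair_def x0_def by (metis, metis mult.commute)
  have C: "C > 0" using conj_pair_le[OF cp] c by simp
  \<comment> \<open>Pigeonhole on the two sides of \<open>x0\<close>, with i naming the nearer of
    the two points found.\<close>
  have "\<exists>i\<in>{1, 2, 3}. \<exists>j\<in>{1, 2, 3}. x i \<noteq> x j \<and> (x0 \<le> x i \<and> x i \<le> x j \<or> x j \<le> x i \<and> x i \<le> x0)"
    using ne by (simp, smt (verit))
  then obtain i j where ij: "i \<in> {1, 2, 3}" "j \<in> {1, 2, 3}" "x i \<noteq> x j"
      "gs s \<le> x i \<and> x i \<le> x j \<or> x j \<le> x i \<and> x i \<le> gs s"
    unfolding x0_def by blast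
  have n: "\<bar>f (x i) - y i\<bar> \<le> \<eta>" "\<bar>f (x j) - y j\<bar> \<le> \<eta>" "z \<le> x i" "x i \<le> z + 1"
    using P[OF ij(1)] P[OF ij(2)] by (auto simp: rat_points_near_def \<eta>_def)
  note h = rat_height_line[OF P[OF ij(1)] P[OF ij(2)] ij(3) on[OF ij(1)] on[OF ij(2)], folded B(1)]
  have B0: "real B > 0" using h(1) by simp
  have "c * \<bar>x i - x0\<bar> * \<bar>x j - x i\<bar> \<le> \<eta>"
    unfolding x0_def by (rule near_points_on_line_spread(2)[OF cp c n(1,2) on[OF ij(1)] on[OF ij(2)] ij(4)])
  \<comment> \<open>The spacing B / Q^2 cancels the 1 / Q^2 of the strip: the distance to the
    tangency point is O(1 / B) and no longer involves Q.\<close>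
  moreover have "c * \<bar>x i - x0\<bar> * (real B / (real Q)\<^sup>2) \<le> c * \<bar>x i - x0\<bar> * \<bar>x j - x i\<bar>"
    using h(4) Q c by (intro mult_left_mono) (auto simp: field_simps abs_minus_commute)
  ultimately have "c * \<bar>x i - x0\<bar> * (real B / (real Q)\<^sup>2) \<le> 1 / (4 * (real Q)\<^sup>2)"
    by (simp add: \<eta>_def)
  then have "c * \<bar>x i - x0\<bar> * real B \<le> 1 / 4" using Q by (simp add: field_simps)
  then have dx: "\<bar>x i - x0\<bar> \<le> 1 / (4 * c * real B)" using c B0 by (simp add: field_simps)
  also have "\<dots> \<le> 1 / (4 * c)" using c h(1) by (simp add: field_simps)
  finally have dx': "\<bar>x i - x0\<bar> \<le> 1 / (4 * c)" .
  have "\<bar>g x0 - g (x i)\<bar> \<le> 2 * C * \<bar>x i - x0\<bar>"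
    using conj_pair_deriv_Lipschitz[OF cp c, of x0 "x i"] by (simp add: abs_minus_commute)
  also have "\<dots> \<le> 2 * C * (1 / (4 * c))" using dx' C by (intro mult_left_mono) auto
  finally have 1: "\<bar>g x0 - g (x i)\<bar> \<le> C / (2 * c)" by simp
  have "\<bar>g (x i) - g z\<bar> \<le> 2 * C * \<bar>x i - z\<bar>" by (rule conj_pair_deriv_Lipschitz[OF cp c])
  also have "\<dots> \<le> 2 * C * 1" using n C by (intro mult_left_mono) auto
  finally show "\<bar>s - g z\<bar> \<le> C / (2 * c) + 2 * C" using 1 s by linarith
  define D where "D = f (x i) - f x0 - g x0 * (x i - x0)"
  \<comment> \<open>The gap to the dual curve is a second-order deviation from the tangent at
    \<open>x0\<close>, of size O(1 / B^2), up to the error \<eta> <= 1 / (4 B^2).\<close>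
  have "fs s - \<tau> = D - (f (x i) - y i)"
    using fsx0 on[OF ij(1)] s by (simp add: D_def algebra_simps)
  moreover have "0 \<le> c * (x i - x0)\<^sup>2" using c by simp
  then have "0 \<le> D" unfolding D_def using conj_pair_lower[OF cp, of "x i" x0] by linarith
  moreover have "D \<le> C * (x i - x0)\<^sup>2" unfolding D_def by (rule conj_pair_upper[OF cp])
  ultimately have "\<bar>fs s - \<tau>\<bar> \<le> \<eta> + C * \<bar>x i - x0\<bar>\<^sup>2" using n(1) unfolding power2_abs by linarith
  also have "\<dots> \<le> 1 / (4 * (real B)\<^sup>2) + C * (1 / (4 * c * real B))\<^sup>2"
    unfolding \<eta>_def using B0 B(2) C dx Q
    by (intro add_mono mult_left_mono power_mono divide_left_mono) auto
  also have "\<dots> = (1 / 4 + C / (16 * c\<^sup>2)) / (real B)\<^sup>2"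
    using B0 c by (simp add: field_simps power2_eq_square)
  finally show "\<bar>fs s - \<tau>\<bar> \<le> (1 / 4 + C / (16 * c\<^sup>2)) / (real B)\<^sup>2" .
qed

section \<open>Induction between a curve and its dual\<close>

text \<open>The sum is comparable to its last term, at the price of a constant that blows up as
  \<epsilon> tends to 0.\<close>

lemma sum_dyadic_le:
  assumes "\<epsilon> > 0" "2 ^ J \<le> (Y::real)"
  shows "(\<Sum>j\<le>J. (2 ^ j :: real) powr \<epsilon>) \<le> Y powr \<epsilon> / (1 - 2 powr - \<epsilon>)"
proof -
  define x where "x = (2::real) powr \<epsilon>"
  have x: "x > 1" using assms by (simp add: x_def)
  have p: "(2 ^ j :: real) powr \<epsilon> = x ^ j" for j
    by (simp add: x_def powr_powr powr_realpow[symmetric] mult.commute)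
  have "(\<Sum>j\<le>J. (2 ^ j :: real) powr \<epsilon>) = (x ^ Suc J - 1) / (x - 1)"
    unfolding p using x geometric_sum[of x "Suc J"] by (simp add: lessThan_Suc_atMost)
  also have "\<dots> \<le> x ^ Suc J / (x - 1)" using x by (intro divide_right_mono) auto
  also have "\<dots> = x ^ J / (1 - 2 powr - \<epsilon>)"
    using x by (simp add: powr_minus x_def[symmetric] field_simps)
  also have "\<dots> \<le> Y powr \<epsilon> / (1 - 2 powr - \<epsilon>)"
  proof (intro divide_right_mono)
    have "x ^ J = (2 ^ J) powr \<epsilon>" by (rule p[symmetric])
    also have "\<dots> \<le> Y powr \<epsilon>" using assms by (intro powr_mono2) auto
    finally show "x ^ J \<le> Y powr \<epsilon>" .
    show "0 \<le> 1 - 2 powr - \<epsilon>" using x by (simp add: powr_minus x_def[symmetric] field_simps)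
  qed
  finally show ?thesis .
qed

lemma sum_UN_le:
  fixes f :: "'a \<Rightarrow> real"
  assumes "finite J" "\<And>j. finite (B j)" "\<And>x. 0 \<le> f x"
  shows "sum f (\<Union>j\<in>J. B j) \<le> (\<Sum>j\<in>J. sum f (B j))"
  using assms(1)
proof (induction J)
  case (insert j J)
  have "sum f (B j \<union> (\<Union>j\<in>J. B j)) + sum f (B j \<inter> (\<Union>j\<in>J. B j)) = sum f (B j) + sum f (\<Union>j\<in>J. B j)"
    using insert assms(2) by (intro sum.union_inter) auto
  moreover have "0 \<le> sum f (B j \<inter> (\<Union>j\<in>J. B j))" using assms(3) by (intro sum_nonneg)
  ultimately have "sum f (B j \<union> (\<Union>j\<in>J. B j)) \<le> sum f (B j) + sum f (\<Union>j\<in>J. B j)" by linarith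
  then show ?case using insert by simp
qed simp

text \<open>One step of the induction on \<open>Q\<close>.  Cut \<open>{z..z + 1}\<close> into arcs of length \<open>c1 / Q\<close>.  An arc with three
  or more points carries a rational line of height \<open>B \<le> c1 Q\<close>, which is a rational point near the dual
  curve and holds \<open>O(Q / B)\<close> points.  Lines are counted by the bound for the dual curve.\<close>

lemma card_rat_points_near_step:
  assumes cp: "conj_pair c C f g fs gs" and c: "0 < c" and \<epsilon>: "0 < \<epsilon>" and Q: "0 < Q" and K: "0 \<le> K"
    and c1: "0 < c1" "c1 \<le> 1 / 4" "2 * C * c1 ^ 3 + c1 < 1"
    and IH: "\<And>t w R. 0 < R \<Longrightarrow> R < Q \<Longrightarrow>
      real (card (rat_points_near (\<lambda>x. fs x + t) w (w + 1) R (1 / (4 * (real R)\<^sup>2)))) \<le> K * real R powr (1 + \<epsilon>)"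
    and A: "A = (2 * (C / (2 * c) + 2 * C) + 1) * (16 * (1 / 4 + C / (16 * c\<^sup>2)) + 1) * (2 + 2 / sqrt (2 * c)) * 2 powr (1 + \<epsilon>)"
  shows "real (card (rat_points_near f z (z + 1) Q (1 / (4 * (real Q)\<^sup>2)))) \<le>
     4 / c1 * real Q + A * K * real Q * ((c1 * real Q) powr \<epsilon> / (1 - 2 powr - \<epsilon>))"
proof -
  define X where "X = rat_points_near f z (z + 1) Q (1 / (4 * (real Q)\<^sup>2))"
  define L where "L = c1 / real Q"
  define R where "R = C / (2 * c) + 2 * C"
  define C3 where "C3 = 1 / 4 + C / (16 * c\<^sup>2)"
  define C4 where "C4 = 2 + 2 / sqrt (2 * c)"
  define arc where "arc = (\<lambda>i::int. {P \<in> X. \<lfloor>(fst P - z) / L\<rfloor> = i})"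
  define I where "I = {i::int. 0 \<le> real_of_int i \<and> of_int i \<le> 1 / L}"
  define on where "on = (\<lambda>w::real \<times> real. {P \<in> X. snd P + snd w = fst w * fst P})"
  \<comment> \<open>Lines that contain a whole arc with three or more points; arcs with at most two
    points are counted trivially.\<close>
  define W where "W = {w. \<exists>i\<in>I. 3 \<le> card (arc i) \<and> arc i \<subseteq> on w}"
  have C: "C > 0" using conj_pair_le[OF cp] c by simp
  have L: "L > 0" using c1 Q by (simp add: L_def)
  have pos: "R > 0" "C3 > 0" "C4 > 0" using C c by (auto simp: R_def C3_def C4_def intro: add_pos_pos)
  have finX: "finite X" by (simp add: X_def finite_rat_points_near)
  have fin: "finite (arc i)" "finite (on w)" for i w using finX by (auto simp: arc_def on_def)
  have finI: "finite I" unfolding I_def by (rule finite_Ints_between)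
  have inj: "inj_on fst X"
    unfolding X_def by (auto intro!: inj_onI intro: rat_points_near_fst_inj)
  have arc_dist: "\<bar>fst P - fst P'\<bar> \<le> L" if "P \<in> arc i" "P' \<in> arc i" for P P' i
  proof -
    have "\<bar>(fst P - z) / L - (fst P' - z) / L\<bar> < 1" using that unfolding arc_def by (simp, linarith)
    also have "(fst P - z) / L - (fst P' - z) / L = (fst P - fst P') / L" by (simp add: diff_divide_distrib)
    finally show ?thesis using L by (simp add: abs_divide)
  qed
  have XI: "X \<subseteq> (\<Union>i\<in>I. arc i)"
  proof
    fix P assume P: "P \<in> X"
    then have "0 \<le> (fst P - z) / L" "(fst P - z) / L \<le> 1 / L"
      using L by (auto simp: X_def rat_points_near_def intro!: divide_right_mono)
    then have "\<lfloor>(fst P - z) / L\<rfloor> \<in> I" by (auto simp: I_def intro: order.trans[OF of_int_floor_le])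
    then show "P \<in> (\<Union>i\<in>I. arc i)" using P by (auto simp: arc_def)
  qed
  have line: "\<exists>w. arc i \<subseteq> on w" if i: "3 \<le> card (arc i)" for i
  proof -
    obtain P1 P2 where P: "P1 \<in> arc i" "P2 \<in> arc i" "P1 \<noteq> P2"
      using i fin(1)[of i] by (metis card_le_Suc0_iff_eq not_less_eq_eq numeral_3_eq_3 Suc_leD)
    then have ne: "fst P1 \<noteq> fst P2" using inj by (auto simp: arc_def inj_on_def)
    define s where "s = (snd P2 - snd P1) / (fst P2 - fst P1)"
    have "arc i \<subseteq> on (s, s * fst P1 - snd P1)"
    proof
      fix P assume PA: "P \<in> arc i"
      define x where "x = (\<lambda>k::nat. if k = 1 then fst P1 else if k = 2 then fst P2 else fst P)"
      define y where "y = (\<lambda>k::nat. if k = 1 then snd P1 else if k = 2 then snd P2 else snd P)"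
      have "(x 2 - x 1) * (y 3 - y 1) = (x 3 - x 1) * (y 2 - y 1)"
      proof (rule near_points_collinear[OF cp c Q L_def c1(1,3)])
        show "(x k, y k) \<in> rat_points_near f z (z + 1) Q (1 / (4 * (real Q)\<^sup>2))" for k
          using P PA by (auto simp: x_def y_def arc_def X_def)
        show "\<bar>x 2 - x 1\<bar> \<le> L" "\<bar>x 3 - x 1\<bar> \<le> L"
          using arc_dist P PA by (auto simp: x_def)
      qed
      then have "(fst P2 - fst P1) * (snd P - snd P1) = (fst P - fst P1) * (snd P2 - snd P1)"
        by (simp add: x_def y_def)
      then have "snd P - snd P1 = s * (fst P - fst P1)"
        using ne by (simp add: s_def field_simps)
      then have "snd P + (s * fst P1 - snd P1) = s * fst P" by (simp add: algebra_simps)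
      then show "P \<in> on (s, s * fst P1 - snd P1)" using PA by (simp add: on_def arc_def)
    qed
    then show ?thesis by blast
  qed
  have Wprop: "0 < rat_height w \<and> real (rat_height w) \<le> c1 * real Q \<and>
      real (rat_height w) * fst w \<in> \<int> \<and> real (rat_height w) * snd w \<in> \<int> \<and>
      \<bar>fst w - g z\<bar> \<le> R \<and> \<bar>fs (fst w) - snd w\<bar> \<le> C3 / (real (rat_height w))\<^sup>2 \<and>
      real (card (on w)) \<le> C4 * real Q / real (rat_height w)" if "w \<in> W" for w
  proof -
    obtain s \<tau> where w: "w = (s, \<tau>)" by (cases w)
    from that obtain i where i: "3 \<le> card (arc i)" "arc i \<subseteq> on w" by (auto simp: W_def)
    then obtain T where "T \<subseteq> arc i" "card T = 3" by (meson obtain_subset_with_card_n)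
    then obtain P1 P2 P3 where P: "P1 \<in> arc i" "P2 \<in> arc i" "P3 \<in> arc i" "P1 \<noteq> P2" "P1 \<noteq> P3" "P2 \<noteq> P3"
      by (auto simp: card_3_iff)
    have ne: "fst P1 \<noteq> fst P2" "fst P1 \<noteq> fst P3" "fst P2 \<noteq> fst P3"
      using P inj by (auto simp: arc_def inj_on_def)
    have mem: "(fst P, snd P) \<in> rat_points_near f z (z + 1) Q (1 / (4 * (real Q)\<^sup>2)) \<and> snd P + \<tau> = s * fst P"
      if "P \<in> arc i" for P
      using that i(2) by (auto simp: on_def X_def w)
    note h = rat_height_line[OF conjunct1[OF mem[OF P(1)]] conjunct1[OF mem[OF P(2)]] ne(1)
        conjunct2[OF mem[OF P(1)]] conjunct2[OF mem[OF P(2)]]]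
    have "real (rat_height w) \<le> (real Q)\<^sup>2 * L"
      using h(4) arc_dist[OF P(1,2)] unfolding w by (meson mult_left_mono order.trans zero_le_power2)
    then have hc: "real (rat_height w) \<le> c1 * real Q"
      using Q by (simp add: L_def power2_eq_square mult.commute)
    also have "\<dots> \<le> real Q" using c1 Q by simp
    finally have hQ: "rat_height w \<le> Q" by simp
    define x where "x = (\<lambda>k::nat. if k = 1 then fst P1 else if k = 2 then fst P2 else fst P3)"
    define y where "y = (\<lambda>k::nat. if k = 1 then snd P1 else if k = 2 then snd P2 else snd P3)"
    have 1: "(x k, y k) \<in> rat_points_near f z (z + 1) Q (1 / (4 * (real Q)\<^sup>2))" "y k + \<tau> = s * x k" for k
      using mem P by (auto simp: x_def y_def)
    have 2: "x 1 \<noteq> x 2" "x 1 \<noteq> x 3" "x 2 \<noteq> x 3" using ne by (auto simp: x_def)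
    have on_eq: "on w = {P \<in> rat_points_near f z (z + 1) Q (1 / (4 * (real Q)\<^sup>2)). snd P + \<tau> = s * fst P}"
      by (simp add: on_def X_def w)
    show ?thesis
      using line_through_near_points_is_near_dual[OF cp c Q 1 2 refl hQ[unfolded w]]
        card_line_points_le[OF cp c Q on_eq h(1) hQ[unfolded w]] h hc
      unfolding w R_def C3_def C4_def fst_conv snd_conv by blast
  qed
  define J where "J = {j::nat. 2 ^ j \<le> c1 * real Q}"
  \<comment> \<open>Within a dyadic range of heights the error C3 / B^2 is at most 16 C3 basic
    half-widths at denominator bound 2^(j+1), so boundedly many translates of the dual strip
    suffice.\<close>
  define Wj where "Wj = (\<lambda>j. {w \<in> W. 2 ^ j \<le> rat_height w \<and> rat_height w < 2 ^ Suc j})"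
  have Wj_sub: "Wj j \<subseteq> rat_points_near fs (g z - R) (g z + R) (2 ^ Suc j) (4 * C3 / (2 ^ Suc j)\<^sup>2)" for j
  proof
    fix w assume w: "w \<in> Wj j"
    note p = Wprop[of w]
    have "C3 / (real (rat_height w))\<^sup>2 \<le> C3 / (2 ^ j)\<^sup>2"
    proof (intro divide_left_mono power_mono)
      show "2 ^ j \<le> real (rat_height w)" using w by (auto simp: Wj_def)
      have "0 < rat_height w" using p w by (auto simp: Wj_def)
      then show "0 < (real (rat_height w))\<^sup>2 * (2 ^ j)\<^sup>2" by simp
    qed (use pos in auto)
    also have "\<dots> = 4 * C3 / (2 ^ Suc j)\<^sup>2" by (simp add: field_simps power2_eq_square)
    finally show "w \<in> rat_points_near fs (g z - R) (g z + R) (2 ^ Suc j) (4 * C3 / (2 ^ Suc j)\<^sup>2)"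
      using p w by (auto simp: Wj_def rat_points_near_def case_prod_beta abs_le_iff intro!: exI[of _ "rat_height w"])
  qed
  then have finWj: "finite (Wj j)" for j using finite_rat_points_near finite_subset by blast
  have cardWj: "real (card (Wj j)) \<le> (2 * R + 1) * (16 * C3 + 1) * (K * (2 ^ Suc j) powr (1 + \<epsilon>))" if j: "j \<in> J" for j
  proof -
    \<comment> \<open>Here c1 <= 1/4 is used: even the upper end of the dyadic range stays below Q,
      so the induction hypothesis applies.\<close>
    have "(2::real) ^ Suc j \<le> 2 * (c1 * real Q)" using j by (simp add: J_def)
    also have "\<dots> < real Q" using c1 Q by simp
    finally have lt: "2 ^ Suc j < Q" by (metis of_nat_less_iff of_nat_numeral of_nat_power)
    have "real (card (Wj j)) \<le> real (card (rat_points_near fs (g z - R) (g z + R) (2 ^ Suc j) (4 * C3 / (2 ^ Suc j)\<^sup>2)))"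
      using Wj_sub by (simp add: card_mono finite_rat_points_near)
    also have "\<dots> \<le> ((g z + R) - (g z - R) + 1) * (4 * (4 * C3 / (2 ^ Suc j)\<^sup>2) * (real (2 ^ Suc j))\<^sup>2 + 1) * (K * (2 ^ Suc j) powr (1 + \<epsilon>))"
      using pos IH[OF _ lt] by (intro card_rat_points_near_general) auto
    also have "\<dots> = (2 * R + 1) * (16 * C3 + 1) * (K * (2 ^ Suc j) powr (1 + \<epsilon>))" by simp
    finally show ?thesis .
  qed
  have W_sub: "W \<subseteq> (\<Union>j\<in>J. Wj j)"
  proof
    fix w assume w: "w \<in> W"
    note p = Wprop[OF w]
    obtain j where j: "2 ^ j \<le> rat_height w" "rat_height w < 2 ^ Suc j"
      using ex_power_ivl1[of 2 "rat_height w"] p by auto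
    have "2 ^ j \<le> real (rat_height w)" using j(1) by (metis of_nat_le_iff of_nat_numeral of_nat_power)
    also have "\<dots> \<le> c1 * real Q" using p by blast
    finally have "j \<in> J" by (simp add: J_def)
    then show "w \<in> (\<Union>j\<in>J. Wj j)" using w j by (auto simp: Wj_def)
  qed
  have finJ: "finite J"
  proof (rule finite_subset)
    show "J \<subseteq> {..Q}"
    proof
      fix j assume "j \<in> J"
      then have "2 ^ j \<le> c1 * real Q" by (simp add: J_def)
      also have "\<dots> \<le> real Q" using c1 Q by simp
      finally have "2 ^ j \<le> Q" by (metis of_nat_le_iff of_nat_numeral of_nat_power)
      then show "j \<in> {..Q}" by (auto intro: less_imp_le less_le_trans[OF less_exp])
    qed
  qed auto
  have finW: "finite W" using W_sub finJ finWj finite_subset by blast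
  have "X \<subseteq> (\<Union>i\<in>{i \<in> I. card (arc i) \<le> 2}. arc i) \<union> (\<Union>w\<in>W. on w)"
  proof
    fix P assume "P \<in> X"
    then obtain i where i: "i \<in> I" "P \<in> arc i" using XI by blast
    show "P \<in> (\<Union>i\<in>{i \<in> I. card (arc i) \<le> 2}. arc i) \<union> (\<Union>w\<in>W. on w)"
    proof (cases "card (arc i) \<le> 2")
      case False
      then have 3: "3 \<le> card (arc i)" by simp
      then obtain w where "arc i \<subseteq> on w" using line[of i] by blast
      moreover from this have "w \<in> W" using 3 i unfolding W_def by blast
      ultimately show ?thesis using i by blast
    qed (use i in auto)
  qed
  then have "card X \<le> card ((\<Union>i\<in>{i \<in> I. card (arc i) \<le> 2}. arc i) \<union> (\<Union>w\<in>W. on w))"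
    using finI finW fin by (intro card_mono) auto
  also have "\<dots> \<le> card (\<Union>i\<in>{i \<in> I. card (arc i) \<le> 2}. arc i) + card (\<Union>w\<in>W. on w)" by (rule card_Un_le)
  also have "\<dots> \<le> (\<Sum>i\<in>{i \<in> I. card (arc i) \<le> 2}. card (arc i)) + (\<Sum>w\<in>W. card (on w))"
    using finI finW by (intro add_mono card_UN_le) auto
  also have "(\<Sum>i\<in>{i \<in> I. card (arc i) \<le> 2}. card (arc i)) \<le> (\<Sum>i\<in>{i \<in> I. card (arc i) \<le> 2}. 2)"
    by (intro sum_mono) auto
  also have "\<dots> \<le> 2 * card I" using finI by (simp add: card_mono)
  finally have "card X \<le> 2 * card I + (\<Sum>w\<in>W. card (on w))" by simp
  then have "real (card X) \<le> real (2 * card I + (\<Sum>w\<in>W. card (on w)))" by (simp only: of_nat_le_iff)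
  then have main: "real (card X) \<le> 2 * real (card I) + (\<Sum>w\<in>W. real (card (on w)))" by simp
  have "real (card I) \<le> 1 / L + 1" using card_Ints_between_le[of 0 "1 / L"] L by (simp add: I_def)
  also have "1 \<le> 1 / L" using c1 Q L by (simp add: L_def field_simps)
  then have "1 / L + 1 \<le> 2 / c1 * real Q" by (simp add: L_def)
  finally have cardI: "real (card I) \<le> 2 / c1 * real Q" .
  have "(\<Sum>w\<in>W. real (card (on w))) \<le> (\<Sum>w\<in>(\<Union>j\<in>J. Wj j). real (card (on w)))"
    using W_sub finJ finWj by (intro sum_mono2) auto
  also have "\<dots> \<le> (\<Sum>j\<in>J. \<Sum>w\<in>Wj j. real (card (on w)))"
    using finJ finWj by (intro sum_UN_le) auto
  also have "\<dots> \<le> (\<Sum>j\<in>J. A * K * real Q * (2 ^ j) powr \<epsilon>)"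
  proof (rule sum_mono)
    fix j assume j: "j \<in> J"
    \<comment> \<open>There are O(2^(j (1+\<epsilon>))) lines of height about 2^j with O(Q / 2^j)
      points each; in the product only 2^(j \<epsilon>) survives beside Q.\<close>
    have "(\<Sum>w\<in>Wj j. real (card (on w))) \<le> (\<Sum>w\<in>Wj j. C4 * real Q / 2 ^ j)"
    proof (rule sum_mono)
      fix w assume w: "w \<in> Wj j"
      then have p: "0 < rat_height w" "real (card (on w)) \<le> C4 * real Q / real (rat_height w)"
        using Wprop[of w] by (auto simp: Wj_def)
      have "2 ^ j \<le> real (rat_height w)" using w by (auto simp: Wj_def)
      then have "C4 * real Q / real (rat_height w) \<le> C4 * real Q / 2 ^ j"
        using pos p by (intro divide_left_mono mult_pos_pos) auto
      then show "real (card (on w)) \<le> C4 * real Q / 2 ^ j" using p by simp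
    qed
    also have "\<dots> = real (card (Wj j)) * (C4 * real Q / 2 ^ j)" by simp
    also have "\<dots> \<le> (2 * R + 1) * (16 * C3 + 1) * (K * (2 ^ Suc j) powr (1 + \<epsilon>)) * (C4 * real Q / 2 ^ j)"
      using cardWj[OF j] pos by (intro mult_right_mono) auto
    also have "(2 ^ Suc j :: real) powr (1 + \<epsilon>) = 2 powr (1 + \<epsilon>) * (2 ^ j * (2 ^ j) powr \<epsilon>)"
      by (simp add: powr_mult powr_add)
    also have "(2 * R + 1) * (16 * C3 + 1) * (K * (2 powr (1 + \<epsilon>) * (2 ^ j * (2 ^ j) powr \<epsilon>))) * (C4 * real Q / 2 ^ j)
       = A * K * real Q * (2 ^ j) powr \<epsilon>"
      by (simp add: A R_def[symmetric] C3_def[symmetric] C4_def[symmetric])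
    finally show "(\<Sum>w\<in>Wj j. real (card (on w))) \<le> A * K * real Q * (2 ^ j) powr \<epsilon>" .
  qed
  also have "\<dots> = A * K * real Q * (\<Sum>j\<in>J. (2 ^ j) powr \<epsilon>)" by (simp add: sum_distrib_left)
  also have "\<dots> \<le> A * K * real Q * ((c1 * real Q) powr \<epsilon> / (1 - 2 powr - \<epsilon>))"
  proof (intro mult_left_mono)
    show "0 \<le> A * K * real Q" using K pos
      by (simp add: A R_def[symmetric] C3_def[symmetric] C4_def[symmetric])
    show "(\<Sum>j\<in>J. (2 ^ j) powr \<epsilon>) \<le> (c1 * real Q) powr \<epsilon> / (1 - 2 powr - \<epsilon>)"
    proof (cases "J = {}")
      case True
      have "(2::real) powr - \<epsilon> \<le> 1" using \<epsilon> by (simp add: powr_minus field_simps ge_one_powr_ge_zero)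
      then show ?thesis using True by simp
    next
      case False
      \<comment> \<open>\<open>J\<close> is an initial segment, so the sum over it is a full
        geometric sum.\<close>
      have "J = {..Max J}"
      proof (rule set_eqI)
        fix j
        have "j \<in> J" if "j \<le> Max J"
        proof -
          have "(2::real) ^ j \<le> 2 ^ Max J" using that by (intro power_increasing) auto
          also have "\<dots> \<le> c1 * real Q" using Max_in[OF finJ False] unfolding J_def by blast
          finally show ?thesis unfolding J_def by blast
        qed
        then show "j \<in> J \<longleftrightarrow> j \<in> {..Max J}" using finJ by auto
      qed
      moreover have "2 ^ Max J \<le> c1 * real Q" using Max_in[OF finJ False] unfolding J_def by blast
      ultimately show ?thesis using sum_dyadic_le[OF \<epsilon>, of "Max J" "c1 * real Q"] by simp
    qed
  qed
  finally show ?thesis using main cardI unfolding X_def[symmetric] by (simp add: mult.assoc)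
qed

text \<open>K depends only on c, C and \<epsilon>. This uniformity lets the induction pass to the
  dual curve and its translates, which form pairs with the same constants.\<close>

lemma card_rat_points_near_le:
  assumes c: "0 < c" and \<epsilon>: "0 < \<epsilon>"
  shows "\<exists>K\<ge>0. \<forall>f g fs gs z Q. conj_pair c C f g fs gs \<longrightarrow> 0 < Q \<longrightarrow>
    real (card (rat_points_near f z (z + 1) Q (1 / (4 * (real Q)\<^sup>2)))) \<le> K * real Q powr (1 + \<epsilon>)"
proof -
  define A where "A = (2 * (C / (2 * c) + 2 * C) + 1) * (16 * (1 / 4 + C / (16 * c\<^sup>2)) + 1) * (2 + 2 / sqrt (2 * c)) * 2 powr (1 + \<epsilon>)"
  define M where "M = 1 - 2 powr - \<epsilon>"
  have M: "M > 0" using \<epsilon> by (simp add: M_def powr_minus field_simps)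
  have "((\<lambda>x. A * x powr \<epsilon> / M) \<longlongrightarrow> A * 0 powr \<epsilon> / M) (at_right 0)"
    using \<epsilon> M by (intro tendsto_intros) (auto intro!: eventually_mono[OF eventually_at_right_less])
  \<comment> \<open>The recursive term gets a coefficient below 1/2 for small arcs, since \<epsilon>
    > 0 while A and M are independent of the arc length.\<close>
  then have "\<forall>\<^sub>F x in at_right 0. A * x powr \<epsilon> / M < 1 / 2"
    by (rule order_tendstoD) simp
  moreover have "((\<lambda>x. 2 * C * x ^ 3 + x) \<longlongrightarrow> 2 * C * 0 ^ 3 + 0) (at_right 0)"
    by (intro tendsto_intros)
  then have "\<forall>\<^sub>F x in at_right 0. 2 * C * x ^ 3 + x < 1"
    by (rule order_tendstoD) simp
  moreover have "\<forall>\<^sub>F x::real in at_right 0. 0 < x \<and> x < 1 / 4"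
    using eventually_at_right_real[of 0 "1/4 :: real"] by simp
  ultimately have "\<forall>\<^sub>F x in at_right 0. A * x powr \<epsilon> / M < 1 / 2 \<and> 2 * C * x ^ 3 + x < 1 \<and> 0 < x \<and> x < 1 / 4"
    by (auto simp only: eventually_conj_iff)
  then obtain c1 where c1: "A * c1 powr \<epsilon> / M < 1 / 2" "2 * C * c1 ^ 3 + c1 < 1" "0 < c1" "c1 < 1 / 4"
    using eventually_happens'[OF trivial_limit_at_right_real[of "0::real"]] by blast
  \<comment> \<open>Chosen so that the trivial term 4 / c1 is K / 2; the recursive term supplies the
    other half.\<close>
  define K where "K = 8 / c1"
  have K: "K \<ge> 0" using c1 by (simp add: K_def)
  have "real (card (rat_points_near f z (z + 1) Q (1 / (4 * (real Q)\<^sup>2)))) \<le> K * real Q powr (1 + \<epsilon>)"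
    if "conj_pair c C f g fs gs" "0 < Q" for f g fs gs z Q
    using that
  proof (induction Q arbitrary: f g fs gs z rule: less_induct)
    case (less Q)
    have "real (card (rat_points_near f z (z + 1) Q (1 / (4 * (real Q)\<^sup>2)))) \<le>
       4 / c1 * real Q + A * K * real Q * ((c1 * real Q) powr \<epsilon> / (1 - 2 powr - \<epsilon>))"
    proof (rule card_rat_points_near_step[OF less.prems(1) c \<epsilon> less.prems(2) K c1(3) _ c1(2) _ A_def])
      fix t w R assume "0 < R" "R < Q"
      then show "real (card (rat_points_near (\<lambda>x. fs x + t) w (w + 1) R (1 / (4 * (real R)\<^sup>2)))) \<le> K * real R powr (1 + \<epsilon>)"
        using less.IH conj_pair_translate[OF conj_pair_sym[OF less.prems(1)]] by blast
    qed (use c1 in simp)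
    also have "\<dots> = 4 / c1 * real Q + (A * c1 powr \<epsilon> / M) * (K * (real Q * real Q powr \<epsilon>))"
      using c1 by (simp add: M_def powr_mult)
    also have "\<dots> \<le> K / 2 * (real Q * real Q powr \<epsilon>) + 1 / 2 * (K * (real Q * real Q powr \<epsilon>))"
    proof (intro add_mono)
      have "1 \<le> real Q powr \<epsilon>" using less.prems(2) \<epsilon> by (simp add: ge_one_powr_ge_zero)
      then have "real Q * 1 \<le> real Q * real Q powr \<epsilon>" by (intro mult_left_mono) auto
      then have "4 / c1 * (real Q * 1) \<le> 4 / c1 * (real Q * real Q powr \<epsilon>)"
        by (rule mult_left_mono) (use c1 in simp)
      moreover have "4 / c1 = K / 2" by (simp add: K_def)
      ultimately show "4 / c1 * real Q \<le> K / 2 * (real Q * real Q powr \<epsilon>)" by (simp only: mult_1_right)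
      show "(A * c1 powr \<epsilon> / M) * (K * (real Q * real Q powr \<epsilon>)) \<le> 1 / 2 * (K * (real Q * real Q powr \<epsilon>))"
        using c1 K by (intro mult_right_mono) auto
    qed
    finally have "real (card (rat_points_near f z (z + 1) Q (1 / (4 * (real Q)\<^sup>2)))) \<le> K * (real Q * real Q powr \<epsilon>)"
      by simp
    then show ?case using less.prems(2) by (simp add: powr_add)
  qed
  then show ?thesis using K by blast
qed

section \<open>The upper bound\<close>

text \<open>The Legendre conjugate works: G is strictly increasing and onto, and the deviation of
  \<open>Fs\<close> from its tangent is that of \<open>F\<close> with base point and argument
  exchanged.\<close>

lemma conj_pair_exists:
  assumes c: "0 < c" and low: "\<And>x y. c * (y - x)\<^sup>2 \<le> F y - F x - G x * (y - x)"
    and upp: "\<And>x y. F y - F x - G x * (y - x) \<le> C * (y - x)\<^sup>2"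
  obtains Fs Gs k K where "0 < k" "conj_pair k K F G Fs Gs"
proof -
  have C: "0 < C" using low[of 1 0] upp[of 1 0] c by simp
  have G: "2 * c * (y - x) \<le> G y - G x" "G y - G x \<le> 2 * C * (y - x)" if "x \<le> y" for x y
  proof -
    have "2 * c * (y - x)\<^sup>2 \<le> (G y - G x) * (y - x)" "(G y - G x) * (y - x) \<le> 2 * C * (y - x)\<^sup>2"
      using low[of y x] low[of x y] upp[of y x] upp[of x y]
      by (simp_all add: algebra_simps power2_commute power2_eq_square)
    then show "2 * c * (y - x) \<le> G y - G x" "G y - G x \<le> 2 * C * (y - x)"
      using that by (cases "x = y"; simp add: power2_eq_square mult.assoc[symmetric])+
  qed
  have Gabs: "2 * c * \<bar>y - x\<bar> \<le> \<bar>G y - G x\<bar> \<and> \<bar>G y - G x\<bar> \<le> 2 * C * \<bar>y - x\<bar>" for x y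
  proof -
    have *: "2 * c * \<bar>v - u\<bar> \<le> \<bar>G v - G u\<bar> \<and> \<bar>G v - G u\<bar> \<le> 2 * C * \<bar>v - u\<bar>" if "u \<le> v" for u v
    proof -
      have "0 \<le> 2 * c * (v - u)" using c that by simp
      then show ?thesis using G[OF that] that by simp
    qed
    show ?thesis using *[of x y] *[of y x] by (cases "x \<le> y") (auto simp: abs_minus_commute)
  qed
  have cont: "continuous_on UNIV G"
  proof (rule lipschitz_on_continuous_on)
    show "(2 * C)-lipschitz_on UNIV G"
      using C Gabs by (intro lipschitz_onI) (auto simp: dist_real_def)
  qed
  have surj: "\<exists>x. G x = p" for p
  proof -
    define M where "M = \<bar>p - G 0\<bar> / (2 * c)"
    have M: "0 \<le> M" "2 * c * M = \<bar>p - G 0\<bar>" using c by (auto simp: M_def)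
    have "G (- M) \<le> p" "p \<le> G M" using G(1)[of 0 M] G(1)[of "-M" 0] M by auto
    moreover have "continuous_on {- M..M} G" using cont by (rule continuous_on_subset) simp
    moreover have "- M \<le> M" using M by simp
    ultimately show ?thesis using IVT'[of G "-M" p M] by metis
  qed
  have inj: "inj G" 
  proof (rule injI)
    fix x y assume "G x = G y"
    then have "2 * c * \<bar>y - x\<bar> \<le> 0" using Gabs[of y x] by simp
    then show "x = y" using c by (simp add: mult_le_0_iff)
  qed
  define Gs where "Gs = inv G"
  have "surj G" unfolding surj_def using surj by metis
  then have Gs: "Gs (G x) = x" "G (Gs p) = p" for x p
    unfolding Gs_def using inj by (simp_all add: surj_f_inv_f)
  define Fs where "Fs = (\<lambda>p. p * Gs p - F (Gs p))"
  \<comment> \<open>The bounds 2 c and 2 C on the slopes of G turn squares of abscissae into squares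
    of slopes; minimum and maximum make one pair of constants serve both functions.\<close>
  define k where "k = min c (c / (4 * C\<^sup>2))"
  define K where "K = max C (C / (4 * c\<^sup>2))"
  have Fs: "k * (q - p)\<^sup>2 \<le> Fs q - Fs p - Gs p * (q - p)" "Fs q - Fs p - Gs p * (q - p) \<le> K * (q - p)\<^sup>2" for p q
  proof -
    define x where "x = Gs p"
    define y where "y = Gs q"
    have e: "Fs q - Fs p - Gs p * (q - p) = F x - F y - G y * (x - y)"
      using Gs(2)[of q] by (simp add: Fs_def x_def y_def algebra_simps)
    have d: "2 * c * \<bar>x - y\<bar> \<le> \<bar>q - p\<bar>" "\<bar>q - p\<bar> \<le> 2 * C * \<bar>x - y\<bar>"
      using Gabs[of y x] unfolding x_def y_def Gs(2) by (simp_all only: abs_minus_commute[of "Gs p"])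
    have "(2 * c * \<bar>x - y\<bar>)\<^sup>2 \<le> \<bar>q - p\<bar>\<^sup>2" using d(1) c by (intro power_mono) auto
    then have d1: "4 * c\<^sup>2 * (x - y)\<^sup>2 \<le> (q - p)\<^sup>2" by (simp add: power_mult_distrib)
    have "\<bar>q - p\<bar>\<^sup>2 \<le> (2 * C * \<bar>x - y\<bar>)\<^sup>2" using d(2) by (intro power_mono) auto
    then have d2: "(q - p)\<^sup>2 \<le> 4 * C\<^sup>2 * (x - y)\<^sup>2" by (simp add: power_mult_distrib)
    have "k * (q - p)\<^sup>2 \<le> c / (4 * C\<^sup>2) * (q - p)\<^sup>2" by (intro mult_right_mono) (auto simp: k_def)
    also have "\<dots> \<le> c / (4 * C\<^sup>2) * (4 * C\<^sup>2 * (x - y)\<^sup>2)" using d2 c by (intro mult_left_mono) auto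
    also have "\<dots> = c * (x - y)\<^sup>2" using C by simp
    finally show "k * (q - p)\<^sup>2 \<le> Fs q - Fs p - Gs p * (q - p)" using low[of x y] unfolding e by linarith
    have "C * (x - y)\<^sup>2 = C / (4 * c\<^sup>2) * (4 * c\<^sup>2 * (x - y)\<^sup>2)" using c by simp
    also have "\<dots> \<le> C / (4 * c\<^sup>2) * (q - p)\<^sup>2" using d1 C by (intro mult_left_mono) auto
    also have "\<dots> \<le> K * (q - p)\<^sup>2" by (intro mult_right_mono) (auto simp: K_def)
    finally show "Fs q - Fs p - Gs p * (q - p) \<le> K * (q - p)\<^sup>2" using upp[of x y] unfolding e by linarith
  qed
  have F: "k * (y - x)\<^sup>2 \<le> F y - F x - G x * (y - x)" "F y - F x - G x * (y - x) \<le> K * (y - x)\<^sup>2" for x y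
  proof -
    have "k * (y - x)\<^sup>2 \<le> c * (y - x)\<^sup>2" by (intro mult_right_mono) (auto simp: k_def)
    then show "k * (y - x)\<^sup>2 \<le> F y - F x - G x * (y - x)" using low[of y x] by linarith
    have "C * (y - x)\<^sup>2 \<le> K * (y - x)\<^sup>2" by (intro mult_right_mono) (auto simp: K_def)
    then show "F y - F x - G x * (y - x) \<le> K * (y - x)\<^sup>2" using upp[of y x] by linarith
  qed
  show ?thesis
  proof (rule that)
    show "0 < k" using c C by (simp add: k_def)
    show "conj_pair k K F G Fs Gs"
      unfolding conj_pair_def using F Fs Gs by (simp add: Fs_def mult.commute)
  qed
qed

lemma mvt_between:
  fixes h h' :: "real \<Rightarrow> real"
  assumes h: "\<And>x. x \<in> {a..b} \<Longrightarrow> (h has_real_derivative h' x) (at x within {a..b})"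
    and u: "u \<in> {a..b}" and v: "v \<in> {a..b}"
  obtains \<xi> where "\<xi> \<in> {a..b}" "(u \<le> \<xi> \<and> \<xi> \<le> v) \<or> (v \<le> \<xi> \<and> \<xi> \<le> u)" "h v - h u = h' \<xi> * (v - u)"
proof -
  have *: "\<exists>\<xi>\<in>{p..q}. h q - h p = h' \<xi> * (q - p)" if "p \<le> q" "{p..q} \<subseteq> {a..b}" for p q
  proof -
    have "\<exists>\<xi>\<in>{p..q}. h q - h p = (\<lambda>t. h' \<xi> * t) (q - p)"
    proof (rule mvt_very_simple[OF that(1)])
      fix x assume "p \<le> x" "x \<le> q"
      then show "(h has_derivative (\<lambda>t. h' x * t)) (at x within {p..q})"
        using h[of x] that(2) has_field_derivative_subset[of h "h' x" x "{a..b}" "{p..q}"]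
        by (auto simp: has_field_derivative_def)
    qed
    then show ?thesis .
  qed
  show ?thesis
  proof (cases "u \<le> v")
    case True
    then obtain \<xi> where "\<xi> \<in> {u..v}" "h v - h u = h' \<xi> * (v - u)" using *[of u v] u v by auto
    then show ?thesis using that[of \<xi>] u v by auto
  next
    case False
    then obtain \<xi> where "\<xi> \<in> {v..u}" "h u - h v = h' \<xi> * (u - v)" using *[of v u] u v by auto
    then show ?thesis using that[of \<xi>] u v by (auto simp: algebra_simps)
  qed
qed

text \<open>After subtracting the tangent and the quadratic, the derivative has the sign of x - u.
  Upper bounds follow by applying this to -f.\<close>

lemma bregman_bounds:
  fixes f f' f'' :: "real \<Rightarrow> real"
  assumes f: "\<And>x. x \<in> {a..b} \<Longrightarrow> (f has_real_derivative f' x) (at x within {a..b})"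
    and f': "\<And>x. x \<in> {a..b} \<Longrightarrow> (f' has_real_derivative f'' x) (at x within {a..b})"
    and low: "\<And>x. x \<in> {a..b} \<Longrightarrow> c \<le> f'' x"
    and u: "u \<in> {a..b}" and v: "v \<in> {a..b}"
  shows "c / 2 * (v - u)\<^sup>2 \<le> f v - f u - f' u * (v - u)"
    and "u \<le> v \<Longrightarrow> c * (v - u) \<le> f' v - f' u"
proof -
  have mono: "c * (y - x) \<le> f' y - f' x" if xy: "x \<in> {a..b}" "y \<in> {a..b}" "x \<le> y" for x y
  proof -
    obtain \<xi> where "\<xi> \<in> {a..b}" "f' y - f' x = f'' \<xi> * (y - x)"
      using mvt_between[OF f' xy(1,2)] by metis
    then show ?thesis using low xy(3) by (simp add: mult_right_mono)
  qed
  then show "u \<le> v \<Longrightarrow> c * (v - u) \<le> f' v - f' u" using u v by blast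
  define \<phi> where "\<phi> = (\<lambda>x. f x - f u - f' u * (x - u) - c / 2 * (x - u)\<^sup>2)"
  have "(\<phi> has_real_derivative (f' x - f' u - c * (x - u))) (at x within {a..b})" if "x \<in> {a..b}" for x
    unfolding \<phi>_def by (rule derivative_eq_intros f that refl | simp)+
  then obtain \<xi> where \<xi>: "\<xi> \<in> {a..b}" "(u \<le> \<xi> \<and> \<xi> \<le> v) \<or> (v \<le> \<xi> \<and> \<xi> \<le> u)"
      "\<phi> v - \<phi> u = (f' \<xi> - f' u - c * (\<xi> - u)) * (v - u)"
    using mvt_between[of a b \<phi> "\<lambda>x. f' x - f' u - c * (x - u)" u v] u v by metis
  have "0 \<le> (f' \<xi> - f' u - c * (\<xi> - u)) * (v - u)"
    using \<xi>(2)
  proof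
    assume "u \<le> \<xi> \<and> \<xi> \<le> v"
    then show ?thesis using mono[OF u \<xi>(1)] by (intro mult_nonneg_nonneg) auto
  next
    assume "v \<le> \<xi> \<and> \<xi> \<le> u"
    then show ?thesis using mono[OF \<xi>(1) u] by (intro mult_nonpos_nonpos) (auto simp: algebra_simps)
  qed
  then show "c / 2 * (v - u)\<^sup>2 \<le> f v - f u - f' u * (v - u)"
    using \<xi>(3) by (simp add: \<phi>_def)
qed

text \<open>The extension is quadratic outside \<open>{a..b}\<close>, with second derivative \<open>c\<close>.\<close>

lemma conj_pair_extension:
  fixes f f' f'' :: "real \<Rightarrow> real"
  assumes ab: "a \<le> b" and c: "0 < c"
    and f: "\<And>x. x \<in> {a..b} \<Longrightarrow> (f has_real_derivative f' x) (at x within {a..b})"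
    and f': "\<And>x. x \<in> {a..b} \<Longrightarrow> (f' has_real_derivative f'' x) (at x within {a..b})"
    and f'': "\<And>x. x \<in> {a..b} \<Longrightarrow> c \<le> f'' x \<and> f'' x \<le> C"
  obtains F G Fs Gs k K where "0 < k" "conj_pair k K F G Fs Gs" "\<And>x. x \<in> {a..b} \<Longrightarrow> F x = f x"
proof -
  define \<pi> where "\<pi> = (\<lambda>x. max a (min b x))"
  define F where "F = (\<lambda>x. f (\<pi> x) + f' (\<pi> x) * (x - \<pi> x) + c / 2 * (x - \<pi> x)\<^sup>2)"
  define G where "G = (\<lambda>x. f' (\<pi> x) + c * (x - \<pi> x))"
  have \<pi>: "\<pi> x \<in> {a..b}" for x using ab by (auto simp: \<pi>_def)
  have cC: "c \<le> C" using f''[of a] ab by auto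
  have D: "c / 2 * (y - x)\<^sup>2 \<le> F y - F x - G x * (y - x) \<and> F y - F x - G x * (y - x) \<le> C / 2 * (y - x)\<^sup>2" for x y
  proof -
    define u where "u = \<pi> x"
    define v where "v = \<pi> y"
    define p where "p = x - u"
    define r where "r = y - v"
    have uv: "u \<in> {a..b}" "v \<in> {a..b}" using \<pi> by (auto simp: u_def v_def)
    have xy: "y - x = (v - u) + (r - p)" by (simp add: p_def r_def)
    \<comment> \<open>The deviation splits into a part on {a..b}, between the projections u and v,
      and parts due to the overshoots p and r.\<close>
    have id: "F y - F x - G x * (y - x) =
        (f v - f u - f' u * (v - u)) + (f' v - f' u) * r + c / 2 * (r - p)\<^sup>2 - c * (p * (v - u))"
      unfolding F_def G_def u_def[symmetric] v_def[symmetric] p_def[symmetric] r_def[symmetric] xy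
      by (simp add: power2_eq_square field_simps)
    \<comment> \<open>A point overshoots only when its projection is the endpoint on that side,
      which fixes the signs of the mixed products.\<close>
    have r: "r > 0 \<Longrightarrow> u \<le> v" "r < 0 \<Longrightarrow> v \<le> u" and p: "p > 0 \<Longrightarrow> v \<le> u" "p < 0 \<Longrightarrow> u \<le> v"
      using uv ab by (auto simp: r_def p_def u_def v_def \<pi>_def max_def min_def split: if_splits)
    have vr: "0 \<le> (v - u) * r" using r by (cases r "0 :: real" rule: linorder_cases) (auto simp: zero_le_mult_iff)
    have pv: "p * (v - u) \<le> 0" using p by (cases p "0 :: real" rule: linorder_cases) (auto simp: mult_le_0_iff)
    have neg: "((\<lambda>x. - f x) has_real_derivative - f' x) (at x within {a..b})"
        "((\<lambda>x. - f' x) has_real_derivative - f'' x) (at x within {a..b})" if "x \<in> {a..b}" for x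
      using f f' that by (auto intro!: derivative_eq_intros)
    have f'u: "f'' x \<le> C" "c \<le> f'' x" if "x \<in> {a..b}" for x using f'' that by auto
    have neg': "- C \<le> - f'' x" if "x \<in> {a..b}" for x using f'' that by auto
    have D1: "c / 2 * (v - u)\<^sup>2 \<le> f v - f u - f' u * (v - u)"
      using bregman_bounds(1)[OF f f' f'u(2) uv] by simp
    have D2: "f v - f u - f' u * (v - u) \<le> C / 2 * (v - u)\<^sup>2"
      using bregman_bounds(1)[OF neg neg' uv] by simp
    have lo: "c * (t - w) \<le> f' t - f' w" and hi: "f' t - f' w \<le> C * (t - w)"
      if "w \<le> t" "w \<in> {a..b}" "t \<in> {a..b}" for w t
      using bregman_bounds(2)[OF f f' f'u(2) that(2,3,1)] bregman_bounds(2)[OF neg neg' that(2,3,1)] by simp_all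
    have E: "c * ((v - u) * r) \<le> (f' v - f' u) * r \<and> (f' v - f' u) * r \<le> C * ((v - u) * r)"
    proof (cases r "0 :: real" rule: linorder_cases)
      case less
      have "(c * (u - v)) * (- r) \<le> (f' u - f' v) * (- r)" "(f' u - f' v) * (- r) \<le> (C * (u - v)) * (- r)"
        using less by (intro mult_right_mono lo[OF r(2) uv(2,1)] hi[OF r(2) uv(2,1)]; simp)+
      then show ?thesis by (simp add: algebra_simps)
    next
      case greater
      have "(c * (v - u)) * r \<le> (f' v - f' u) * r" "(f' v - f' u) * r \<le> (C * (v - u)) * r"
        using greater by (intro mult_right_mono lo[OF r(1) uv] hi[OF r(1) uv]; simp)+
      then show ?thesis by (simp add: mult.assoc)
    qed simp
    \<comment> \<open>Both required inequalities are linear in these four products, and the lower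
      bound holds term by term.\<close>
    define A1 where "A1 = (v - u)\<^sup>2"
    define A2 where "A2 = (v - u) * r"
    define A3 where "A3 = (r - p)\<^sup>2"
    define A4 where "A4 = p * (v - u)"
    have E0: "(y - x)\<^sup>2 = A1 + 2 * A2 + A3 - 2 * A4"
      unfolding xy A1_def A2_def A3_def A4_def by (simp add: power2_eq_square algebra_simps)
    have sq: "t / 2 * (y - x)\<^sup>2 = t / 2 * A1 + t * A2 + t / 2 * A3 - t * A4" for t
      unfolding E0 by (simp add: field_simps)
    have "c / 2 * A3 \<le> C / 2 * A3" using cC by (intro mult_right_mono) (auto simp: A3_def)
    moreover have "C * A4 \<le> c * A4" using cC pv unfolding A4_def by (intro mult_right_mono_neg)
    ultimately show ?thesis
      using D1 D2 E unfolding id sq A1_def[symmetric] A2_def[symmetric] A3_def[symmetric] A4_def[symmetric]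
      by linarith
  qed
  obtain Fs Gs k K where "0 < k" "conj_pair k K F G Fs Gs"
  proof (rule conj_pair_exists[of "c / 2" F G "C / 2"])
    show "c / 2 * (y - x)\<^sup>2 \<le> F y - F x - G x * (y - x)" for x y using D by blast
    show "F y - F x - G x * (y - x) \<le> C / 2 * (y - x)\<^sup>2" for x y using D by blast
  qed (use c in auto)
  moreover have "F x = f x" if "x \<in> {a..b}" for x
    using that by (simp add: F_def \<pi>_def)
  ultimately show ?thesis using that by blast
qed

section \<open>The covering estimate on one arc\<close>

lemma dist_int_nonneg: "0 \<le> dist_int x"
  by (simp add: dist_int_eq_round)

lemma dist_int_le_half: "dist_int x \<le> 1 / 2"
  using of_int_round_abs_le[of x] by (simp add: dist_int_eq_round abs_minus_commute)

lemma dist_int_minus: "dist_int (- x) = dist_int x"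
proof -
  have "dist_int (- y) \<le> dist_int y" for y
  proof -
    have "dist_int (- y) \<le> \<bar>- y - of_int (- round y)\<bar>"
      unfolding dist_int_def by (intro cINF_lower bdd_belowI[of _ 0]) auto
    then show ?thesis by (simp add: dist_int_eq_round[of y])
  qed
  from this[of x] this[of "- x"] show ?thesis by simp
qed

lemma dyadic_scale:
  assumes "\<mu> \<le> (1::real)" "\<not> \<mu> \<le> (1/2) ^ N"
  obtains k where "k < N" "\<mu> \<le> (1/2) ^ k" "(1/2) ^ Suc k < \<mu>"
proof -
  have "\<exists>k<N. \<mu> \<le> (1/2) ^ k \<and> (1/2) ^ Suc k < \<mu>"
    using assms(2)
  proof (induction N)
    case (Suc N)
    then show ?case by (cases "\<mu> \<le> (1/2) ^ N") (auto simp: not_le less_Suc_eq)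
  qed (use assms(1) in simp)
  then show ?thesis using that by blast
qed

lemma hausdorff_content_interval_le:
  assumes s: "0 < s" and T: "\<And>x y. x \<in> T \<Longrightarrow> y \<in> T \<Longrightarrow> \<bar>x - y\<bar> \<le> (d::real)" and d: "0 \<le> d"
  shows "hausdorff_content s T \<le> ennreal (d powr s)"
proof -
  have b: "bounded T" unfolding bounded_two_points using T by (auto simp: dist_real_def)
  have "diameter T \<le> d" using T d by (intro diameter_le) auto
  then have "diam_pow s T \<le> ennreal (d powr s)"
    using s diameter_ge_0[OF b] by (auto simp: diam_pow_pos_exponent intro!: ennreal_leI powr_mono2)
  then show ?thesis using hausdorff_content_le_diam_pow[OF b, of s] by (rule order.trans[rotated])
qed

text \<open>Dyadic ranges of q are covered separately, and each range by the dyadic size of the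
  larger distance; the total costs are summable in n, so the limsup set is null.\<close>

lemma mult_approx_content_null_on_interval:
  fixes f f' f'' :: "real \<Rightarrow> real"
  assumes ab: "a < b" and c: "0 < c"
    and f: "\<And>x. x \<in> {a..b} \<Longrightarrow> (f has_real_derivative f' x) (at x within {a..b})"
    and f': "\<And>x. x \<in> {a..b} \<Longrightarrow> (f' has_real_derivative f'' x) (at x within {a..b})"
    and f'': "\<And>x. x \<in> {a..b} \<Longrightarrow> c \<le> f'' x \<and> f'' x \<le> C"
    and m: "0 < m" "\<And>x. x \<in> {a..b} \<Longrightarrow> m \<le> \<bar>f' x\<bar>"
    and s: "0 < s" "s \<le> 1" "0 < \<rho>" "s * \<rho> \<le> 2" "2 < s * (1 + \<rho>)"
  shows "hausdorff_content s {x \<in> {a..b}. infinite {q::nat. q > 0 \<and>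
    dist_int (real q * x) * dist_int (real q * f x) < real q powr - \<rho>}} = 0"
proof -
  \<comment> \<open>Half of the available excess goes into the counting bound; the other half is the
    decay left over at the end.\<close>
  define \<epsilon> where "\<epsilon> = (s * (1 + \<rho>) - 2) / 2"
  have \<epsilon>: "0 < \<epsilon>" using s by (simp add: \<epsilon>_def)
  obtain F G Fs Gs k K where k: "0 < k" and cp: "conj_pair k K F G Fs Gs" and Ff: "\<And>x. x \<in> {a..b} \<Longrightarrow> F x = f x"
    by (rule conj_pair_extension[OF less_imp_le[OF ab] c f f' f'']) (assumption+, rule that)
  obtain K1 where K1: "0 \<le> K1" "\<forall>f g fs gs z Q. conj_pair k K f g fs gs \<longrightarrow> 0 < Q \<longrightarrow>
    real (card (rat_points_near f z (z + 1) Q (1 / (4 * (real Q)\<^sup>2)))) \<le> K1 * real Q powr (1 + \<epsilon>)"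
    using card_rat_points_near_le[OF k \<epsilon>, of K] by blast
  have K: "0 < K" using conj_pair_le[OF cp] k by simp
  \<comment> \<open>A Lipschitz constant up to distance 1 from {a..b}. The rational abscissa near x
    may leave the interval, where only the extension \<open>F\<close> makes sense.\<close>
  define \<Lambda> where "\<Lambda> = \<bar>G a\<bar> + 2 * K * (b - a) + K"
  have \<Lambda>: "0 \<le> \<Lambda>" using K ab by (simp add: \<Lambda>_def)
  have lip: "\<bar>F y - F x\<bar> \<le> \<Lambda> * \<bar>y - x\<bar>" if "x \<in> {a..b}" "\<bar>y - x\<bar> \<le> 1" for x y
  proof -
    have "\<bar>G x - G a\<bar> \<le> 2 * K * \<bar>x - a\<bar>" by (rule conj_pair_deriv_Lipschitz[OF cp k])
    also have "\<dots> \<le> 2 * K * (b - a)" using that K by (intro mult_left_mono) auto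
    finally have Gx: "\<bar>G x\<bar> \<le> \<bar>G a\<bar> + 2 * K * (b - a)" by linarith
    have "0 \<le> k * (y - x)\<^sup>2" using k by simp
    then have "\<bar>F y - F x - G x * (y - x)\<bar> \<le> K * (y - x)\<^sup>2"
      using conj_pair_lower[OF cp, of y x] conj_pair_upper[OF cp, of y x] by linarith
    also have "(y - x)\<^sup>2 = \<bar>y - x\<bar> * \<bar>y - x\<bar>" by (simp add: power2_eq_square)
    also have "K * (\<bar>y - x\<bar> * \<bar>y - x\<bar>) \<le> K * (1 * \<bar>y - x\<bar>)"
      using that K by (intro mult_left_mono mult_right_mono) auto
    finally have "\<bar>F y - F x\<bar> \<le> \<bar>G x * (y - x)\<bar> + K * \<bar>y - x\<bar>" by linarith
    also have "\<bar>G x * (y - x)\<bar> \<le> (\<bar>G a\<bar> + 2 * K * (b - a)) * \<bar>y - x\<bar>"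
      using Gx by (simp add: abs_mult mult_right_mono)
    finally show ?thesis by (simp add: \<Lambda>_def algebra_simps)
  qed
  \<comment> \<open>Needed when q f(x) is the better approximated coordinate: closeness of ordinates
    is converted into closeness of abscissae.\<close>
  have expand: "m * \<bar>x - y\<bar> \<le> \<bar>f x - f y\<bar>" if xy: "x \<in> {a..b}" "y \<in> {a..b}" for x y
  proof -
    obtain \<xi> where "\<xi> \<in> {a..b}" "f x - f y = f' \<xi> * (x - y)"
      using mvt_between[OF f xy(2,1)] by metis
    then show ?thesis using m(2) by (simp add: abs_mult mult_right_mono)
  qed
  define P where "P = (\<lambda>n k. rat_points_near F (a - 1) (b + 1) (2 * 2 ^ n) ((\<Lambda> + 1) / (2 ^ k * 2 ^ n)))"
  define d where "d = (\<lambda>n k. 4 * 2 ^ k * (2 ^ n) powr (- 1 - \<rho>) :: real)"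
  \<comment> \<open>At scale 2^(-n \<rho> / 2) the larger distance reaches the square root of the
    bound on the product; further subdivision gains nothing.\<close>
  define k0 where "k0 = (\<lambda>n::nat. nat \<lfloor>real n * \<rho> / 2\<rfloor>)"
  define T1 where "T1 = (\<lambda>n k (w::real \<times> real). {x \<in> {a..b}. \<bar>x - fst w\<bar> \<le> d n k})"
  define T2 where "T2 = (\<lambda>n k (w::real \<times> real). {x \<in> {a..b}. \<bar>f x - snd w\<bar> \<le> d n k})"
  define E where "E = (\<lambda>n::nat. {x \<in> {a..b}. \<exists>q::nat. 2 ^ n \<le> q \<and> q < 2 ^ Suc n \<and>
    dist_int (real q * x) * dist_int (real q * f x) < real q powr - \<rho>})"
  have d0: "0 < d n k" for n k by (simp add: d_def)
  have cover: "E n \<subseteq> (\<Union>k\<in>{..k0 n}. \<Union>w\<in>P n k. T1 n k w \<union> T2 n k w)" for n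
  proof
    fix x assume "x \<in> E n"
    then obtain q :: nat where x: "x \<in> {a..b}" and q: "2 ^ n \<le> q" "q < 2 ^ Suc n"
      and pr: "dist_int (real q * x) * dist_int (real q * f x) < real q powr - \<rho>"
      by (auto simp: E_def)
    define \<alpha> where "\<alpha> = dist_int (real q * x)"
    define \<beta> where "\<beta> = dist_int (real q * f x)"
    define \<xi> where "\<xi> = of_int (round (real q * x)) / real q"
    define y where "y = of_int (round (real q * f x)) / real q"
    define \<mu> where "\<mu> = max \<alpha> \<beta>"
    define \<nu> where "\<nu> = min \<alpha> \<beta>"
    define Q where "Q = (2::real) ^ n"
    have Q: "1 \<le> Q" by (simp add: Q_def)
    have "real (2 ^ n) \<le> real q" using q(1) by (simp only: of_nat_le_iff)
    then have qQ: "Q \<le> real q" by (simp add: Q_def)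
    then have q0: "0 < q" using Q by (auto intro: gr0I)
    have \<alpha>\<beta>: "0 \<le> \<alpha>" "\<alpha> \<le> 1 / 2" "0 \<le> \<beta>" "\<beta> \<le> 1 / 2"
      unfolding \<alpha>_def \<beta>_def by (rule dist_int_nonneg dist_int_le_half)+
    have "\<nu> * \<mu> = \<alpha> * \<beta>" by (auto simp: \<mu>_def \<nu>_def max_def min_def)
    also have "\<dots> < real q powr - \<rho>" using pr by (simp add: \<alpha>_def \<beta>_def)
    also have "\<dots> \<le> Q powr - \<rho>" using s Q qQ by (intro powr_mono2') auto
    finally have prod: "\<nu> * \<mu> < Q powr - \<rho>" .
    have \<nu>: "0 \<le> \<nu>" "\<nu> \<le> \<mu>" "\<mu> \<le> 1" using \<alpha>\<beta> by (auto simp: \<nu>_def \<mu>_def)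
    have dx: "\<bar>x - \<xi>\<bar> = \<alpha> / real q" and dy: "\<bar>f x - y\<bar> = \<beta> / real q"
    proof -
      have "x - \<xi> = (real q * x - of_int (round (real q * x))) / real q"
        "f x - y = (real q * f x - of_int (round (real q * f x))) / real q"
        using q0 by (simp_all add: \<xi>_def y_def field_simps)
      then show "\<bar>x - \<xi>\<bar> = \<alpha> / real q" "\<bar>f x - y\<bar> = \<beta> / real q"
        by (simp_all add: \<alpha>_def \<beta>_def dist_int_eq_round abs_divide)
    qed
    \<comment> \<open>Either the larger distance has an exact dyadic size, and division bounds the
      smaller one, or it lies below the last scale. Then the smaller distance is at most
      Q^(-\<rho>/2), and rounding \<open>k0\<close> down costs a factor 2.\<close>
    obtain k where k: "k \<le> k0 n" "\<mu> \<le> (1/2) ^ k" "\<nu> \<le> 4 * 2 ^ k * Q powr - \<rho>"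
    proof (cases "\<mu> \<le> (1/2) ^ k0 n")
      case True
      have "\<nu>\<^sup>2 \<le> \<nu> * \<mu>" using \<nu> by (simp add: power2_eq_square mult_left_mono)
      also have "\<dots> < Q powr - \<rho>" by (rule prod)
      also have "\<dots> = (Q powr (- \<rho> / 2))\<^sup>2"
        using Q by (simp add: powr_powr flip: powr_numeral)
      finally have "\<nu>\<^sup>2 \<le> (Q powr (- \<rho> / 2))\<^sup>2" by simp
      then have 1: "\<nu> \<le> Q powr (- \<rho> / 2)" by (rule power2_le_imp_le) simp
      have "real n * \<rho> / 2 \<le> real (k0 n) + 1" using s by (simp add: k0_def)
      then have "2 powr (real n * \<rho> / 2) \<le> 2 powr (real (k0 n) + 1)" by (intro powr_mono) auto
      also have "\<dots> = 2 * 2 ^ k0 n" by (simp add: powr_add powr_realpow)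
      also have "2 powr (real n * \<rho> / 2) = Q powr (\<rho> / 2)"
        by (simp add: Q_def powr_powr flip: powr_realpow)
      finally have "Q powr (\<rho> / 2) * Q powr - \<rho> \<le> 2 * 2 ^ k0 n * Q powr - \<rho>" by (intro mult_right_mono) auto
      also have "Q powr (\<rho> / 2) * Q powr - \<rho> = Q powr (- \<rho> / 2)" by (simp flip: powr_add)
      also have "2 * 2 ^ k0 n * Q powr - \<rho> \<le> 4 * 2 ^ k0 n * Q powr - \<rho>" by (intro mult_right_mono) auto
      finally show ?thesis using True 1 that[of "k0 n"] by simp
    next
      case False
      obtain k where k: "k < k0 n" "\<mu> \<le> (1/2) ^ k" "(1/2) ^ Suc k < \<mu>"
        using dyadic_scale[OF \<nu>(3) False] by blast
      have "\<nu> * (1/2) ^ Suc k \<le> \<nu> * \<mu>" using k \<nu> by (intro mult_left_mono) auto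
      then have "\<nu> * (1/2) ^ Suc k \<le> Q powr - \<rho>" using prod by simp
      then have "\<nu> \<le> 2 * 2 ^ k * Q powr - \<rho>" by (simp add: power_divide field_simps)
      also have "\<dots> \<le> 4 * 2 ^ k * Q powr - \<rho>" by (intro mult_right_mono) auto
      finally show ?thesis using k that[of k] by simp
    qed
    have "\<nu> / real q \<le> 4 * 2 ^ k * Q powr - \<rho> / Q"
      using k(3) \<nu> Q qQ by (intro frac_le) auto
    also have "\<dots> = 4 * 2 ^ k * (Q powr - \<rho> / Q powr 1)" using Q by simp
    also have "\<dots> = d n k" unfolding d_def Q_def[symmetric] powr_diff[symmetric] by (simp add: minus_diff_commute)
    finally have dnk: "\<nu> / real q \<le> d n k" .
    have "\<alpha> / real q \<le> 1 / 1" using \<alpha>\<beta> Q qQ by (intro frac_le) auto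
    then have x1: "\<bar>\<xi> - x\<bar> \<le> 1" using dx by (simp add: abs_minus_commute)
    have "\<bar>F \<xi> - y\<bar> \<le> \<bar>F \<xi> - F x\<bar> + \<bar>f x - y\<bar>" using Ff[OF x] by linarith
    also have "\<dots> \<le> \<Lambda> * (\<alpha> / real q) + \<beta> / real q" using lip[OF x x1] dx dy by (simp add: abs_minus_commute)
    also have "\<dots> = (\<Lambda> * \<alpha> + \<beta>) / real q" by (simp add: add_divide_distrib)
    also have "\<dots> \<le> (\<Lambda> * (1/2) ^ k + (1/2) ^ k) / Q"
      using k(2) \<alpha>\<beta> Q qQ \<Lambda> by (intro frac_le add_mono mult_left_mono) (auto simp: \<mu>_def)
    also have "\<dots> = (\<Lambda> + 1) / (2 ^ k * Q)" by (simp add: power_divide field_simps)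
    finally have near: "\<bar>F \<xi> - y\<bar> \<le> (\<Lambda> + 1) / (2 ^ k * 2 ^ n)" by (simp add: Q_def)
    have "a - 1 \<le> \<xi>" "\<xi> \<le> b + 1" using x x1 by (auto simp: abs_le_iff)
    moreover have "real q * \<xi> \<in> \<int>" "real q * y \<in> \<int>" using q0 by (simp_all add: \<xi>_def y_def)
    moreover have "q \<le> 2 * 2 ^ n" using q by simp
    ultimately have "(\<xi>, y) \<in> P n k"
      using near q0 unfolding P_def rat_points_near_def by blast
    moreover have "x \<in> T1 n k (\<xi>, y) \<union> T2 n k (\<xi>, y)"
    proof (cases "\<alpha> \<le> \<beta>")
      case True
      then show ?thesis using x dx dnk by (simp add: T1_def \<nu>_def)
    next
      case False
      then show ?thesis using x dy dnk by (simp add: T2_def \<nu>_def)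
    qed
    ultimately show "x \<in> (\<Union>k\<in>{..k0 n}. \<Union>w\<in>P n k. T1 n k w \<union> T2 n k w)" using k(1) by blast
  qed
  define D where "D = 2 + 2 / m"
  have D: "2 \<le> D" "2 / m \<le> D" "0 < D" using m by (auto simp: D_def add_pos_pos)
  have T: "hausdorff_content s (T1 n k w \<union> T2 n k w) \<le> ennreal (2 * (D * d n k) powr s)" for n k w
  proof -
    have Dd: "2 * d n k \<le> D * d n k" "2 / m * d n k \<le> D * d n k"
      using D d0[of n k] by (intro mult_right_mono; simp)+
    have diam1: "\<bar>x - x'\<bar> \<le> D * d n k" if "x \<in> T1 n k w" "x' \<in> T1 n k w" for x x'
    proof -
      have "\<bar>x - fst w\<bar> \<le> d n k" "\<bar>x' - fst w\<bar> \<le> d n k" using that by (simp_all add: T1_def)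
      then show ?thesis using Dd(1) by linarith
    qed
    have diam2: "\<bar>x - x'\<bar> \<le> D * d n k" if "x \<in> T2 n k w" "x' \<in> T2 n k w" for x x'
    proof -
      have "\<bar>f x - snd w\<bar> \<le> d n k" "\<bar>f x' - snd w\<bar> \<le> d n k" "x \<in> {a..b}" "x' \<in> {a..b}"
        using that by (simp_all add: T2_def)
      then have "m * \<bar>x - x'\<bar> \<le> 2 * d n k" using expand[of x x'] by linarith
      then have "\<bar>x - x'\<bar> \<le> 2 / m * d n k" using m(1) by (simp add: field_simps)
      then show ?thesis using Dd(2) by simp
    qed
    have "0 \<le> D * d n k" using D d0[of n k] by simp
    note T12 = hausdorff_content_interval_le[OF s(1) diam1 this] hausdorff_content_interval_le[OF s(1) diam2 this]
    have "hausdorff_content s (T1 n k w \<union> T2 n k w) \<le> hausdorff_content s (T1 n k w) + hausdorff_content s (T2 n k w)"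
      by (rule hausdorff_content_Un_le)
    also have "\<dots> \<le> ennreal ((D * d n k) powr s) + ennreal ((D * d n k) powr s)"
      by (intro add_mono T12)
    finally have "hausdorff_content s (T1 n k w \<union> T2 n k w) \<le> ennreal ((D * d n k) powr s) + ennreal ((D * d n k) powr s)" .
    then show ?thesis by (simp flip: ennreal_plus)
  qed
  define B where "B = (b - a + 3) * (16 * (\<Lambda> + 1) + 1) * (K1 * 2 powr (1 + \<epsilon>)) * (2 * ((D * 4) powr s)) * 2"
  have B: "0 \<le> B" using ab \<Lambda> K1 by (simp add: B_def)
  have finP: "finite (P n k)" for n k by (simp add: P_def finite_rat_points_near)
  have term_le: "real (card (P n k)) * (2 * (D * d n k) powr s) \<le> B * 2 powr (- \<epsilon> * real n)" if "k \<le> k0 n" for n k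
  proof -
    define Q where "Q = (2::real) ^ n"
    have Q: "1 \<le> Q" by (simp add: Q_def)
    have Qr: "real (2 * 2 ^ n) = 2 * Q" by (simp add: Q_def)
    have "real (card (P n k)) \<le> ((b + 1) - (a - 1) + 1) * (4 * ((\<Lambda> + 1) / (2 ^ k * Q)) * (real (2 * 2 ^ n))\<^sup>2 + 1) *
        (K1 * (real (2 * 2 ^ n)) powr (1 + \<epsilon>))"
      unfolding P_def Q_def[symmetric]
    proof (rule card_rat_points_near_general)
      fix t z
      show "real (card (rat_points_near (\<lambda>x. F x + t) z (z + 1) (2 * 2 ^ n) (1 / (4 * (real (2 * 2 ^ n))\<^sup>2)))) \<le> K1 * (real (2 * 2 ^ n)) powr (1 + \<epsilon>)"
        by (rule K1(2)[rule_format, OF conj_pair_translate[OF cp]]) simp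
    qed (use ab \<Lambda> Q in auto)
    also have "\<dots> = (b - a + 3) * (16 * (\<Lambda> + 1) * (Q / 2 ^ k) + 1) * (K1 * (2 * Q) powr (1 + \<epsilon>))"
      unfolding Qr using Q by (simp add: power2_eq_square field_simps)
    also have "\<dots> \<le> (b - a + 3) * ((16 * (\<Lambda> + 1) + 1) * (Q / 2 ^ k + 1)) * (K1 * (2 * Q) powr (1 + \<epsilon>))"
    proof (intro mult_right_mono mult_left_mono)
      have ut: "u * t + 1 \<le> (u + 1) * (t + 1)" if "0 \<le> u" "0 \<le> t" for u t :: real
        using that by (simp add: algebra_simps)
      show "16 * (\<Lambda> + 1) * (Q / 2 ^ k) + 1 \<le> (16 * (\<Lambda> + 1) + 1) * (Q / 2 ^ k + 1)"
        by (rule ut) (use \<Lambda> Q in auto)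
    qed (use ab K1(1) in auto)
    finally have card: "real (card (P n k)) \<le> (b - a + 3) * ((16 * (\<Lambda> + 1) + 1) * (Q / 2 ^ k + 1)) * (K1 * (2 * Q) powr (1 + \<epsilon>))" .
    have ds: "(D * d n k) powr s = (D * 4) powr s * ((2 ^ k) powr s * Q powr (- (s * (1 + \<rho>))))"
    proof -
      have "D * d n k = (D * 4) * (2 ^ k * Q powr (- 1 - \<rho>))" by (simp add: d_def Q_def)
      moreover have "(- 1 - \<rho>) * s = - (s * (1 + \<rho>))" by (simp add: algebra_simps)
      ultimately show ?thesis using D by (simp add: powr_mult powr_powr)
    qed
    have "real (card (P n k)) * (2 * (D * d n k) powr s) \<le>
       ((b - a + 3) * ((16 * (\<Lambda> + 1) + 1) * (Q / 2 ^ k + 1)) * (K1 * (2 * Q) powr (1 + \<epsilon>))) * (2 * (D * d n k) powr s)"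
      using card by (intro mult_right_mono) auto
    also have "\<dots> = (b - a + 3) * (16 * (\<Lambda> + 1) + 1) * (K1 * 2 powr (1 + \<epsilon>)) * (2 * ((D * 4) powr s)) *
        (((Q / 2 ^ k + 1) * (2 ^ k) powr s) * (Q powr (1 + \<epsilon>) * Q powr (- (s * (1 + \<rho>)))))"
      unfolding ds powr_mult[of 2 Q] by (simp only: ac_simps)
    also have "\<dots> \<le> (b - a + 3) * (16 * (\<Lambda> + 1) + 1) * (K1 * 2 powr (1 + \<epsilon>)) * (2 * ((D * 4) powr s)) *
        ((2 * Q) * (Q powr (1 + \<epsilon>) * Q powr (- (s * (1 + \<rho>)))))"
    proof (intro mult_left_mono mult_right_mono)
      \<comment> \<open>The term Q / 2^k is absorbed by s <= 1, and the term 1 by k <= n \<rho> / 2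
        together with s \<rho> <= 2.\<close>
      have "(2 ^ k :: real) powr s \<le> (2 ^ k) powr 1" using s by (intro powr_mono) auto
      then have "Q / 2 ^ k * (2 ^ k) powr s \<le> Q / 2 ^ k * 2 ^ k" using Q by (intro mult_left_mono) auto
      then have 1: "Q / 2 ^ k * (2 ^ k) powr s \<le> Q" by simp
      have "real k \<le> real n * \<rho> / 2" using that s unfolding k0_def by (simp add: le_nat_iff le_floor_iff)
      then have "real k * s \<le> real n * \<rho> / 2 * s" using s by (intro mult_right_mono) auto
      also have "\<dots> = real n * (s * \<rho> / 2)" by simp
      also have "\<dots> \<le> real n * 1" using s by (intro mult_left_mono) auto
      finally have "2 powr (real k * s) \<le> 2 powr real n" by (intro powr_mono) auto
      then have "(2 ^ k) powr s \<le> Q" by (simp add: Q_def powr_powr flip: powr_realpow)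
      with 1 show "(Q / 2 ^ k + 1) * (2 ^ k) powr s \<le> 2 * Q" by (simp add: algebra_simps)
    qed (use ab \<Lambda> K1 Q in auto)
    also have "\<dots> = B * (Q powr 1 * Q powr (1 + \<epsilon>) * Q powr (- (s * (1 + \<rho>))))"
      using Q by (simp add: B_def)
    also have "Q powr 1 * Q powr (1 + \<epsilon>) * Q powr (- (s * (1 + \<rho>))) = Q powr (- \<epsilon>)"
    proof -
      have "1 + (1 + \<epsilon>) + - (s * (1 + \<rho>)) = - \<epsilon>" by (simp add: \<epsilon>_def field_simps)
      then show ?thesis by (simp only: powr_add[symmetric])
    qed
    also have "Q powr (- \<epsilon>) = 2 powr (- \<epsilon> * real n)"
      by (simp add: Q_def powr_powr mult.commute flip: powr_realpow)
    finally show ?thesis .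
  qed
  define cost where "cost = (\<lambda>n::nat. (real n * \<rho> / 2 + 1) * (B * 2 powr (- \<epsilon> * real n)))"
  have Ec: "hausdorff_content s (E n) \<le> ennreal (cost n)" for n
  proof -
    have "hausdorff_content s (E n) \<le> hausdorff_content s (\<Union>k\<in>{..k0 n}. \<Union>w\<in>P n k. T1 n k w \<union> T2 n k w)"
      using cover by (rule hausdorff_content_mono)
    also have "\<dots> \<le> (\<Sum>k\<le>k0 n. hausdorff_content s (\<Union>w\<in>P n k. T1 n k w \<union> T2 n k w))"
      by (rule hausdorff_content_finite_UN_le) simp
    also have "\<dots> \<le> (\<Sum>k\<le>k0 n. \<Sum>w\<in>P n k. hausdorff_content s (T1 n k w \<union> T2 n k w))"
      by (intro sum_mono hausdorff_content_finite_UN_le finP)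
    also have "\<dots> \<le> (\<Sum>k\<le>k0 n. \<Sum>w\<in>P n k. ennreal (2 * (D * d n k) powr s))"
      by (intro sum_mono T)
    also have "\<dots> = (\<Sum>k\<le>k0 n. ennreal (real (card (P n k)) * (2 * (D * d n k) powr s)))"
      by (intro sum.cong refl) (simp add: ennreal_mult ennreal_of_nat_eq_real_of_nat)
    also have "\<dots> \<le> (\<Sum>k\<le>k0 n. ennreal (B * 2 powr (- \<epsilon> * real n)))"
      by (intro sum_mono ennreal_leI term_le) auto
    also have "\<dots> = ennreal (real (k0 n + 1) * (B * 2 powr (- \<epsilon> * real n)))"
      using B by (simp add: ennreal_mult ennreal_of_nat_eq_real_of_nat flip: ennreal_plus)
    also have "\<dots> \<le> ennreal (cost n)"
      unfolding cost_def
    proof (intro ennreal_leI mult_right_mono)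
      have "0 \<le> real n * \<rho> / 2" using s by simp
      from of_nat_floor[OF this] show "real (k0 n + 1) \<le> real n * \<rho> / 2 + 1" unfolding k0_def by linarith
    qed (use B in auto)
    finally show ?thesis .
  qed
  show ?thesis
  proof (rule hausdorff_content_null_limsup[of s E cost])
    show "hausdorff_content s (E n) \<le> ennreal (cost n)" for n by (rule Ec)
    show "0 \<le> cost n" for n using B s by (simp add: cost_def)
    show "summable cost"
    proof (rule summable_comparison_test_ev)
      \<comment> \<open>\<open>B\<close> is only known to be nonnegative; B + 1 gives a positive
        constant for the asymptotic comparison.\<close>
      have "\<forall>\<^sub>F n in sequentially. (real n * \<rho> / 2 + 1) * ((B + 1) * 2 powr (- \<epsilon> * real n)) \<le> 1 / real n ^ 2"
        using s \<epsilon> B by real_asymp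
      moreover have "norm (cost n) \<le> (real n * \<rho> / 2 + 1) * ((B + 1) * 2 powr (- \<epsilon> * real n))" for n
        using B s by (simp add: cost_def mult_left_mono mult_right_mono)
      ultimately show "\<forall>\<^sub>F n in sequentially. norm (cost n) \<le> inverse (real n ^ 2)"
        by (auto elim!: eventually_mono simp: inverse_eq_divide intro: order.trans)
      show "summable (\<lambda>n. inverse (real n ^ 2))" by (rule inverse_power_summable) simp
    qed
    fix x assume x: "x \<in> {x \<in> {a..b}. infinite {q::nat. q > 0 \<and>
      dist_int (real q * x) * dist_int (real q * f x) < real q powr - \<rho>}}"
    show "infinite {n. x \<in> E n}"
    proof
      assume "finite {n. x \<in> E n}"
      then obtain N where N: "\<And>n. x \<in> E n \<Longrightarrow> n \<le> N"
        by (metis (mono_tags) finite_nat_set_iff_bounded_le mem_Collect_eq)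
      \<comment> \<open>Each dyadic range is finite, so infinitely many q force infinitely many
        n.\<close>
      have "{q::nat. q > 0 \<and> dist_int (real q * x) * dist_int (real q * f x) < real q powr - \<rho>} \<subseteq> {..2 ^ Suc N}"
      proof (rule subsetI)
        fix q :: nat assume "q \<in> {q. q > 0 \<and> dist_int (real q * x) * dist_int (real q * f x) < real q powr - \<rho>}"
        then have q: "0 < q" "dist_int (real q * x) * dist_int (real q * f x) < real q powr - \<rho>" by auto
        obtain n where n: "2 ^ n \<le> q" "q < 2 ^ Suc n"
          using ex_power_ivl1[of 2 q] q by auto
        then have "x \<in> E n" using x q by (auto simp: E_def)
        then have "n \<le> N" by (rule N)
        then have "(2::nat) ^ Suc n \<le> 2 ^ Suc N" by (intro power_increasing) auto
        from less_le_trans[OF n(2) this] show "q \<in> {..2 ^ Suc N}" by (simp only: atMost_iff less_imp_le)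
      qed
      then show False using x finite_subset by blast
    qed
  qed
qed

section \<open>From small arcs to the whole graph\<close>

text \<open>By the Lindelof property countably many of the neighbourhoods suffice. The map is
  included since the graph is Lipschitz only locally.\<close>

lemma hausdorff_content_null_local:
  fixes S :: "real set"
  assumes "\<And>x. x \<in> S \<Longrightarrow> \<exists>T. open T \<and> x \<in> T \<and> hausdorff_content s (\<phi> ` (S \<inter> T)) = 0"
  shows "hausdorff_content s (\<phi> ` S) = 0"
proof -
  define \<F> where "\<F> = {T. open T \<and> hausdorff_content s (\<phi> ` (S \<inter> T)) = 0}"
  obtain \<F>' where F': "\<F>' \<subseteq> \<F>" "countable \<F>'" "\<Union>\<F>' = \<Union>\<F>"
    using Lindelof[of \<F>] by (auto simp: \<F>_def)
  have "S \<subseteq> \<Union>\<F>" using assms by (auto simp: \<F>_def)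
  then have "\<phi> ` S \<subseteq> (\<Union>T\<in>\<F>'. \<phi> ` (S \<inter> T))" using F'(3) by blast
  then have "hausdorff_content s (\<phi> ` S) \<le> hausdorff_content s (\<Union>T\<in>\<F>'. \<phi> ` (S \<inter> T))"
    by (rule hausdorff_content_mono)
  also have "\<dots> = 0"
    using F' by (intro hausdorff_content_null_countable_UN) (auto simp: \<F>_def)
  finally show ?thesis by simp
qed

lemma interval_local_left:
  fixes I :: "real set"
  assumes I: "is_interval I" "x \<in> I" and e: "0 < e"
  shows "\<exists>a t. a \<in> I \<and> a \<le> x \<and> x - e < a \<and> t < x \<and> (\<forall>y\<in>I. t < y \<longrightarrow> a \<le> y) \<and>
    (a = x \<longrightarrow> (\<forall>y\<in>I. x \<le> y))"
proof (cases "\<exists>y\<in>I. y < x")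
  case True
  then obtain y where y: "y \<in> I" "y < x" by blast
  define a where "a = max y (x - e / 2)"
  have "a \<in> I" using mem_is_interval_1_I[OF I(1) y(1) I(2), of a] y e by (auto simp: a_def)
  then show ?thesis using y e by (intro exI[of _ a]) (auto simp: a_def)
next
  case False
  then show ?thesis using I e by (intro exI[of _ x] exI[of _ "x - 1"]) (auto simp: not_less)
qed

text \<open>If x is an endpoint of I, the compact interval is one-sided there, yet contains a
  relative neighbourhood of x. The right end comes from reflecting I; nondegeneracy prevents both
  ends from being x.\<close>

lemma interval_local:
  fixes I :: "real set"
  assumes I: "nondegenerate_interval I" "x \<in> I" and e: "0 < e"
  shows "\<exists>a b T. a < b \<and> {a..b} \<subseteq> I \<and> (\<forall>y\<in>{a..b}. \<bar>y - x\<bar> < e) \<and> open T \<and> x \<in> T \<and> T \<inter> I \<subseteq> {a..b}"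
proof -
  have int: "is_interval I" using I by (simp add: nondegenerate_interval_def)
  have int': "is_interval (uminus ` I)" using int by simp
  obtain a t where a: "a \<in> I" "a \<le> x" "x - e < a" "t < x" "\<forall>y\<in>I. t < y \<longrightarrow> a \<le> y"
      "a = x \<longrightarrow> (\<forall>y\<in>I. x \<le> y)"
    using interval_local_left[OF int I(2) e] by blast
  have "- x \<in> uminus ` I" using I(2) by simp
  from interval_local_left[OF int' this e]
  obtain b0 t0 where b0: "b0 \<in> uminus ` I" "b0 \<le> - x" "- x - e < b0" "t0 < - x"
      "\<forall>y\<in>uminus ` I. t0 < y \<longrightarrow> b0 \<le> y" "b0 = - x \<longrightarrow> (\<forall>y\<in>uminus ` I. - x \<le> y)"
    by blast
  define b where "b = - b0"
  define t1 where "t1 = - t0"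
  have b: "b \<in> I" "x \<le> b" "b < x + e" "x < t1"
    using b0(1-4) by (auto simp: b_def t1_def)
  have b5: "y \<le> b" if "y \<in> I" "y < t1" for y
    using bspec[OF b0(5), of "- y"] that by (auto simp: b_def t1_def)
  have b6: "y \<le> x" if "y \<in> I" "b = x" for y
    using b0(6) that by (auto simp: b_def)
  have "a \<noteq> x \<or> b \<noteq> x"
  proof (rule ccontr)
    assume "\<not> ?thesis"
    then have "y = x" if "y \<in> I" for y using a(6) b6[OF that] that by (metis antisym)
    then show False using I(1) unfolding nondegenerate_interval_def by (metis less_irrefl)
  qed
  then have "a < b" using a(2) b(2) by auto
  moreover have "{a..b} \<subseteq> I" using mem_is_interval_1_I[OF int a(1) b(1)] by auto
  moreover have "{t<..<t1} \<inter> I \<subseteq> {a..b}" using a(5) b5 by auto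
  moreover have "\<forall>y\<in>{a..b}. \<bar>y - x\<bar> < e" using a(3) b(3) by auto
  ultimately show ?thesis using a(4) b(4) by (intro exI[of _ a] exI[of _ b] exI[of _ "{t<..<t1}"]) auto
qed

lemma C_3_on_derivatives:
  assumes "f \<in> C_n_on 3 I"
  shows "x \<in> I \<Longrightarrow> (f has_real_derivative iter_deriv_on I 1 f x) (at x within I)"
    and "x \<in> I \<Longrightarrow> (iter_deriv_on I 1 f has_real_derivative iter_deriv_on I 2 f x) (at x within I)"
    and "continuous_on I (iter_deriv_on I 1 f)" "continuous_on I (iter_deriv_on I 2 f)"
proof -
  have d: "iter_deriv_on I k f differentiable_on I" if "k < 3" for k
    using assms that by (auto simp: C_n_on_def)
  have step: "(iter_deriv_on I k f has_real_derivative iter_deriv_on I (Suc k) f x) (at x within I)"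
    if "x \<in> I" "k < 3" for k x
    using d[OF that(2)] that(1)
    by (simp add: differentiable_on_def vector_derivative_works has_real_derivative_iff_has_vector_derivative)
  show "x \<in> I \<Longrightarrow> (f has_real_derivative iter_deriv_on I 1 f x) (at x within I)"
    using step[of x 0] by simp
  show "x \<in> I \<Longrightarrow> (iter_deriv_on I 1 f has_real_derivative iter_deriv_on I 2 f x) (at x within I)"
    using step[of x 1] by (simp add: numeral_2_eq_2)
  show "continuous_on I (iter_deriv_on I 1 f)" "continuous_on I (iter_deriv_on I 2 f)"
    by (rule differentiable_imp_continuous_on[OF d], simp)+
qed

text \<open>The set splits by the zeros of f'' and f': where f'' = 0 the assumption \<open>Z\<close>
  applies, where only f' = 0 the points are isolated, and elsewhere the estimate on one arc holds.
  On small compact intervals the graph map is Lipschitz and preserves null sets.\<close>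

lemma graph_mult_approx_content_null:
  assumes I: "nondegenerate_interval I" and f: "f \<in> C_n_on 3 I"
    and s: "0 < s" "s \<le> 1" "0 < \<rho>" "s * \<rho> \<le> 2" "2 < s * (1 + \<rho>)"
    and Z: "hausdorff_content s {x \<in> I. iter_deriv_on I 2 f x = 0} = 0"
  shows "hausdorff_content s ((\<lambda>x. (x, f x)) ` {x \<in> I. infinite {q::nat. q > 0 \<and>
    dist_int (real q * x) * dist_int (real q * f x) < real q powr - \<rho>}}) = 0"
proof -
  define f1 where "f1 = iter_deriv_on I 1 f"
  define f2 where "f2 = iter_deriv_on I 2 f"
  define \<phi> where "\<phi> = (\<lambda>x. (x, f x))"
  define E where "E = {x \<in> I. infinite {q::nat. q > 0 \<and>
    dist_int (real q * x) * dist_int (real q * f x) < real q powr - \<rho>}}"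
  note D = C_3_on_derivatives[OF f, folded f1_def f2_def]
  have loc: "\<exists>a b T. a < b \<and> {a..b} \<subseteq> I \<and> open T \<and> x \<in> T \<and> T \<inter> I \<subseteq> {a..b} \<and>
      (\<forall>y\<in>{a..b}. \<bar>f1 y - f1 x\<bar> < e1 \<and> \<bar>f2 y - f2 x\<bar> < e2 \<and>
        (f has_real_derivative f1 y) (at y within {a..b}) \<and> (f1 has_real_derivative f2 y) (at y within {a..b}))"
    if x: "x \<in> I" and e12: "0 < e1" "0 < e2" for x e1 e2
  proof -
    obtain d1 where d1: "d1 > 0" "\<forall>y\<in>I. \<bar>y - x\<bar> < d1 \<longrightarrow> \<bar>f1 y - f1 x\<bar> < e1"
      using D(3)[unfolded continuous_on_iff dist_real_def, rule_format, OF x e12(1)] by blast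
    obtain d2 where d2: "d2 > 0" "\<forall>y\<in>I. \<bar>y - x\<bar> < d2 \<longrightarrow> \<bar>f2 y - f2 x\<bar> < e2"
      using D(4)[unfolded continuous_on_iff dist_real_def, rule_format, OF x e12(2)] by blast
    have "0 < min d1 d2" using d1 d2 by simp
    then obtain a b T where *: "a < b" "{a..b} \<subseteq> I" "\<forall>y\<in>{a..b}. \<bar>y - x\<bar> < min d1 d2"
        "open T" "x \<in> T" "T \<inter> I \<subseteq> {a..b}"
      using interval_local[OF I x] by blast
    have "\<bar>f1 y - f1 x\<bar> < e1 \<and> \<bar>f2 y - f2 x\<bar> < e2 \<and>
        (f has_real_derivative f1 y) (at y within {a..b}) \<and> (f1 has_real_derivative f2 y) (at y within {a..b})"
      if y: "y \<in> {a..b}" for y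
    proof -
      have yI: "y \<in> I" using y *(2) by blast
      have "\<bar>y - x\<bar> < d1" "\<bar>y - x\<bar> < d2" using bspec[OF *(3) y] by simp_all
      then show ?thesis
        using d1(2) d2(2) yI has_field_derivative_subset[OF D(1)[OF yI] *(2)]
          has_field_derivative_subset[OF D(2)[OF yI] *(2)] by blast
    qed
    then show ?thesis using * by blast
  qed
  have lip: "hausdorff_content s (\<phi> ` S) = 0"
    if S: "S \<subseteq> {a..b}" "hausdorff_content s S = 0" and d: "\<And>y. y \<in> {a..b} \<Longrightarrow> (f has_real_derivative f1 y) (at y within {a..b})"
      and M: "\<And>y. y \<in> {a..b} \<Longrightarrow> \<bar>f1 y - u\<bar> < e1" for S a b u e1
  proof (rule hausdorff_content_Lipschitz_image_null[OF s(1) _ S(2)])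
    fix x y assume xy: "x \<in> S" "y \<in> S"
    then have xy': "x \<in> {a..b}" "y \<in> {a..b}" using S(1) by blast+
    obtain \<xi> where "\<xi> \<in> {a..b}" "f y - f x = f1 \<xi> * (y - x)"
      by (rule mvt_between[OF d xy']) (assumption, rule that)
    then have "\<bar>f y - f x\<bar> \<le> (\<bar>u\<bar> + e1) * \<bar>y - x\<bar>"
      using M[of \<xi>] by (simp add: abs_mult) (intro mult_right_mono, auto)
    moreover have "dist (\<phi> x) (\<phi> y) \<le> \<bar>y - x\<bar> + \<bar>f y - f x\<bar>"
      unfolding \<phi>_def dist_Pair_Pair
      by (rule order.trans[OF sqrt_sum_squares_le_sum]) (auto simp: dist_real_def)
    ultimately show "dist (\<phi> x) (\<phi> y) \<le> (1 + (\<bar>u\<bar> + e1)) * dist x y"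
      by (simp add: dist_real_def abs_minus_commute algebra_simps)
  qed
  define E1 where "E1 = {x \<in> E. f2 x = 0}"
  define E2 where "E2 = {x \<in> E. f2 x \<noteq> 0 \<and> f1 x = 0}"
  define E3 where "E3 = {x \<in> E. f2 x \<noteq> 0 \<and> f1 x \<noteq> 0}"
  have sub: "E1 \<subseteq> I" "E2 \<subseteq> I" "E3 \<subseteq> I" by (auto simp: E1_def E2_def E3_def E_def)
  have n1: "hausdorff_content s (\<phi> ` E1) = 0"
  proof (rule hausdorff_content_null_local)
    fix x assume x: "x \<in> E1"
    then have xI: "x \<in> I" using sub by blast
    obtain a b T where T: "a < b" "{a..b} \<subseteq> I" "open T" "x \<in> T" "T \<inter> I \<subseteq> {a..b}"
      and B: "\<forall>y\<in>{a..b}. \<bar>f1 y - f1 x\<bar> < 1 \<and> \<bar>f2 y - f2 x\<bar> < 1 \<and>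
        (f has_real_derivative f1 y) (at y within {a..b}) \<and> (f1 has_real_derivative f2 y) (at y within {a..b})"
      using loc[OF xI zero_less_one zero_less_one] by (elim exE conjE) (rule that)
    have f1b: "\<bar>f1 y - f1 x\<bar> < 1" and df: "(f has_real_derivative f1 y) (at y within {a..b})"
      if "y \<in> {a..b}" for y using bspec[OF B that] by blast+
    have "hausdorff_content s (E1 \<inter> T) \<le> hausdorff_content s {x \<in> I. f2 x = 0}"
      by (rule hausdorff_content_mono) (auto simp: E1_def E_def)
    then have "hausdorff_content s (E1 \<inter> T) = 0" using Z by (simp add: f2_def)
    then have "hausdorff_content s (\<phi> ` (E1 \<inter> T)) = 0"
      using T(5) sub by (intro lip[OF _ _ df f1b]) auto
    then show "\<exists>T. open T \<and> x \<in> T \<and> hausdorff_content s (\<phi> ` (E1 \<inter> T)) = 0" using T by blast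
  qed
  have n2: "hausdorff_content s (\<phi> ` E2) = 0"
  proof (rule hausdorff_content_null_local)
    fix x assume x: "x \<in> E2"
    then have pos: "0 < \<bar>f2 x\<bar>" by (auto simp: E2_def)
    have xI: "x \<in> I" using x sub by blast
    obtain a b T where T: "a < b" "{a..b} \<subseteq> I" "open T" "x \<in> T" "T \<inter> I \<subseteq> {a..b}"
      and B: "\<forall>y\<in>{a..b}. \<bar>f1 y - f1 x\<bar> < 1 \<and> \<bar>f2 y - f2 x\<bar> < \<bar>f2 x\<bar> \<and>
        (f has_real_derivative f1 y) (at y within {a..b}) \<and> (f1 has_real_derivative f2 y) (at y within {a..b})"
      using loc[OF xI zero_less_one pos] by (elim exE conjE) (rule that)
    have f2b: "\<bar>f2 y - f2 x\<bar> < \<bar>f2 x\<bar>" and df1: "(f1 has_real_derivative f2 y) (at y within {a..b})"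
      if "y \<in> {a..b}" for y using bspec[OF B that] by blast+
    \<comment> \<open>Near x the second derivative keeps away from 0, so f' is injective there and x
      is its only zero.\<close>
    have "E2 \<inter> T \<subseteq> {x}"
    proof
      fix y assume y: "y \<in> E2 \<inter> T"
      have xy: "x \<in> {a..b}" "y \<in> {a..b}" using y x xI sub T(4,5) by blast+
      obtain \<xi> where \<xi>: "\<xi> \<in> {a..b}" "f1 y - f1 x = f2 \<xi> * (y - x)"
        by (rule mvt_between[OF df1 xy]) (assumption, rule that)
      moreover have "f2 \<xi> \<noteq> 0" using f2b[OF \<xi>(1)] by auto
      ultimately show "y \<in> {x}" using x y by (auto simp: E2_def)
    qed
    then have "\<phi> ` (E2 \<inter> T) \<subseteq> {\<phi> x}" by auto
    then have "hausdorff_content s (\<phi> ` (E2 \<inter> T)) \<le> hausdorff_content s {\<phi> x}" by (rule hausdorff_content_mono)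
    also have "\<dots> \<le> diam_pow s {\<phi> x}" by (rule hausdorff_content_le_diam_pow) simp
    also have "\<dots> = 0" using s by (simp add: diam_pow_pos_exponent)
    finally show "\<exists>T. open T \<and> x \<in> T \<and> hausdorff_content s (\<phi> ` (E2 \<inter> T)) = 0" using T by auto
  qed
  have n3: "hausdorff_content s (\<phi> ` E3) = 0"
  proof (rule hausdorff_content_null_local)
    fix x assume x: "x \<in> E3"
    define c where "c = \<bar>f2 x\<bar> / 2"
    define m where "m = \<bar>f1 x\<bar> / 2"
    have cm: "0 < c" "0 < m" using x by (auto simp: E3_def c_def m_def)
    have xI: "x \<in> I" using x sub by blast
    obtain a b T where T: "a < b" "{a..b} \<subseteq> I" "open T" "x \<in> T" "T \<inter> I \<subseteq> {a..b}"
      and B: "\<forall>y\<in>{a..b}. \<bar>f1 y - f1 x\<bar> < m \<and> \<bar>f2 y - f2 x\<bar> < c \<and>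
        (f has_real_derivative f1 y) (at y within {a..b}) \<and> (f1 has_real_derivative f2 y) (at y within {a..b})"
      using loc[OF xI cm(2,1)] by (elim exE conjE) (rule that)
    have f1b: "\<bar>f1 y - f1 x\<bar> < m" and f2b: "\<bar>f2 y - f2 x\<bar> < c"
      and df: "(f has_real_derivative f1 y) (at y within {a..b})"
      and df1: "(f1 has_real_derivative f2 y) (at y within {a..b})"
      if "y \<in> {a..b}" for y using bspec[OF B that] by blast+
    have m': "m \<le> \<bar>f1 y\<bar>" if "y \<in> {a..b}" for y using f1b[OF that] unfolding m_def by linarith
    have neg: "((\<lambda>x. - f x) has_real_derivative - f1 y) (at y within {a..b})"
        "((\<lambda>x. - f1 x) has_real_derivative - f2 y) (at y within {a..b})" if "y \<in> {a..b}" for y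
      using df[OF that] df1[OF that] by (auto intro!: derivative_eq_intros)
    have "hausdorff_content s {x \<in> {a..b}. infinite {q::nat. q > 0 \<and>
        dist_int (real q * x) * dist_int (real q * f x) < real q powr - \<rho>}} = 0"
    proof (cases "f2 x > 0")
      case True
      have c': "c \<le> f2 y \<and> f2 y \<le> 3 * c" if "y \<in> {a..b}" for y
        using f2b[OF that] True unfolding c_def by linarith
      show ?thesis
        by (rule mult_approx_content_null_on_interval[OF T(1) cm(1) df df1 c' cm(2) m' s])
    next
      case False
      \<comment> \<open>A concave arc is treated through -f; distances to the nearest integer do not
        change.\<close>
      have c': "c \<le> - f2 y \<and> - f2 y \<le> 3 * c" if "y \<in> {a..b}" for y
        using f2b[OF that] False unfolding c_def by linarith
      have m'': "m \<le> \<bar>- f1 y\<bar>" if "y \<in> {a..b}" for y using m'[OF that] by simp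
      show ?thesis
        using mult_approx_content_null_on_interval[OF T(1) cm(1) neg(1,2) c' cm(2) m'' s]
        by (simp add: dist_int_minus)
    qed
    moreover have "hausdorff_content s (E3 \<inter> T) \<le> hausdorff_content s {x \<in> {a..b}. infinite {q::nat. q > 0 \<and>
        dist_int (real q * x) * dist_int (real q * f x) < real q powr - \<rho>}}"
      using T(5) by (intro hausdorff_content_mono) (auto simp: E3_def E_def)
    ultimately have "hausdorff_content s (E3 \<inter> T) = 0" by simp
    then have "hausdorff_content s (\<phi> ` (E3 \<inter> T)) = 0"
      using T(5) sub by (intro lip[OF _ _ df f1b]) auto
    then show "\<exists>T. open T \<and> x \<in> T \<and> hausdorff_content s (\<phi> ` (E3 \<inter> T)) = 0" using T by blast
  qed
  have "hausdorff_content s (\<phi> ` E2 \<union> \<phi> ` E3) = 0"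
    using hausdorff_content_Un_le[of s "\<phi> ` E2" "\<phi> ` E3"] n2 n3 by simp
  then have null: "hausdorff_content s (\<phi> ` E1 \<union> (\<phi> ` E2 \<union> \<phi> ` E3)) = 0"
    using hausdorff_content_Un_le[of s "\<phi> ` E1" "\<phi> ` E2 \<union> \<phi> ` E3"] n1 by simp
  have "E \<subseteq> E1 \<union> (E2 \<union> E3)"
    unfolding E1_def E2_def E3_def by blast
  then have "\<phi> ` E \<subseteq> \<phi> ` E1 \<union> (\<phi> ` E2 \<union> \<phi> ` E3)"
    unfolding image_Un[symmetric] by (rule image_mono)
  from hausdorff_content_mono[OF this, of s] null have "hausdorff_content s (\<phi> ` E) = 0" by simp
  then show ?thesis unfolding \<phi>_def E_def .
qed

section \<open>Comparison with powers and the dimension formula\<close>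

lemma has_order_eventually:
  assumes "approximating_function \<psi>" "has_order \<psi> l"
  shows "\<rho> < l \<Longrightarrow> \<forall>\<^sub>F q::nat in sequentially. \<psi> (real q) \<le> real q powr - \<rho>"
    and "l < \<rho> \<Longrightarrow> \<forall>\<^sub>F q::nat in sequentially. real q powr - \<rho> \<le> \<psi> (real q)"
proof -
  have lim: "(\<lambda>q::nat. - ln (\<psi> (real q)) / ln (real q)) \<longlonglongrightarrow> l"
    using assms(2) unfolding has_order_def
    by (auto intro: filterlim_compose[OF _ filterlim_real_sequentially])
  have big: "\<forall>\<^sub>F q::nat in sequentially. 1 < real q" by real_asymp
  have pos: "0 < \<psi> h" if "0 < h" for h using assms(1) that by (simp add: approximating_function_def)
  { assume "\<rho> < l"
    from order_tendstoD(1)[OF lim this] big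
    show "\<forall>\<^sub>F q::nat in sequentially. \<psi> (real q) \<le> real q powr - \<rho>"
    proof eventually_elim
      case (elim q)
      then have "0 < ln (real q)" by simp
      from elim(1) have "\<rho> * ln (real q) < - ln (\<psi> (real q))" unfolding pos_less_divide_eq[OF \<open>0 < ln (real q)\<close>] .
      then have "ln (\<psi> (real q)) \<le> ln (real q powr - \<rho>)" using elim by (simp add: ln_powr)
      moreover have a: "0 < \<psi> (real q)" and b: "0 < real q powr - \<rho>" using elim pos[of "real q"] by auto
      ultimately show ?case unfolding ln_le_cancel_iff[OF a b] by blast
    qed }
  { assume "l < \<rho>"
    from order_tendstoD(2)[OF lim this] big
    show "\<forall>\<^sub>F q::nat in sequentially. real q powr - \<rho> \<le> \<psi> (real q)"
    proof eventually_elim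
      case (elim q)
      then have "0 < ln (real q)" by simp
      from elim(1) have "- ln (\<psi> (real q)) < \<rho> * ln (real q)" unfolding pos_divide_less_eq[OF \<open>0 < ln (real q)\<close>] .
      then have "ln (real q powr - \<rho>) \<le> ln (\<psi> (real q))" using elim by (simp add: ln_powr)
      moreover have a: "0 < \<psi> (real q)" and b: "0 < real q powr - \<rho>" using elim pos[of "real q"] by auto
      ultimately show ?case unfolding ln_le_cancel_iff[OF b a] by blast
    qed }
qed

lemma infinite_eventually_imp:
  assumes "infinite {q::nat. P q}" "\<forall>\<^sub>F q in sequentially. P q \<longrightarrow> R q"
  shows "infinite {q. R q}"
proof -
  obtain N where N: "\<And>q. q \<ge> N \<Longrightarrow> P q \<Longrightarrow> R q" using assms(2) unfolding eventually_sequentially by blast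
  have "{q. P q} \<subseteq> {q. R q} \<union> {..<N}" using N by (auto simp: not_less)
  then show ?thesis using assms(1) by (meson finite_Un finite_lessThan finite_subset)
qed

theorem mainTheorem7:
  fixes I\<^sub>0 :: "real set" and f \<psi> :: "real \<Rightarrow> real" and l :: real
  assumes "nondegenerate_interval I\<^sub>0"
    and "f \<in> C_n_on 3 I\<^sub>0"
    and "approximating_function \<psi>"
    and "has_order \<psi> l" and "l > 1"
    and "hausdorff_dim {x \<in> I\<^sub>0. iter_deriv_on I\<^sub>0 2 f x = 0} \<le> ereal (2 / (1 + l))"
  shows "hausdorff_dim (graph_on f I\<^sub>0 \<inter> mult_approx_set \<psi>) = ereal (2 / (1 + l))"
proof (rule antisym)
  let ?S = "graph_on f I\<^sub>0 \<inter> mult_approx_set \<psi>"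
  note l = \<open>l > 1\<close>
  show "hausdorff_dim ?S \<le> ereal (2 / (1 + l))"
  proof (rule hausdorff_dim_leI)
    \<comment> \<open>The upper end secures s <= 1 and, through \<rho> < l, also s \<rho> <= 2. It
      exceeds 2 / (1 + l) because l > 1.\<close>
    show "0 \<le> 2 / (1 + l)" "2 / (1 + l) < min 1 (2 / l)" using l by (auto simp: field_simps)
    fix s assume s: "2 / (1 + l) < s" "s < min 1 (2 / l)"
    have s0: "0 < s" using s(1) l by (meson divide_pos_pos less_trans zero_less_numeral add_pos_pos zero_less_one)
    have "2 / s - 1 < l" using s(1) s0 l by (simp add: field_simps)
    \<comment> \<open>Below l, so that \<psi>(q) is eventually at most q^-\<rho>; above 2 / s - 1,
      so that s (1 + \<rho>) > 2.\<close>
    then obtain \<rho> where \<rho>: "2 / s - 1 < \<rho>" "\<rho> < l" using dense by blast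
    have "1 \<le> 2 / s - 1" using s s0 by (simp add: field_simps)
    then have "0 < \<rho>" using \<rho> by linarith
    moreover have "2 < s * (1 + \<rho>)" using \<rho>(1) s0 by (simp add: field_simps)
    moreover have "s * \<rho> \<le> 2"
    proof -
      have "s * \<rho> \<le> s * l" using \<rho> s0 by (intro mult_left_mono) auto
      also have "\<dots> \<le> 2" using s(2) l by (simp add: field_simps)
      finally show ?thesis .
    qed
    moreover have "hausdorff_content s {x \<in> I\<^sub>0. iter_deriv_on I\<^sub>0 2 f x = 0} = 0"
      using assms(6) s(1) by (intro hausdorff_content_null_above_dim) (auto intro: order.strict_trans1)
    ultimately have null: "hausdorff_content s ((\<lambda>x. (x, f x)) ` {x \<in> I\<^sub>0. infinite {q::nat. q > 0 \<and>
        dist_int (real q * x) * dist_int (real q * f x) < real q powr - \<rho>}}) = 0"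
      using s s0 by (intro graph_mult_approx_content_null[OF assms(1,2)]) auto
    have ev: "\<forall>\<^sub>F q::nat in sequentially. \<psi> (real q) \<le> real q powr - \<rho>"
      by (rule has_order_eventually(1)[OF assms(3,4) \<rho>(2)])
    have "?S \<subseteq> (\<lambda>x. (x, f x)) ` {x \<in> I\<^sub>0. infinite {q::nat. q > 0 \<and>
        dist_int (real q * x) * dist_int (real q * f x) < real q powr - \<rho>}}"
    proof clarify
      fix x y assume "(x, y) \<in> graph_on f I\<^sub>0" "(x, y) \<in> mult_approx_set \<psi>"
      then have x: "x \<in> I\<^sub>0" "y = f x"
        and inf: "infinite {q::nat. q > 0 \<and> dist_int (real q * x) * dist_int (real q * f x) < \<psi> (real q)}"
        by (auto simp: graph_on_def mult_approx_set_def)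
      have "infinite {q::nat. q > 0 \<and> dist_int (real q * x) * dist_int (real q * f x) < real q powr - \<rho>}"
        by (rule infinite_eventually_imp[OF inf]) (use ev in \<open>auto elim!: eventually_mono\<close>)
      then show "(x, y) \<in> (\<lambda>x. (x, f x)) ` {x \<in> I\<^sub>0. infinite {q::nat. q > 0 \<and>
        dist_int (real q * x) * dist_int (real q * f x) < real q powr - \<rho>}}" using x by blast
    qed
    from hausdorff_content_mono[OF this, of s] null show "hausdorff_content s ?S = 0" by simp
  qed
  show "ereal (2 / (1 + l)) \<le> hausdorff_dim ?S"
  proof (rule hausdorff_dim_geI)
    fix s assume s: "0 < s" "s < 2 / (1 + l)"
    have "l < 2 / s - 1" using s l by (simp add: field_simps)
    \<comment> \<open>The opposite choice: q^-\<rho> is eventually at most \<psi>(q), and s (1 +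
      \<rho>) < 2.\<close>
    then obtain \<rho> where \<rho>: "l < \<rho>" "\<rho> < 2 / s - 1" using dense by blast
    have \<rho>': "1 \<le> \<rho>" "s * (1 + \<rho>) < 2" using \<rho> l s by (auto simp: field_simps)
    obtain a b where ab: "a \<in> I\<^sub>0" "b \<in> I\<^sub>0" "a < b" and int: "is_interval I\<^sub>0"
      using assms(1) by (auto simp: nondegenerate_interval_def)
    have ev: "\<forall>\<^sub>F q::nat in sequentially. real q powr - \<rho> \<le> \<psi> (real q)"
      by (rule has_order_eventually(2)[OF assms(3,4) \<rho>(1)])
    \<comment> \<open>The projection to the first coordinate is 1-Lipschitz, so a null set on the
      graph would have a null projection.\<close>
    have sub: "{x \<in> {a..b}. infinite {q::nat. q > 0 \<and> dist_int (real q * x) < real q powr - \<rho>}} \<subseteq> fst ` ?S"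
    proof clarify
      fix x assume x: "x \<in> {a..b}"
        and inf: "infinite {q::nat. q > 0 \<and> dist_int (real q * x) < real q powr - \<rho>}"
      have le: "dist_int (real q * x) * dist_int (real q * f x) \<le> dist_int (real q * x)" for q :: nat
      proof -
        have "dist_int (real q * f x) \<le> 1" using dist_int_le_half[of "real q * f x"] by linarith
        then show ?thesis using dist_int_nonneg[of "real q * x"] by (simp add: mult_left_le)
      qed
      have "infinite {q::nat. q > 0 \<and> dist_int (real q * x) * dist_int (real q * f x) < \<psi> (real q)}"
        by (rule infinite_eventually_imp[OF inf])
           (use ev le in \<open>auto elim!: eventually_mono intro: order.strict_trans1 order.strict_trans2\<close>)
      moreover have "x \<in> I\<^sub>0" using mem_is_interval_1_I[OF int ab(1,2)] x by auto
      ultimately have "(x, f x) \<in> ?S" by (auto simp: graph_on_def mult_approx_set_def)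
      then show "x \<in> fst ` ?S" by (rule rev_image_eqI) simp
    qed
    show "hausdorff_content s ?S \<noteq> 0"
    proof
      assume "hausdorff_content s ?S = 0"
      then have "hausdorff_content s (fst ` ?S) = 0"
        using s(1) by (intro hausdorff_content_Lipschitz_image_null[where C = 1]) (auto simp: dist_fst_le)
      with hausdorff_content_mono[OF sub, of s]
      have "hausdorff_content s {x \<in> {a..b}. infinite {q::nat. q > 0 \<and> dist_int (real q * x) < real q powr - \<rho>}} = 0"
        by simp
      then show False using Jarnik_Besicovitch_content[OF ab(3) s(1) \<rho>'] by simp
    qed
  qed
qed

end
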